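(* There exists $n_0$ such that the following holds for all $n \ge n_0$. Suppose the complete bipartite graph $K_{n,n}$ is properly edge-coloured using $dn^2$ colours, where $d > n^{-1/200}$. Then $K_{n,n}$ contains a rainbow perfect matching.
   Context: A proper edge-colouring assigns colours to edges so that any two edges sharing a vertex receive different colours. A matching is rainbow if all its edges have distinct colours. A perfect matching in $K_{n,n}$ is a matching of $n$ edges covering all vertices. (Equivalently: any Latin array of order $n$ — an $n\times n$ array in which each symbol appears at most once in each row and each column — with at least $dn^2$ distinct symbols, $d>n^{-1/200}$, $n$ large, has a transversal.) *)

theory Defs
  imports Complex_Main "HOL-Library.Disjoint_Sets"
begin

text \<open>
  A (simple, undirected) graph is given by its vertex set and its edge set, where an edge
  is the two-element set of its endpoints.  The two sides of the complete bipartite graph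
  are the left and the right summand of the vertex type.
\<close>

definition complete_bipartite_verts :: "nat \<Rightarrow> (nat + nat) set" where
  "complete_bipartite_verts n = {..<n} <+> {..<n}"

definition complete_bipartite_edges :: "nat \<Rightarrow> (nat + nat) set set" where
  "complete_bipartite_edges n = {{Inl i, Inr j} | i j. i < n \<and> j < n}"

definition proper_edge_colouring :: "'v set set \<Rightarrow> ('v set \<Rightarrow> 'c) \<Rightarrow> bool" where
  "proper_edge_colouring E c \<longleftrightarrow>
     (\<forall>e\<in>E. \<forall>f\<in>E. e \<noteq> f \<and> e \<inter> f \<noteq> {} \<longrightarrow> c e \<noteq> c f)"

definition matching :: "'v set set \<Rightarrow> 'v set set \<Rightarrow> bool" where
  "matching E M \<longleftrightarrow> M \<subseteq> E \<and> disjoint M"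

definition rainbow :: "('v set \<Rightarrow> 'c) \<Rightarrow> 'v set set \<Rightarrow> bool" where
  "rainbow c M \<longleftrightarrow> inj_on c M"

definition perfect_matching :: "nat \<Rightarrow> (nat + nat) set set \<Rightarrow> bool" where
  "perfect_matching n M \<longleftrightarrow>
     matching (complete_bipartite_edges n) M \<and> card M = n \<and>
     \<Union>M = complete_bipartite_verts n"

end

theory Submission
  imports Defs "HOL-Real_Asymp.Real_Asymp"
begin

text \<open>
  Put $\<delta> = n^{-1/200}/2$.  At least $\<delta> n^2$ colours occur at most $1/\<delta>$ times; one cell of
  each of them gives a set $R$ of cells of density $\<delta>$ whose colours are pairwise distinct.  By the
  Balog--Szemeredi--Gowers argument there are large sets $A'$ of rows and $B'$ of columns such that each
  $(a, b)$ in $A' \<times> B'$ has many $e = (a', b')$ in $R$ with $(a, b')$ and $(a', b)$ in $R$: such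
  an $e$ absorbs $(a, b)$, since replacing $e$ by $(a, b')$ and $(a', b)$ covers $a$ and $b$ in addition.
  A random matching $Q$ in $R$, disjoint from small sets $A_0 \<subseteq> A'$ and $B_0 \<subseteq> B'$,
  contains many absorbers for every pair in $A_0 \<times> B_0$.  The array of the remaining rows and
  columns has more colours than needed: no colour occurs in almost all of its rows.  A random
  greedy matching (nibble) in it avoids the colours of $Q$, leaves only $O(n^{9/10})$ rows and columns
  uncovered, and uses every prescribed set of colours no more than expected.  Hence each
  uncovered row still has many cells in $B_0$ with unused colours, and likewise for uncovered columns and
  $A_0$; these are matched greedily.  What is left of $A_0$ and $B_0$ is paired arbitrarily and absorbed.
  Both random choices are derandomised: one bounds the average of an exponential potential over the
  possible next steps, and takes a step that does not exceed the average.
\<close>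

section \<open>Pseudorandom matchings in linear 3-graphs\<close>

text \<open>The obstacle is the link between the nibble and the absorption. An uncovered row has
  only m colours in B_0, where m = |B_0|, and the nibble could use up all of them if each occurred
  in every row of the remaining array. Deleting the lines of Q prevents this: with s = |Q|, a colour
  that fills almost all rows loses about two cells for each cell of Q, while the order of the array
  drops by one. So every colour falls short of the order k of the remaining array by at least s/4,
  the nibble is expected to use at most m (1 - s/(4k)) of the m colours, and the surplus m s/(4k)
  only has to beat its error n^(9/10). With \<beta> = \<delta>^5/4096, the density of absorbers, s
  is of order \<beta> n and m of order \<beta> s, so the surplus is of order \<beta>^3 n. Since
  \<beta> is of order n^(-5/200), this works because 15/200 < 1/10, which is where the exponent
  1/200 is spent. On the other side m must be small against the \<beta> s/8 absorbers of a pair, as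
  each absorption may spoil one of them.\<close>

locale linear_3_graph =
  fixes V :: "'v set" and E :: "'v set set" and N :: real
  assumes finite_V: "finite V"
    and edge_subset: "\<And>e. e \<in> E \<Longrightarrow> e \<subseteq> V"
    and edge_card: "\<And>e. e \<in> E \<Longrightarrow> card e = 3"
    and linear: "\<And>e f. e \<in> E \<Longrightarrow> f \<in> E \<Longrightarrow> e \<noteq> f \<Longrightarrow> card (e \<inter> f) \<le> 1"
    and N_pos: "N > 0"
    and degree_le: "\<And>v. v \<in> V \<Longrightarrow> real (card {e \<in> E. v \<in> e}) \<le> N"
begin

definition alive :: "'v set \<Rightarrow> 'v set set" where
  "alive S = {e \<in> E. e \<subseteq> S}"

definition deg :: "'v set \<Rightarrow> 'v \<Rightarrow> nat" where
  "deg S v = card {e \<in> alive S. v \<in> e}"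

definition weight :: "'v \<Rightarrow> real" where
  "weight v = real (card {e \<in> E. v \<in> e}) / N"

definition link :: "'v set \<Rightarrow> 'v \<Rightarrow> 'v set" where
  "link S v = \<Union>{e \<in> alive S. v \<in> e} - {v}"

lemma finite_E: "finite E"
proof (rule finite_subset)
  show "E \<subseteq> Pow V" using edge_subset by auto
qed (use finite_V in simp)

lemma finite_alive [simp]: "finite (alive S)"
  unfolding alive_def using finite_E by simp

lemma edge_finite: "e \<in> E \<Longrightarrow> finite e"
  using edge_subset finite_V finite_subset by blast

lemma weight_bounds: "v \<in> V \<Longrightarrow> 0 \<le> weight v \<and> weight v \<le> 1"
  unfolding weight_def using degree_le N_pos by simp

lemma alive_V: "alive V = E"
  unfolding alive_def using edge_subset by auto

lemma deg_V: "real (deg V v) = N * weight v"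
  unfolding deg_def weight_def alive_V using N_pos by simp

lemma edges_inter_at:
  assumes "e \<in> E" "f \<in> E" "e \<noteq> f" "v \<in> e" "v \<in> f"
  shows "e \<inter> f = {v}"
proof -
  have "finite (e \<inter> f)" using edge_finite assms by blast
  moreover have "card (e \<inter> f) \<le> 1" using linear assms by blast
  moreover have "v \<in> e \<inter> f" using assms by blast
  ultimately show ?thesis using card_le_Suc0_iff_eq[of "e \<inter> f"] by auto
qed

lemma link_subset: "link S v \<subseteq> S - {v}"
  unfolding link_def alive_def by auto

text \<open>By linearity the edges through \<open>v\<close> are disjoint away from \<open>v\<close>,
  and each contributes two further vertices.\<close>

lemma card_link:
  shows "card (link S v) = 2 * deg S v"
proof -
  let ?F = "{e \<in> alive S. v \<in> e}"
  have eq: "link S v = (\<Union>e\<in>?F. e - {v})" unfolding link_def by auto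
  have "card (\<Union>e\<in>?F. e - {v}) = (\<Sum>e\<in>?F. card (e - {v}))"
  proof (rule card_UN_disjoint)
    show "\<forall>i\<in>?F. finite (i - {v})" unfolding alive_def using edge_finite by auto
    show "\<forall>i\<in>?F. \<forall>j\<in>?F. i \<noteq> j \<longrightarrow> (i - {v}) \<inter> (j - {v}) = {}"
    proof (intro ballI impI)
      fix i j assume "i \<in> ?F" "j \<in> ?F" "i \<noteq> j"
      then have "i \<inter> j = {v}" using edges_inter_at[of i j v] unfolding alive_def by simp
      then show "(i - {v}) \<inter> (j - {v}) = {}" by auto
    qed
  qed simp
  also have "\<dots> = (\<Sum>e\<in>?F. 2)"
  proof (rule sum.cong)
    fix e assume "e \<in> ?F"
    then show "card (e - {v}) = 2" using edge_card[of e] edge_finite[of e] unfolding alive_def by simp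
  qed simp
  finally show ?thesis unfolding eq deg_def by simp
qed

text \<open>An edge through \<open>v\<close> dies exactly when \<open>K\<close> meets it, and by the
  second hypothesis it then dies through a single vertex. Each lost vertex of the link thus costs
  exactly one edge, which makes the exponent of a degree statistic linear in the number of lost link
  vertices.\<close>

lemma deg_remove:
  assumes vK: "v \<notin> K" and one: "\<And>e. e \<in> alive S \<Longrightarrow> v \<in> e \<Longrightarrow> card (e \<inter> K) \<le> 1"
  shows "real (deg (S - K) v) = real (deg S v) - real (card (K \<inter> link S v))"
proof -
  let ?F = "{e \<in> alive S. v \<in> e}"
  let ?G = "{e \<in> ?F. e \<inter> K = {}}"
  let ?H = "{e \<in> ?F. e \<inter> K \<noteq> {}}"
  have F: "?F = ?G \<union> ?H" "?G \<inter> ?H = {}" by auto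
  have "{e \<in> alive (S - K). v \<in> e} = ?G" unfolding alive_def by auto
  then have d: "deg (S - K) v = card ?G" unfolding deg_def by simp
  have c: "deg S v = card ?G + card ?H"
    unfolding deg_def by (subst F(1), rule card_Un_disjoint) auto
  have eq: "K \<inter> link S v = (\<Union>e\<in>?H. e \<inter> K)" unfolding link_def using vK by auto
  have "card (\<Union>e\<in>?H. e \<inter> K) = (\<Sum>e\<in>?H. card (e \<inter> K))"
  proof (rule card_UN_disjoint)
    show "\<forall>i\<in>?H. finite (i \<inter> K)" unfolding alive_def using edge_finite by auto
    show "\<forall>i\<in>?H. \<forall>j\<in>?H. i \<noteq> j \<longrightarrow> (i \<inter> K) \<inter> (j \<inter> K) = {}"
    proof (intro ballI impI)
      fix i j assume "i \<in> ?H" "j \<in> ?H" "i \<noteq> j"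
      then have "i \<inter> j = {v}" using edges_inter_at[of i j v] unfolding alive_def by simp
      then show "(i \<inter> K) \<inter> (j \<inter> K) = {}" using vK by auto
    qed
  qed simp
  also have "\<dots> = (\<Sum>e\<in>?H. 1)"
  proof (rule sum.cong)
    fix e assume e: "e \<in> ?H"
    then have "finite (e \<inter> K)" using edge_finite unfolding alive_def by blast
    then have "card (e \<inter> K) \<noteq> 0" using e by auto
    moreover have "card (e \<inter> K) \<le> 1" using one e by blast
    ultimately show "card (e \<inter> K) = 1" by linarith
  qed simp
  finally show ?thesis unfolding d c eq by simp
qed

section \<open>One random step: its average and its exponential moments\<close>

abbreviation (input) mean :: "real \<Rightarrow> real \<Rightarrow> 'v set \<Rightarrow> ('v set \<Rightarrow> real) \<Rightarrow> ('v \<Rightarrow> real) \<Rightarrow> real" where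
  "mean q h S x y \<equiv> (\<Sum>e\<in>alive S. q * x e) + (\<Sum>v\<in>S. h * (1 - weight v) * y v)"

text \<open>
  In one step of the random greedy process, with alive vertices $S$ and used vertices $U$, each alive edge is
  added to the matching with probability $q$, and each alive vertex $v$ is discarded on its own with
  probability $h (1 - w(v))$, where $w$ is the weight.  The discarding compensates for low degrees:
  if $q = h / (N \<phi>^2)$ then all alive vertices disappear at about the same rate $h$.
\<close>

definition avg :: "real \<Rightarrow> real \<Rightarrow> ('v set \<Rightarrow> 'v set \<Rightarrow> real) \<Rightarrow> 'v set \<Rightarrow> 'v set \<Rightarrow> real" where
  "avg q h F S U = mean q h S (\<lambda>e. F (S - e) (U \<union> e)) (\<lambda>v. F (S - {v}) U)
     + (1 - (\<Sum>e\<in>alive S. q) - (\<Sum>v\<in>S. h * (1 - weight v))) * F S U"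

lemma avg_add: "avg q h (\<lambda>S U. F S U + G S U) S U = avg q h F S U + avg q h G S U"
  unfolding avg_def by (simp add: distrib_left sum.distrib)

lemma avg_sum: "finite I \<Longrightarrow> avg q h (\<lambda>S U. \<Sum>i\<in>I. F i S U) S U = (\<Sum>i\<in>I. avg q h (F i) S U)"
  by (induction I rule: finite_induct) (simp_all add: avg_add avg_def[of _ _ "\<lambda>S U. 0"])

lemma weight_bounds_subset: "S \<subseteq> V \<Longrightarrow> v \<in> S \<Longrightarrow> 0 \<le> weight v \<and> weight v \<le> 1"
  using weight_bounds by blast

lemma idle_nonneg:
  assumes S: "S \<subseteq> V" and h: "h \<ge> 0" and tot: "real (card (alive S)) * q + h * real (card S) \<le> 1"
  shows "1 - (\<Sum>e\<in>alive S. q) - (\<Sum>v\<in>S. h * (1 - weight v)) \<ge> 0"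
proof -
  have "(\<Sum>v\<in>S. h * (1 - weight v)) \<le> (\<Sum>v\<in>S. h)"
    using weight_bounds_subset[OF S] h by (intro sum_mono) (simp add: mult_left_le)
  then show ?thesis using tot by (simp add: mult.commute)
qed

text \<open>By \<open>tot\<close> the probability of the idle outcome is nonnegative, so
  \<open>avg\<close> is a genuine convex combination and cannot be smaller than all of its values.
  This is where the random step is derandomised.\<close>

lemma avg_exists:
  assumes S: "S \<subseteq> V" and q: "q \<ge> 0" and h: "h \<ge> 0"
    and tot: "real (card (alive S)) * q + h * real (card S) \<le> 1"
    and le: "avg q h F S U < B"
  shows "(\<exists>e\<in>alive S. F (S - e) (U \<union> e) < B) \<or> (\<exists>v\<in>S. F (S - {v}) U < B) \<or> F S U < B"
proof (rule ccontr)
  assume "\<not> ?thesis"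
  then have a: "\<And>e. e \<in> alive S \<Longrightarrow> B \<le> F (S - e) (U \<union> e)" "\<And>v. v \<in> S \<Longrightarrow> B \<le> F (S - {v}) U" "B \<le> F S U"
    by (auto simp: not_less)
  note w = weight_bounds_subset[OF S]
  note rest = idle_nonneg[OF S h tot]
  have "(\<Sum>e\<in>alive S. q * B) \<le> (\<Sum>e\<in>alive S. q * F (S - e) (U \<union> e))"
    using a q by (intro sum_mono mult_left_mono) auto
  moreover have "(\<Sum>v\<in>S. h * (1 - weight v) * B) \<le> (\<Sum>v\<in>S. h * (1 - weight v) * F (S - {v}) U)"
    using a h w by (intro sum_mono mult_left_mono) auto
  moreover have "(1 - (\<Sum>e\<in>alive S. q) - (\<Sum>v\<in>S. h * (1 - weight v))) * B
     \<le> (1 - (\<Sum>e\<in>alive S. q) - (\<Sum>v\<in>S. h * (1 - weight v))) * F S U"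
    using a rest by (intro mult_left_mono)
  ultimately have "avg q h F S U \<ge> mean q h S (\<lambda>e. B) (\<lambda>v. B)
     + (1 - (\<Sum>e\<in>alive S. q) - (\<Sum>v\<in>S. h * (1 - weight v))) * B"
    unfolding avg_def by linarith
  also have "mean q h S (\<lambda>e. B) (\<lambda>v. B)
     + (1 - (\<Sum>e\<in>alive S. q) - (\<Sum>v\<in>S. h * (1 - weight v))) * B = B"
    unfolding sum_distrib_right[symmetric] by (simp only: ring_distribs)
  finally show False using le by simp
qed

lemma exp_quadratic_bound:
  assumes "\<bar>x\<bar> \<le> (1::real)" shows "exp x \<le> 1 + x + x^2"
proof (cases "x \<ge> 0")
  case True
  then show ?thesis using assms exp_bound[of x] by simp
next
  case False
  define y where "y = - x"
  have y: "0 < y" "y \<le> 1" using False assms unfolding y_def by auto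
  have "1 + y + y^2/2 \<le> exp y" using exp_lower_Taylor_quadratic[of y] y by simp
  \<comment> \<open>This turns the Taylor lower bound for exp y into an upper bound for its
    reciprocal.\<close>
  moreover have "(1 + y + y^2/2) * (1 - y + y^2) \<ge> 1"
  proof -
    have "(1 + y + y^2/2) * (1 - y + y^2) - 1 = y^2/2 + y^3/2 + y^4/2"
      by (simp add: field_simps power2_eq_square power3_eq_cube power4_eq_xxxx)
    then show ?thesis using y by (smt (verit) divide_nonneg_pos zero_le_power)
  qed
  moreover have "1 - y + y^2 \<ge> 0" using y by (smt (verit) zero_le_power2)
  ultimately have "1 \<le> exp y * (1 - y + y^2)"
    by (meson mult_right_mono order_trans)
  then have "exp (-y) \<le> 1 - y + y^2"
    by (simp add: exp_minus field_simps)
  then show ?thesis unfolding y_def by simp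
qed

text \<open>A Chernoff argument for one step: exp t \<le> 1 + t + t^2 on each outcome makes the
  average computable, and 1 + t \<le> exp t puts the result back into the exponent. The quadratic
  terms are kept, because the growing tolerance has to pay for them.\<close>

lemma avg_exp_le:
  assumes S: "S \<subseteq> V" and q: "q \<ge> 0" and h: "h \<ge> 0" and b: "b \<ge> 0"
    and tot: "real (card (alive S)) * q + h * real (card S) \<le> 1"
    and e1: "\<And>e. e \<in> alive S \<Longrightarrow> F (S - e) (U \<union> e) \<le> b * exp (x e) \<and> \<bar>x e\<bar> \<le> 1"
    and v1: "\<And>v. v \<in> S \<Longrightarrow> F (S - {v}) U \<le> b * exp (y v) \<and> \<bar>y v\<bar> \<le> 1"
    and n1: "F S U \<le> b"
  shows "avg q h F S U \<le> b * exp (mean q h S (\<lambda>e. (x e + (x e)^2)) (\<lambda>v. (y v + (y v)^2)))"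
proof -
  note w = weight_bounds_subset[OF S]
  note rest = idle_nonneg[OF S h tot]
  have 1: "F (S - e) (U \<union> e) \<le> b * (1 + (x e + (x e)^2))" if "e \<in> alive S" for e
    using e1[OF that] exp_quadratic_bound[of "x e"] b mult_left_mono[of "exp (x e)" "1 + x e + (x e)^2" b] by (simp add: add.assoc)
  have 2: "F (S - {v}) U \<le> b * (1 + (y v + (y v)^2))" if "v \<in> S" for v
    using v1[OF that] exp_quadratic_bound[of "y v"] b mult_left_mono[of "exp (y v)" "1 + y v + (y v)^2" b] by (simp add: add.assoc)
  have "avg q h F S U \<le> mean q h S (\<lambda>e. (b * (1 + (x e + (x e)^2)))) (\<lambda>v. (b * (1 + (y v + (y v)^2))))
     + (1 - (\<Sum>e\<in>alive S. q) - (\<Sum>v\<in>S. h * (1 - weight v))) * b"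
    unfolding avg_def
    by (intro add_mono sum_mono mult_left_mono 1 2 n1 rest q mult_nonneg_nonneg h) (use w in auto)
  also have "\<dots> = b * (1 + (mean q h S (\<lambda>e. (x e + (x e)^2)) (\<lambda>v. (y v + (y v)^2))))"
  proof -
    have a: "(\<Sum>e\<in>alive S. q * (b * (1 + (x e + (x e)^2)))) = (\<Sum>e\<in>alive S. q) * b + b * (\<Sum>e\<in>alive S. q * (x e + (x e)^2))"
      unfolding sum_distrib_left sum_distrib_right sum.distrib[symmetric] by (intro sum.cong) (auto simp: algebra_simps)
    have b: "(\<Sum>v\<in>S. h * (1 - weight v) * (b * (1 + (y v + (y v)^2)))) = (\<Sum>v\<in>S. h * (1 - weight v)) * b + b * (\<Sum>v\<in>S. h * (1 - weight v) * (y v + (y v)^2))"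
      unfolding sum_distrib_left sum_distrib_right sum.distrib[symmetric] by (intro sum.cong) (auto simp: algebra_simps)
    show ?thesis unfolding a b by (simp add: algebra_simps)
  qed
  also have "\<dots> \<le> b * exp (mean q h S (\<lambda>e. (x e + (x e)^2)) (\<lambda>v. (y v + (y v)^2)))"
    using b by (intro mult_left_mono exp_ge_add_one_self) auto
  finally show ?thesis .
qed

lemma edge_sum:
  assumes S: "S \<subseteq> V" and L: "L \<subseteq> S"
  shows "(\<Sum>e\<in>alive S. \<Sum>u\<in>e \<inter> L. g u) = (\<Sum>u\<in>L. real (deg S u) * g u)"
proof -
  have finL: "finite L" using S L finite_V by (meson finite_subset)
  have "(\<Sum>e\<in>alive S. \<Sum>u\<in>e \<inter> L. g u) = (\<Sum>e\<in>alive S. \<Sum>u\<in>L. if u \<in> e then g u else 0)"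
    by (rule sum.cong[OF refl]) (subst Int_commute, simp only: sum.inter_restrict[OF finL])
  also have "\<dots> = (\<Sum>u\<in>L. \<Sum>e\<in>alive S. if u \<in> e then g u else 0)" by (rule sum.swap)
  also have "\<dots> = (\<Sum>u\<in>L. real (deg S u) * g u)"
    unfolding deg_def by (intro sum.cong refl) (simp add: sum.If_cases Int_def)
  finally show ?thesis .
qed

lemma vertex_sum:
  fixes g :: "'v \<Rightarrow> real"
  assumes S: "S \<subseteq> V" and L: "L \<subseteq> S"
  shows "(\<Sum>v\<in>S. g v * of_bool (v \<in> L)) = (\<Sum>v\<in>L. g v)"
proof -
  have "finite S" using S finite_V by (meson finite_subset)
  then show ?thesis using L by (intro sum.mono_neutral_cong_right) auto
qed

text \<open>Both sides are the expected number of vertices of \<open>L\<close> that leave the alive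
  set in one step; the right one adds the removal probabilities of the single vertices.\<close>

lemma kill_sum:
  assumes S: "S \<subseteq> V" and L: "L \<subseteq> S"
  shows "mean q h S (\<lambda>e. real (card (e \<inter> L))) (\<lambda>v. of_bool (v \<in> L))
      = (\<Sum>u\<in>L. q * real (deg S u) + h * (1 - weight u))"
proof -
  have "(\<Sum>e\<in>alive S. q * real (card (e \<inter> L))) = q * (\<Sum>e\<in>alive S. \<Sum>u\<in>e \<inter> L. 1)"
    by (simp add: sum_distrib_left)
  also have "\<dots> = (\<Sum>u\<in>L. q * real (deg S u))"
    unfolding edge_sum[OF S L] by (simp add: sum_distrib_left)
  finally show ?thesis unfolding vertex_sum[OF S L] by (simp add: sum.distrib)
qed

end

text \<open>
  Here $\<phi>$ is the proportion of alive vertices, so a vertex $v$ should have alive degree about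
  $\<phi>^2 N w(v)$.  The relative error $\<mu>_0 / \<phi>^3$ grows faster than the rate $\<phi>^{-2}$ at which
  errors propagate; the difference pays for the random fluctuations.
\<close>

locale nibble_step = linear_3_graph +
  fixes S U :: "'a set" and \<phi> h \<mu>0 :: real
  assumes S: "S \<subseteq> V" and SU: "S \<inter> U = {}"
    and phi: "0 < \<phi>" "\<phi> \<le> 1" and h_pos: "0 < h" and h_le: "h \<le> \<mu>0 / 100"
    and eps_le: "\<mu>0 / \<phi>^3 \<le> 1/20" and N_eps: "N * \<mu>0 \<ge> 20"
    and tot: "real (card (alive S)) * (h / (N * \<phi>^2)) + h * real (card S) \<le> 1"
    and good: "\<And>u. u \<in> S \<Longrightarrow> \<bar>real (deg S u) / \<phi>^2 - N * weight u\<bar> \<le> N * (\<mu>0 / \<phi>^3)"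
begin

section \<open>Numerical bounds for a single step\<close>

definition "q = h / (N * \<phi>^2)"
text \<open>The rate of the exponential moments. It is small against \<mu>, so that second-order
  terms cost little; on the other hand the initial condition of the run asks that
  \<open>\<xi> * (N * \<mu>0)\<close> exceed the logarithm of the number of tracked
  statistics.\<close>

definition "\<xi> = \<mu>0 / 100"
definition "\<mu> = \<mu>0 / \<phi>^3"
definition "\<phi>' = \<phi> * (1 - h)"
definition "\<mu>' = \<mu>0 / \<phi>'^3"

lemma finite_S: "finite S"
  using S finite_V by (meson finite_subset)

lemma eps0_pos: "\<mu>0 > 0" using h_pos h_le by simp

lemma eps_ge: "\<mu>0 / \<phi>^2 \<le> \<mu>" "\<mu>0 / \<phi> \<le> \<mu>" "\<mu>0 \<le> \<mu>"
proof -
  have "\<phi>^3 \<le> \<phi>^2" "\<phi>^3 \<le> \<phi>^1" "\<phi>^3 \<le> \<phi>^0" using phi by (intro power_decreasing; simp)+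
  then show "\<mu>0 / \<phi>^2 \<le> \<mu>" "\<mu>0 / \<phi> \<le> \<mu>" "\<mu>0 \<le> \<mu>"
    unfolding \<mu>_def using eps0_pos phi by (auto intro!: divide_left_mono simp: field_simps)
qed

lemma eps_bounds: "0 < \<mu>" "\<mu> \<le> 1/20" "h \<le> \<mu> / 100" "h \<le> 1/2000" "\<xi> \<le> \<mu> / 100" "0 < \<xi>"
  using eps_ge eps_le h_le eps0_pos phi unfolding \<mu>_def[symmetric] \<xi>_def by auto

lemma q_nonneg: "q \<ge> 0" unfolding q_def using h_pos N_pos by simp

lemma phi'_pos: "0 < \<phi>'" unfolding \<phi>'_def using phi eps_bounds by simp

text \<open>As \<phi> shrinks by the factor \<open>1 - h\<close> and the tolerance is proportional
  to \<phi>^(-3), each step widens it by a relative amount of at least \<open>3 * h\<close>. This is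
  the budget to which drift and quadratic terms of one step are compared.\<close>

lemma eps'_ge: "\<mu>' \<ge> \<mu> * (1 + 3 * h)"
proof -
  have h1: "h \<le> 1/2000" "h > 0" using eps_bounds h_pos by auto
  have "(1 + 3 * h) * (1 - h)^3 = 1 - 6*h^2 + 8 * h^3 - 3 * h^4"
    by (simp add: algebra_simps power2_eq_square power3_eq_cube power4_eq_xxxx)
  also have "\<dots> \<le> 1"
  proof -
    have "h^2 * (6 - 8 * h + 3 * h^2) \<ge> 0" using h1 by (intro mult_nonneg_nonneg) (auto intro: add_nonneg_nonneg)
    then show ?thesis by (simp add: algebra_simps power2_eq_square power3_eq_cube power4_eq_xxxx)
  qed
  finally have *: "(1 + 3 * h) * (1 - h)^3 \<le> 1" .
  have "1 + 3 * h \<le> 1 / (1 - h)^3" using * h1 by (simp add: field_simps)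
  then have "\<mu> * (1 + 3 * h) \<le> \<mu> * (1 / (1 - h)^3)" using eps_bounds by (intro mult_left_mono) auto
  also have "\<dots> = \<mu>'" unfolding \<mu>'_def \<phi>'_def \<mu>_def by (simp add: power_mult_distrib)
  finally show ?thesis .
qed

text \<open>The hypothesis \<open>good\<close> multiplied by \<open>h / N\<close>: edges remove
  \<open>u\<close> with probability close to \<open>h * weight u\<close>.\<close>

lemma kill_rate:
  assumes "u \<in> S"
  shows "\<bar>q * real (deg S u) - h * weight u\<bar> \<le> h * \<mu>"
proof -
  have "q * real (deg S u) - h * weight u = (h / N) * (real (deg S u) / \<phi>^2 - N * weight u)"
    unfolding q_def using N_pos phi by (simp add: field_simps)
  also have "\<bar>\<dots>\<bar> = (h / N) * \<bar>real (deg S u) / \<phi>^2 - N * weight u\<bar>"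
    using h_pos N_pos by (simp add: abs_mult)
  also have "\<dots> \<le> (h / N) * (N * \<mu>)"
    using good[OF assms] h_pos N_pos unfolding \<mu>_def by (intro mult_left_mono) auto
  finally show ?thesis using N_pos by simp
qed

lemma deg_bound:
  assumes "u \<in> S" shows "real (deg S u) / \<phi>^2 \<le> 21/20 * N"
proof -
  have "weight u \<le> 1" using weight_bounds assms S by blast
  then have "N * weight u \<le> N" using N_pos by simp
  moreover have "N * \<mu> \<le> N * (1/20)" using N_pos eps_bounds by (intro mult_left_mono) auto
  moreover have "real (deg S u) / \<phi>^2 - N * weight u \<le> N * \<mu>"
    using good[OF assms] unfolding \<mu>_def by (simp only: abs_le_iff)
  ultimately show ?thesis by linarith
qed

abbreviation "rate L \<equiv> mean q h S (\<lambda>e. real (card (e \<inter> L))) (\<lambda>v. of_bool (v \<in> L))"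

text \<open>The discarding probability \<open>h * (1 - weight u)\<close> completes
  \<open>h * weight u\<close> to \<open>h\<close>, so the weights cancel and only the error of
  \<open>kill_rate\<close> is left.\<close>

lemma rate_bounds:
  assumes L: "L \<subseteq> S"
  shows "h * (1 - \<mu>) * card L \<le> rate L" "rate L \<le> h * (1 + \<mu>) * card L"
proof -
  have r: "h * (1 - \<mu>) \<le> q * real (deg S u) + h * (1 - weight u)"
    "q * real (deg S u) + h * (1 - weight u) \<le> h * (1 + \<mu>)" if "u \<in> L" for u
  proof -
    have "u \<in> S" using that L by auto
    from kill_rate[OF this] show "h * (1 - \<mu>) \<le> q * real (deg S u) + h * (1 - weight u)"
      "q * real (deg S u) + h * (1 - weight u) \<le> h * (1 + \<mu>)"
      by (auto simp: abs_le_iff algebra_simps)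
  qed
  show "h * (1 - \<mu>) * card L \<le> rate L" "rate L \<le> h * (1 + \<mu>) * card L"
    unfolding kill_sum[OF S L]
    using sum_mono[of L "\<lambda>_. h * (1 - \<mu>)", OF r(1)] sum_mono[of L _ "\<lambda>_. h * (1 + \<mu>)", OF r(2)]
    by (simp_all add: mult.commute)
qed

lemma alive_card: "e \<in> alive S \<Longrightarrow> finite e \<and> card e = 3 \<and> e \<subseteq> S"
  unfolding alive_def using edge_card edge_finite by auto

lemma card_inter_alive: "e \<in> alive S \<Longrightarrow> real (card (e \<inter> L)) \<le> 3"
  using alive_card[of e] card_mono[of e "e \<inter> L"] by simp

lemma weight_factor: "v \<in> S \<Longrightarrow> 0 \<le> h * (1 - weight v)"
  using weight_bounds S h_pos by (metis diff_ge_0_iff_ge less_le mult_nonneg_nonneg subsetD)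

text \<open>The factor by which the normalisation \<open>1 / \<phi>^2\<close> of a degree grows in
  one step. Its excess over 1 is about \<open>2 * h\<close>; the loss of link vertices, two per
  edge, has to cancel it.\<close>

definition "r = 1 / (1 - h)^2"
lemma r_bounds: "1 \<le> r" "r \<le> 501/500" "r - 1 = 2 * h * r - h^2 * r"
proof -
  have h1: "h \<le> 1/2000" "h > 0" using eps_bounds h_pos by auto
  have "(1 - h)^2 \<le> 1^2" using h1 by (intro power_mono) auto
  then show "1 \<le> r" unfolding r_def using h1 by (simp add: field_simps)
  have "(1 - 1/2000)^2 \<le> (1 - h)^2" using h1 by (intro power_mono) auto
  then have "501/500 * (1 - h)^2 \<ge> 1" by (simp add: power2_eq_square)
  then show "r \<le> 501/500" unfolding r_def using h1 by (simp add: field_simps)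
  have "r * (1 - h)^2 = 1" unfolding r_def using h1 by simp
  then show "r - 1 = 2 * h * r - h^2 * r" by (simp add: algebra_simps power2_eq_square)
qed

lemma phi'_sq: "1 / \<phi>'^2 = r / \<phi>^2"
  unfolding \<phi>'_def r_def by (simp add: power_mult_distrib)

text \<open>The change of a degree exponent caused by the loss of one link vertex, in the new
  normalisation.\<close>

definition "z = \<xi> / \<phi>'^2"

lemma z_bounds: "0 \<le> z" "3 * z \<le> \<mu> / 20" "z = \<xi> * r / \<phi>^2"
proof -
  show eq: "z = \<xi> * r / \<phi>^2" unfolding z_def using phi'_sq by (metis times_divide_eq_right mult.right_neutral)
  show "0 \<le> z" unfolding z_def using eps_bounds by simp
  have "z = (\<mu>0 / \<phi>^2) * (r / 100)" unfolding eq \<xi>_def by simp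
  also have "\<dots> \<le> \<mu> * (501/500 / 100)" using eps_ge r_bounds eps_bounds eps0_pos by (intro mult_mono) auto
  finally show "3 * z \<le> \<mu> / 20" using eps_bounds by simp
qed

text \<open>Common bookkeeping of the drift estimates: a statistic of size \<open>c * N\<close> with
  relative drift \<open>k * h * \<mu>\<close> stays within the budget of \<open>eps'_ge\<close> as
  long as \<open>c * k\<close> is at most 3.\<close>

lemma scale_bound:
  assumes "0 \<le> X" "X \<le> c * N" "Y \<le> k * (h * \<mu>)" "0 \<le> k" "c * k \<le> 3"
  shows "X * Y \<le> N * (3 * h * \<mu>)"
proof -
  have he: "0 \<le> h * \<mu>" using h_pos eps_bounds by simp
  have "X * Y \<le> X * (k * (h * \<mu>))" using assms by (intro mult_left_mono)
  also have "\<dots> \<le> c * N * (k * (h * \<mu>))" using assms he by (intro mult_right_mono) auto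
  also have "\<dots> = c * k * (N * (h * \<mu>))" by simp
  also have "\<dots> \<le> 3 * (N * (h * \<mu>))" using assms he N_pos by (intro mult_right_mono) auto
  finally show ?thesis by (simp add: mult_ac)
qed

text \<open>Used for degrees that are too large. With \<open>X\<close> the normalised degree,
  renormalising adds \<open>X * (r - 1)\<close> and the loss of link vertices takes away at least
  the subtracted term. To first order both are \<open>2 * h * X\<close>, so a quantity of order
  \<open>h * \<mu> * X\<close> remains. The summand \<open>1 / (N * \<phi>^2)\<close> accounts for
  the edges through the vertex itself, and \<open>3 * z\<close> for the quadratic terms.\<close>

lemma drift_upper:
  assumes "0 \<le> X" "X \<le> 21/20 * N"
  shows "X * (r - 1 - r * (1 - 3 * z) * (2 * h * (1 - \<mu> - 1 / (N * \<phi>^2)))) \<le> N * (3 * h * \<mu>)"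
proof -
  define k where "k = 1 / (N * \<phi>^2)"
  have k: "0 \<le> k" "k \<le> \<mu> / 20"
  proof -
    show "0 \<le> k" unfolding k_def using N_pos by simp
    have "k = (1 / N) / \<phi>^2" unfolding k_def by simp
    also have "\<dots> \<le> (\<mu>0 / 20) / \<phi>^2" using N_eps N_pos by (intro divide_right_mono) (auto simp: field_simps)
    also have "\<dots> \<le> \<mu> / 20" using eps_ge(1) by simp
    finally show "k \<le> \<mu> / 20" .
  qed
  have "r - 1 \<le> r * (2 * h)" using r_bounds by simp
  then have "r - 1 - r * (1 - 3 * z) * (2 * h * (1 - \<mu> - k)) \<le> r * (2 * h) * (1 - (1 - 3 * z) * (1 - \<mu> - k))"
    by (simp add: algebra_simps)
  also have "\<dots> \<le> r * (2 * h) * (11/10 * \<mu>)"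
  proof (intro mult_left_mono)
    have "3 * z * (\<mu> + k) \<ge> 0" using z_bounds k eps_bounds by (intro mult_nonneg_nonneg) auto
    then have "1 - (1 - 3 * z) * (1 - \<mu> - k) \<le> 3 * z + \<mu> + k" by (simp add: algebra_simps)
    also have "\<dots> \<le> 11/10 * \<mu>" using z_bounds k by simp
    finally show "1 - (1 - 3 * z) * (1 - \<mu> - k) \<le> 11/10 * \<mu>" .
  qed (use r_bounds h_pos in auto)
  also have "\<dots> \<le> 501/500 * (2 * h) * (11/10 * \<mu>)" using r_bounds h_pos eps_bounds by (intro mult_right_mono) auto
  finally have "r - 1 - r * (1 - 3 * z) * (2 * h * (1 - \<mu> - k)) \<le> 23/10 * (h * \<mu>)"
    using mult_pos_pos[OF h_pos eps_bounds(1)] by linarith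
  then show ?thesis unfolding k_def using assms by (intro scale_bound[of X "21/20" _ "23/10"]) auto
qed

text \<open>The mirror image for degrees that are too small: the losses are bounded from above, and
  the quadratic terms act in the other direction. In both lemmas the factors 21/20 and 23/10
  multiply to less than 3.\<close>

lemma drift_lower:
  assumes "0 \<le> X" "X \<le> 21/20 * N"
  shows "X * (r * (1 + 3 * z) * (2 * h * (1 + \<mu>)) - (r - 1)) \<le> N * (3 * h * \<mu>)"
proof -
  have "r * (1 + 3 * z) * (2 * h * (1 + \<mu>)) - (r - 1) = r * h * (2 * ((1 + 3 * z) * (1 + \<mu>) - 1) + h)"
    unfolding r_bounds(3) by (simp add: algebra_simps power2_eq_square)
  also have "\<dots> \<le> r * h * (11/5 * \<mu>)"
  proof (intro mult_left_mono)
    have "3 * z * \<mu> \<le> (\<mu> / 20) * (1/20)" using z_bounds eps_bounds by (intro mult_mono) auto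
    moreover have "2 * ((1 + 3 * z) * (1 + \<mu>) - 1) + h = 2 * (3 * z) + 2 * \<mu> + 2 * (3 * z * \<mu>) + h"
      by (simp add: algebra_simps)
    ultimately show "2 * ((1 + 3 * z) * (1 + \<mu>) - 1) + h \<le> 11/5 * \<mu>"
      using z_bounds(2) eps_bounds(1,3) by linarith
  qed (use r_bounds h_pos in auto)
  also have "\<dots> \<le> 501/500 * h * (11/5 * \<mu>)" using r_bounds h_pos eps_bounds by (intro mult_right_mono) auto
  finally have "r * (1 + 3 * z) * (2 * h * (1 + \<mu>)) - (r - 1) \<le> 23/10 * (h * \<mu>)"
    using mult_pos_pos[OF h_pos eps_bounds(1)] by linarith
  then show ?thesis using assms by (intro scale_bound[of X "21/20" _ "23/10"]) auto
qed

lemma drift_absorb: "N * (3 * h * \<mu>) \<le> N * \<mu>' - N * \<mu>"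
proof -
  have "N * (\<mu> * (1 + 3 * h)) \<le> N * \<mu>'" using eps'_ge N_pos by (intro mult_left_mono) auto
  then show ?thesis by (simp add: algebra_simps)
qed


section \<open>Exponential moments of the three kinds of statistic\<close>

lemma deg_remove_alive:
  assumes v: "v \<in> S"
  shows "e \<in> alive S \<Longrightarrow> v \<notin> e \<Longrightarrow> real (deg (S - e) v) = real (deg S v) - real (card (e \<inter> link S v))"
    and "w \<in> S \<Longrightarrow> w \<noteq> v \<Longrightarrow> real (deg (S - {w}) v) = real (deg S v) - of_bool (w \<in> link S v)"
proof -
  assume e: "e \<in> alive S" "v \<notin> e"
  show "real (deg (S - e) v) = real (deg S v) - real (card (e \<inter> link S v))"
  proof (rule deg_remove[OF e(2)])
    fix f assume f: "f \<in> alive S" "v \<in> f"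
    then have "f \<noteq> e" using e by auto
    then show "card (f \<inter> e) \<le> 1" using linear f e unfolding alive_def by auto
  qed
next
  assume w: "w \<in> S" "w \<noteq> v"
  have "real (deg (S - {w}) v) = real (deg S v) - real (card ({w} \<inter> link S v))"
  proof (rule deg_remove)
    fix f assume f: "f \<in> alive S" "v \<in> f"
    have "card (f \<inter> {w}) \<le> card {w}" by (intro card_mono) auto
    then show "card (f \<inter> {w}) \<le> 1" by simp
  qed (use w in auto)
  then show "real (deg (S - {w}) v) = real (deg S v) - of_bool (w \<in> link S v)"
    by (cases "w \<in> link S v") auto
qed

lemma link_inter: "e \<in> alive S \<Longrightarrow> v \<in> e \<Longrightarrow> card (e \<inter> link S v) = 2"
proof -
  assume e: "e \<in> alive S" "v \<in> e"
  have "e \<inter> link S v = e - {v}" using e unfolding link_def by auto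
  then show ?thesis using e alive_card by simp
qed

text \<open>An edge through \<open>v\<close> removes \<open>v\<close> together with its statistic,
  so its count is set to 0. Each such edge contains two vertices of the link, whence the correction
  \<open>2 * q * real (deg S v)\<close>.\<close>

lemma split_at_vertex:
  assumes L: "L = link S v"
  shows "mean q h S (\<lambda>e. (if v \<in> e then 0 else real (card (e \<inter> L)))) (\<lambda>w. of_bool (w \<in> L)) = rate L - 2 * q * real (deg S v)"
proof -
  have "(\<Sum>e\<in>alive S. q * real (card (e \<inter> L)))
     = (\<Sum>e\<in>alive S. q * (if v \<in> e then 0 else real (card (e \<inter> L))) + (if v \<in> e then 2 * q else 0))"
    unfolding L using link_inter by (intro sum.cong refl) auto
  also have "\<dots> = (\<Sum>e\<in>alive S. q * (if v \<in> e then 0 else real (card (e \<inter> L)))) + 2 * q * real (deg S v)"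
    unfolding sum.distrib deg_def by (simp add: sum.If_cases Int_def)
  finally show ?thesis by simp
qed

text \<open>The counts are at most 3, so the square of a count is at most three times the count. The
  quadratic terms fold into the linear ones, and only the expected count is left in the
  exponent.\<close>

lemma count_step:
  assumes b: "b \<ge> 0" and c: "3 * \<bar>c\<bar> \<le> 1"
    and k: "\<And>e. e \<in> alive S \<Longrightarrow> 0 \<le> k e \<and> k e \<le> 3" and j: "\<And>v. v \<in> S \<Longrightarrow> 0 \<le> j v \<and> j v \<le> 3"
    and F: "\<And>e. e \<in> alive S \<Longrightarrow> F (S - e) (U \<union> e) \<le> b * exp (c * k e)"
      "\<And>v. v \<in> S \<Longrightarrow> F (S - {v}) U \<le> b * exp (c * j v)" "F S U \<le> b"
  shows "avg q h F S U \<le> b * exp ((c + 3 * c^2) * (mean q h S k j))"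
proof -
  have quad: "c * t + (c * t)^2 \<le> (c + 3 * c^2) * t" if "0 \<le> t \<and> t \<le> 3" for t
  proof -
    have "c^2 * (t * t) \<le> c^2 * (3 * t)" using that by (intro mult_left_mono mult_right_mono) auto
    then show ?thesis by (simp add: algebra_simps power2_eq_square)
  qed
  have one: "\<bar>c * t\<bar> \<le> 1" if "0 \<le> t \<and> t \<le> 3" for t
  proof -
    have "\<bar>c\<bar> * t \<le> \<bar>c\<bar> * 3" using that by (intro mult_left_mono) auto
    then show ?thesis using c that by (simp add: abs_mult)
  qed
  have "avg q h F S U \<le> b * exp (mean q h S (\<lambda>e. (c * k e + (c * k e)^2)) (\<lambda>v. (c * j v + (c * j v)^2)))"
    by (rule avg_exp_le) (use S q_nonneg h_pos tot b F one k j in \<open>auto simp: q_def\<close>)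
  also have "\<dots> \<le> b * exp (mean q h S (\<lambda>e. ((c + 3 * c^2) * k e)) (\<lambda>v. ((c + 3 * c^2) * j v)))"
    unfolding mult_exp_exp using b quad k j q_nonneg weight_factor
    by (intro mult_left_mono iffD2[OF exp_le_cancel_iff] add_mono sum_mono) auto
  also have "mean q h S (\<lambda>e. ((c + 3 * c^2) * k e)) (\<lambda>v. ((c + 3 * c^2) * j v))
     = (c + 3 * c^2) * (mean q h S k j)"
    unfolding distrib_left sum_distrib_left by (simp add: mult_ac)
  finally show ?thesis .
qed

text \<open>The two signs are the two tails. On the left both the normalisation and the tolerance
  are already those of the next step; the growth of the tolerance outweighs drift and quadratic
  terms, so the expected term does not increase.\<close>

lemma degree_step:
  assumes v: "v \<in> S" and \<sigma>: "\<sigma> = 1 \<or> \<sigma> = - 1"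
  shows "avg q h (\<lambda>S' U'. of_bool (v \<in> S') * exp (\<xi> * (\<sigma> * (real (deg S' v) / \<phi>'^2 - N * weight v) - N * \<mu>'))) S U
    \<le> exp (\<xi> * (\<sigma> * (real (deg S v) / \<phi>^2 - N * weight v) - N * \<mu>))"
proof -
  define L where "L = link S v"
  define g where "g S' = \<xi> * (\<sigma> * (real (deg S' v) / \<phi>'^2 - N * weight v) - N * \<mu>')" for S'
  define b where "b = exp (g S)"
  define k where "k e = (if v \<in> e then 0 else real (card (e \<inter> L)))" for e
  define j where "j w = (of_bool (w \<in> L) :: real)" for w :: 'a
  define D where "D = real (deg S v)"
  define R where "R = rate L - 2 * q * D"
  have LS: "L \<subseteq> S" "v \<notin> L" unfolding L_def using link_subset by auto
  \<comment> \<open>Makes the coefficient \<open>z - 3 * z^2\<close> nonnegative, so that a lower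
    bound on the losses can be multiplied by it.\<close>
  have zz: "3 * z * z \<le> z"
    using mult_right_mono[of "3 * z" 1 z] z_bounds eps_bounds by simp
  have "avg q h (\<lambda>S' U'. of_bool (v \<in> S') * exp (g S')) S U
    \<le> b * exp ((- \<sigma> * z + 3 * (- \<sigma> * z)^2) * (mean q h S k j))"
  proof (rule count_step)
    fix e assume e: "e \<in> alive S"
    show "of_bool (v \<in> S - e) * exp (g (S - e)) \<le> b * exp (- \<sigma> * z * k e)"
    proof (cases "v \<in> e")
      case False
      have "real (deg (S - e) v) = real (deg S v) - k e" using deg_remove_alive(1)[OF v e False] False unfolding k_def L_def by simp
      then have "g (S - e) = g S + - \<sigma> * z * k e"
        unfolding g_def by (simp only:) (simp add: z_def algebra_simps diff_divide_distrib)
      then show ?thesis unfolding b_def by (simp add: exp_add[symmetric])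
    qed (simp add: b_def)
    show "0 \<le> k e \<and> k e \<le> 3" unfolding k_def using card_inter_alive[OF e, of L] by auto
  next
    fix w assume w: "w \<in> S"
    show "of_bool (v \<in> S - {w}) * exp (g (S - {w})) \<le> b * exp (- \<sigma> * z * j w)"
    proof (cases "w = v")
      case False
      have "real (deg (S - {w}) v) = real (deg S v) - j w" using deg_remove_alive(2)[OF v w False] unfolding j_def L_def by simp
      then have "g (S - {w}) = g S + - \<sigma> * z * j w"
        unfolding g_def by (simp only:) (simp add: z_def algebra_simps diff_divide_distrib)
      then show ?thesis unfolding b_def by (simp add: exp_add[symmetric])
    qed (simp add: b_def)
    show "0 \<le> j w \<and> j w \<le> 3" unfolding j_def by auto
  next
    show "of_bool (v \<in> S) * exp (g S) \<le> b"
      using v by (simp add: b_def)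
    show "3 * \<bar>- \<sigma> * z\<bar> \<le> 1" using \<sigma> z_bounds eps_bounds by (auto simp: abs_mult)
  qed (simp add: b_def)
  also have "mean q h S k j = R"
    unfolding k_def j_def R_def D_def by (rule split_at_vertex[OF L_def])
  also have "b * exp ((- \<sigma> * z + 3 * (- \<sigma> * z)^2) * R) \<le> exp (\<xi> * (\<sigma> * (real (deg S v) / \<phi>^2 - N * weight v) - N * \<mu>))"
  proof -
    have D': "D / \<phi>'^2 = D / \<phi>^2 * r" using phi'_sq by (metis mult.right_neutral mult.commute times_divide_eq_right)
    have Dpos: "0 \<le> D / \<phi>^2" "D / \<phi>^2 \<le> 21/20 * N" unfolding D_def using deg_bound[OF v] by auto
    define X where "X = D / \<phi>^2"
    have zD: "z * D = \<xi> * (X * r)" unfolding z_bounds(3) X_def by simp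
    have "\<sigma> * (D / \<phi>'^2) * \<xi> + (- \<sigma> * z + 3 * (- \<sigma> * z)^2) * R \<le> \<sigma> * (D / \<phi>^2) * \<xi> + \<xi> * (N * \<mu>' - N * \<mu>)"
      using \<sigma>
    proof
      \<comment> \<open>Upper tail: the losses must not be too few, so \<open>rate L\<close> is
        bounded from below.\<close>
      assume 1: "\<sigma> = 1"
      define P where "P = r * (1 - 3 * z) * (2 * h * (1 - \<mu> - 1 / (N * \<phi>^2)))"
      have "h * (1 - \<mu>) * (2 * D) - 2 * q * D \<le> R"
        using rate_bounds(1)[OF LS(1)] unfolding R_def D_def L_def card_link by simp
      then have "(z - 3 * z^2) * (h * (1 - \<mu>) * (2 * D) - 2 * q * D) \<le> (z - 3 * z^2) * R"
        using zz by (intro mult_left_mono) (auto simp: power2_eq_square)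
      moreover have "(z - 3 * z^2) * (h * (1 - \<mu>) * (2 * D) - 2 * q * D) = (z * D) * (1 - 3 * z) * (2 * h * (1 - \<mu> - 1 / (N * \<phi>^2)))"
        unfolding q_def by (simp add: algebra_simps power2_eq_square)
      ultimately have R: "\<xi> * (X * P) \<le> (z - 3 * z^2) * R" unfolding zD P_def by (simp add: mult_ac)
      have "\<xi> * (X * (r - 1 - P)) \<le> \<xi> * (N * \<mu>' - N * \<mu>)" unfolding P_def X_def
        using eps_bounds(6) order_trans[OF drift_upper[OF Dpos] drift_absorb] by (intro mult_left_mono) auto
      moreover have "\<xi> * (X * (r - 1 - P)) = X * r * \<xi> - X * \<xi> - \<xi> * (X * P)" by (simp add: algebra_simps)
      ultimately have "X * r * \<xi> - (z - 3 * z^2) * R \<le> X * \<xi> + \<xi> * (N * \<mu>' - N * \<mu>)" using R by linarith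
      then show ?thesis unfolding 1 D' X_def by (simp add: left_diff_distrib distrib_right)
    next
      \<comment> \<open>Lower tail: the losses must not be too many, and the correction for edges
        through \<open>v\<close> has a favourable sign.\<close>
      assume 1: "\<sigma> = - 1"
      define P where "P = r * (1 + 3 * z) * (2 * h * (1 + \<mu>))"
      have "R \<le> h * (1 + \<mu>) * (2 * D)"
      proof -
        have "0 \<le> 2 * q * D" using q_nonneg unfolding D_def by simp
        then show ?thesis using rate_bounds(2)[OF LS(1)] unfolding R_def D_def L_def card_link by simp
      qed
      then have "(z + 3 * z^2) * R \<le> (z + 3 * z^2) * (h * (1 + \<mu>) * (2 * D))"
        using z_bounds by (intro mult_left_mono) auto
      moreover have "(z + 3 * z^2) * (h * (1 + \<mu>) * (2 * D)) = (z * D) * (1 + 3 * z) * (2 * h * (1 + \<mu>))"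
        by (simp add: algebra_simps power2_eq_square)
      moreover have "(z * D) * (1 + 3 * z) * (2 * h * (1 + \<mu>)) = \<xi> * (X * P)" unfolding zD P_def by (simp add: mult_ac)
      ultimately have R: "(z + 3 * z^2) * R \<le> \<xi> * (X * P)" by linarith
      have "\<xi> * (X * (P - (r - 1))) \<le> \<xi> * (N * \<mu>' - N * \<mu>)" unfolding P_def X_def
        using eps_bounds(6) order_trans[OF drift_lower[OF Dpos] drift_absorb] by (intro mult_left_mono) auto
      moreover have "\<xi> * (X * (P - (r - 1))) = \<xi> * (X * P) - X * r * \<xi> + X * \<xi>" by (simp add: algebra_simps)
      ultimately have "(z + 3 * z^2) * R - X * r * \<xi> \<le> \<xi> * (N * \<mu>' - N * \<mu>) - X * \<xi>" using R by linarith
      then show ?thesis unfolding 1 D' X_def by (simp add: left_diff_distrib distrib_right)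
    qed
    then show ?thesis unfolding b_def g_def mult_exp_exp D_def[symmetric] by (simp add: algebra_simps)
  qed
  finally show ?thesis unfolding g_def .
qed

text \<open>Survivors of \<open>T\<close> decay like \<phi>, where degrees decay like \<phi>^2, so
  the argument for degrees works with smaller drift. Only the upper tail is followed, since
  survivors merely have to be few at the end.\<close>

lemma survivor_step:
  assumes T: "T \<subseteq> V" "real (card T) \<le> 2 * N" and surv: "real (card (T \<inter> S)) / \<phi> - real (card T) \<le> N * \<mu>"
  shows "avg q h (\<lambda>S' U'. exp (\<xi> * (real (card (T \<inter> S')) / \<phi>' - real (card T) - N * \<mu>'))) S U
    \<le> exp (\<xi> * (real (card (T \<inter> S)) / \<phi> - real (card T) - N * \<mu>))"
proof -
  define L where "L = T \<inter> S"
  define g where "g S' = \<xi> * (real (card (T \<inter> S')) / \<phi>' - real (card T) - N * \<mu>')" for S'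
  define b where "b = exp (g S)"
  define c where "c = \<xi> / \<phi>'"
  define r1 where "r1 = 1 / (1 - h)"
  have finL: "finite L" "L \<subseteq> S" unfolding L_def using finite_S by auto
  have r1: "0 \<le> r1" "r1 \<le> 501/500" "r1 - 1 = h * r1"
  proof -
    have "h \<le> 1/2000" using eps_bounds by simp
    then show "0 \<le> r1" "r1 \<le> 501/500" "r1 - 1 = h * r1" unfolding r1_def by (auto simp: field_simps)
  qed
  have c_eq: "c = \<xi> * r1 / \<phi>" unfolding c_def r1_def \<phi>'_def by simp
  have c0: "0 \<le> c" unfolding c_def using eps_bounds phi'_pos by simp
  have c3: "3 * c \<le> \<mu> / 20"
  proof -
    have "c = (\<mu>0 / \<phi>) * (r1 / 100)" unfolding c_eq \<xi>_def by simp
    also have "\<dots> \<le> \<mu> * (501/500 / 100)" using eps_ge r1 eps_bounds eps0_pos by (intro mult_mono) auto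
    finally show ?thesis using eps_bounds by simp
  qed
  have cc: "3 * c * c \<le> c"
    using mult_right_mono[of "3 * c" 1 c] c0 c3 eps_bounds by simp
  have "avg q h (\<lambda>S' U'. exp (g S')) S U
    \<le> b * exp ((- c + 3 * (- c)^2) * (mean q h S (\<lambda>e. real (card (e \<inter> L))) (\<lambda>w. of_bool (w \<in> L))))"
  proof (rule count_step)
    fix e assume e: "e \<in> alive S"
    have "T \<inter> (S - e) = L - e \<inter> L" unfolding L_def by auto
    then have "real (card (T \<inter> (S - e))) = real (card L) - real (card (e \<inter> L))"
      using finL by (simp add: card_Diff_subset card_mono of_nat_diff)
    then have "g (S - e) = g S + - c * real (card (e \<inter> L))"
      unfolding g_def L_def[symmetric] by (simp only:) (simp add: c_def algebra_simps diff_divide_distrib)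
    then show "exp (g (S - e)) \<le> b * exp (- c * real (card (e \<inter> L)))"
      unfolding b_def by (simp add: exp_add[symmetric])
    show "0 \<le> real (card (e \<inter> L)) \<and> real (card (e \<inter> L)) \<le> 3" using card_inter_alive[OF e] by simp
  next
    fix w assume w: "w \<in> S"
    have "real (card (T \<inter> (S - {w}))) = real (card L) - of_bool (w \<in> L)"
    proof (cases "w \<in> L")
      case True
      then have "T \<inter> (S - {w}) = L - {w}" unfolding L_def by auto
      moreover have "card L > 0" using True finL by (auto simp: card_gt_0_iff)
      ultimately show ?thesis using True finL by (simp add: of_nat_diff Suc_leI)
    next
      case False
      then have "T \<inter> (S - {w}) = L" unfolding L_def by auto
      then show ?thesis using False by simp
    qed
    then have "g (S - {w}) = g S + - c * of_bool (w \<in> L)"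
      unfolding g_def L_def[symmetric] by (simp only:) (simp add: c_def algebra_simps diff_divide_distrib)
    then show "exp (g (S - {w})) \<le> b * exp (- c * of_bool (w \<in> L))"
      unfolding b_def by (simp add: exp_add[symmetric])
  next
    show "3 * \<bar>- c\<bar> \<le> 1" using c0 c3 eps_bounds by simp
  qed (auto simp: b_def L_def)
  also have "\<dots> \<le> exp (\<xi> * (real (card (T \<inter> S)) / \<phi> - real (card T) - N * \<mu>))"
  proof -
    define X where "X = real (card L) / \<phi>"
    have X: "0 \<le> X" "X \<le> 41/20 * N"
    proof -
      have "N * \<mu> \<le> N * (1/20)" using N_pos eps_bounds by (intro mult_left_mono) auto
      then show "X \<le> 41/20 * N" using surv T unfolding X_def L_def by linarith
    qed (use phi X_def in simp)
    have "(c - 3 * c^2) * (h * (1 - \<mu>) * card L) \<le> (c - 3 * c^2) * rate L"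
      using rate_bounds(1)[OF finL(2)] cc by (intro mult_left_mono) (auto simp: power2_eq_square)
    moreover have "(c - 3 * c^2) * (h * (1 - \<mu>) * card L) = \<xi> * (X * (r1 * (1 - 3 * c) * (h * (1 - \<mu>))))"
    proof -
      have "c * card L = \<xi> * (X * r1)" unfolding c_eq X_def by simp
      moreover have "(c - 3 * c^2) * (h * (1 - \<mu>) * card L) = c * card L * (1 - 3 * c) * (h * (1 - \<mu>))"
        by (simp add: algebra_simps power2_eq_square)
      ultimately show ?thesis by simp
    qed
    moreover have "X * (r1 - 1 - r1 * (1 - 3 * c) * (h * (1 - \<mu>))) \<le> N * \<mu>' - N * \<mu>"
    proof -
      have "r1 - 1 - r1 * (1 - 3 * c) * (h * (1 - \<mu>)) = r1 * h * (3 * c * (1 - \<mu>) + \<mu>)"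
        unfolding r1(3) by (simp add: algebra_simps)
      also have "\<dots> \<le> 501/500 * h * (21/20 * \<mu>)"
      proof (intro mult_mono)
        have "3 * c * (1 - \<mu>) \<le> 3 * c * 1" using c0 eps_bounds by (intro mult_left_mono) auto
        then show "3 * c * (1 - \<mu>) + \<mu> \<le> 21/20 * \<mu>" using c3 by simp
      qed (use r1 h_pos c0 eps_bounds in auto)
      finally have "r1 - 1 - r1 * (1 - 3 * c) * (h * (1 - \<mu>)) \<le> 11/10 * (h * \<mu>)"
        using mult_pos_pos[OF h_pos eps_bounds(1)] by simp
      then show ?thesis using X by (intro order_trans[OF scale_bound[of X "41/20" _ "11/10"] drift_absorb]) auto
    qed
    then have "\<xi> * (X * (r1 - 1 - r1 * (1 - 3 * c) * (h * (1 - \<mu>)))) \<le> \<xi> * (N * \<mu>' - N * \<mu>)"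
      using eps_bounds(6) by (intro mult_left_mono) auto
    moreover have "real (card L) / \<phi>' = X * r1" unfolding X_def r1_def \<phi>'_def by simp
    ultimately show ?thesis unfolding b_def g_def mult_exp_exp L_def[symmetric] X_def[symmetric] by (simp add: algebra_simps)
  qed
  finally show ?thesis unfolding g_def .
qed


text \<open>The expected number of vertices of $T$ in the final matching, given the present state.\<close>

abbreviation (input) tally :: "'a set \<Rightarrow> 'a set \<Rightarrow> 'a set \<Rightarrow> real" where
  "tally T S' U' \<equiv> real (card (T \<inter> U')) + (\<Sum>v\<in>T \<inter> S'. weight v)"

text \<open>\<open>tally\<close> is a martingale up to the error of \<open>kill_rate\<close>. A
  vertex of weight w counts as 1 once an edge takes it, which has probability about h w, and as 0
  once it is discarded, which has probability h (1 - w). The expected changes h w (1 - w) and - h (1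
  - w) w cancel.\<close>

lemma tally_step:
  assumes T: "T \<subseteq> V" "real (card T) \<le> 2 * N" and \<sigma>: "\<sigma> = 1 \<or> \<sigma> = - 1" and finU: "finite U"
  shows "avg q h (\<lambda>S' U'. exp (\<xi> * (\<sigma> * (tally T S' U' - Y) - N * \<mu>'))) S U
    \<le> exp (\<xi> * (\<sigma> * (tally T S U - Y) - N * \<mu>))"
proof -
  define L where "L = T \<inter> S"
  define b where "b = exp (\<xi> * (\<sigma> * (tally T S U - Y) - N * \<mu>'))"
  define x where "x e = \<xi> * \<sigma> * (\<Sum>u\<in>e \<inter> L. 1 - weight u)" for e
  define y where "y v = - (\<xi> * \<sigma> * weight v * of_bool (v \<in> L))" for v
  have finL: "finite L" "L \<subseteq> S" "finite T" unfolding L_def using finite_S T finite_V finite_subset by auto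
  have w: "0 \<le> weight v" "weight v \<le> 1" if "v \<in> S" for v using weight_bounds S that by blast+
  have \<sigma>1: "\<bar>\<sigma>\<bar> = 1" "\<sigma>^2 = 1" using \<sigma> by auto
  have \<xi>1: "0 < \<xi>" "\<xi> \<le> 1/2000" using eps_bounds by auto
  have xk: "\<bar>x e\<bar> \<le> \<xi> * card (e \<inter> L)" if "e \<in> alive S" for e
  proof -
    have "\<bar>\<Sum>u\<in>e \<inter> L. 1 - weight u\<bar> \<le> (\<Sum>u\<in>e \<inter> L. 1)"
      using w finL by (intro order_trans[OF sum_abs] sum_mono) (auto simp: subset_iff)
    then show ?thesis unfolding x_def abs_mult \<sigma>1 using \<xi>1 by simp
  qed
  have x1: "\<bar>x e\<bar> \<le> 1" if "e \<in> alive S" for e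
    using xk[OF that] mult_left_mono[OF card_inter_alive[OF that, of L] less_imp_le[OF \<xi>1(1)]] \<xi>1 by linarith
  have x2: "(x e)^2 \<le> 3 * \<xi>^2 * card (e \<inter> L)" if "e \<in> alive S" for e
  proof -
    have "(x e)^2 \<le> (\<xi> * card (e \<inter> L))^2" using xk[OF that] by (metis abs_ge_zero power2_abs power_mono)
    also have "\<dots> = \<xi>^2 * (real (card (e \<inter> L)) * real (card (e \<inter> L)))" by (simp add: power2_eq_square)
    also have "\<dots> \<le> \<xi>^2 * (3 * real (card (e \<inter> L)))"
      using card_inter_alive[OF that, of L] by (intro mult_left_mono mult_right_mono) auto
    finally show ?thesis by simp
  qed
  have yk: "\<bar>y v\<bar> \<le> \<xi> * of_bool (v \<in> L)" if "v \<in> S" for v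
    unfolding y_def abs_minus_cancel abs_mult \<sigma>1 using w[OF that] \<xi>1 by (simp add: mult_left_le)
  have y1: "\<bar>y v\<bar> \<le> 1" if "v \<in> S" for v
    using yk[OF that] \<xi>1 by (cases "v \<in> L") auto
  have y2: "(y v)^2 \<le> 3 * \<xi>^2 * of_bool (v \<in> L)" if "v \<in> S" for v
  proof -
    have "(y v)^2 \<le> (\<xi> * of_bool (v \<in> L))^2" using yk[OF that] by (metis abs_ge_zero power2_abs power_mono)
    then show ?thesis by (cases "v \<in> L") (auto intro: order_trans)
  qed
  have "avg q h (\<lambda>S' U'. exp (\<xi> * (\<sigma> * (tally T S' U' - Y) - N * \<mu>'))) S U
    \<le> b * exp (mean q h S (\<lambda>e. (x e + (x e)^2)) (\<lambda>v. (y v + (y v)^2)))"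
  proof (rule avg_exp_le)
    fix e assume e: "e \<in> alive S"
    have eS: "e \<subseteq> S" "finite e" using alive_card[OF e] by auto
    have "T \<inter> (U \<union> e) = (T \<inter> U) \<union> (e \<inter> L)" "(T \<inter> U) \<inter> (e \<inter> L) = {}"
      using eS SU unfolding L_def by auto
    then have "card (T \<inter> (U \<union> e)) = card (T \<inter> U) + card (e \<inter> L)"
      using finL by (simp add: card_Un_disjoint)
    moreover have "(\<Sum>v\<in>T \<inter> (S - e). weight v) = (\<Sum>v\<in>L. weight v) - (\<Sum>v\<in>e \<inter> L. weight v)"
    proof -
      have "T \<inter> (S - e) = L - e \<inter> L" unfolding L_def by auto
      then show ?thesis using finL by (simp add: sum_diff)
    qed
    ultimately have "tally T (S - e) (U \<union> e) = tally T S U + (\<Sum>u\<in>e \<inter> L. 1 - weight u)"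
      unfolding L_def[symmetric] by (simp add: sum_subtractf)
    then have "\<xi> * (\<sigma> * (tally T (S - e) (U \<union> e) - Y) - N * \<mu>') = \<xi> * (\<sigma> * (tally T S U - Y) - N * \<mu>') + x e"
      by (simp only:) (simp add: x_def algebra_simps)
    then show "exp (\<xi> * (\<sigma> * (tally T (S - e) (U \<union> e) - Y) - N * \<mu>')) \<le> b * exp (x e) \<and> \<bar>x e\<bar> \<le> 1"
      using x1[OF e] unfolding b_def by (simp add: exp_add[symmetric])
  next
    fix v assume v: "v \<in> S"
    have "(\<Sum>u\<in>T \<inter> (S - {v}). weight u) = (\<Sum>u\<in>L. weight u) - weight v * of_bool (v \<in> L)"
    proof (cases "v \<in> L")
      case True
      then have "T \<inter> (S - {v}) = L - {v}" unfolding L_def by auto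
      then show ?thesis using finL True by (simp add: sum_diff1)
    next
      case False
      then have "T \<inter> (S - {v}) = L" using v unfolding L_def by auto
      then show ?thesis using False by simp
    qed
    then have "tally T (S - {v}) U = tally T S U - weight v * of_bool (v \<in> L)"
      unfolding L_def[symmetric] by simp
    then have "\<xi> * (\<sigma> * (tally T (S - {v}) U - Y) - N * \<mu>') = \<xi> * (\<sigma> * (tally T S U - Y) - N * \<mu>') + y v"
      by (simp only:) (simp add: y_def algebra_simps)
    then show "exp (\<xi> * (\<sigma> * (tally T (S - {v}) U - Y) - N * \<mu>')) \<le> b * exp (y v) \<and> \<bar>y v\<bar> \<le> 1"
      using y1[OF v] unfolding b_def by (simp add: exp_add[symmetric])
  qed (use S q_nonneg h_pos tot in \<open>auto simp: b_def q_def\<close>)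
  also have "\<dots> \<le> exp (\<xi> * (\<sigma> * (tally T S U - Y) - N * \<mu>))"
  proof -
    have cL: "real (card L) \<le> 2 * N"
      using card_mono[OF finL(3), of L] T unfolding L_def by simp
    have "mean q h S (\<lambda>e. (x e)^2) (\<lambda>v. (y v)^2)
       \<le> mean q h S (\<lambda>e. (3 * \<xi>^2 * card (e \<inter> L))) (\<lambda>v. (3 * \<xi>^2 * of_bool (v \<in> L)))"
      using x2 y2 q_nonneg weight_factor by (intro add_mono sum_mono mult_left_mono) auto
    also have "\<dots> = 3 * \<xi>^2 * rate L" unfolding distrib_left sum_distrib_left by (simp add: mult_ac)
    also have "\<dots> \<le> 3 * \<xi>^2 * (h * (1 + \<mu>) * card L)" using rate_bounds(2)[OF finL(2)] by (intro mult_left_mono) auto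
    also have "\<dots> \<le> 3 * \<xi>^2 * (h * (21/20) * (2 * N))"
      using eps_bounds h_pos cL by (intro mult_left_mono mult_mono) auto
    also have "\<dots> = \<xi> * (63/10 * \<xi> * (h * N))" by (simp add: power2_eq_square)
    also have "\<dots> \<le> \<xi> * (63/10 * (\<mu> / 100) * (h * N))"
      using eps_bounds h_pos N_pos by (intro mult_left_mono mult_right_mono) auto
    finally have quad: "mean q h S (\<lambda>e. (x e)^2) (\<lambda>v. (y v)^2) \<le> \<xi> * (63/1000 * (N * (h * \<mu>)))"
      by (simp add: mult_ac)
    have lin: "mean q h S x y \<le> \<xi> * (2 * (N * (h * \<mu>)))"
    proof -
      have "(\<Sum>e\<in>alive S. q * x e) = q * \<xi> * \<sigma> * (\<Sum>e\<in>alive S. \<Sum>u\<in>e \<inter> L. 1 - weight u)"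
        unfolding x_def sum_distrib_left by (simp add: mult_ac)
      also have "\<dots> = (\<Sum>u\<in>L. \<xi> * \<sigma> * (1 - weight u) * (q * real (deg S u)))"
        unfolding edge_sum[OF S finL(2)] sum_distrib_left by (simp add: mult_ac)
      finally have 1: "(\<Sum>e\<in>alive S. q * x e) = \<dots>" .
      have "(\<Sum>v\<in>S. h * (1 - weight v) * y v) = (\<Sum>v\<in>S. (- (h * (1 - weight v) * \<xi> * \<sigma> * weight v)) * of_bool (v \<in> L))"
        unfolding y_def by (intro sum.cong) (auto simp: mult_ac)
      also have "\<dots> = (\<Sum>u\<in>L. - (h * (1 - weight u) * \<xi> * \<sigma> * weight u))" by (rule vertex_sum[OF S finL(2)])
      finally have 2: "(\<Sum>v\<in>S. h * (1 - weight v) * y v) = \<dots>" .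
      \<comment> \<open>Edges gain \<open>1 - weight u\<close> and discards lose
        \<open>weight u\<close>; after taking out the common factor \<open>1 - weight u\<close>
        exactly the difference bounded by \<open>kill_rate\<close> is left.\<close>
      have "mean q h S x y
        = (\<Sum>u\<in>L. \<xi> * (\<sigma> * (1 - weight u) * (q * real (deg S u) - h * weight u)))"
        unfolding 1 2 sum.distrib[symmetric] by (intro sum.cong) (auto simp: algebra_simps)
      also have "\<dots> \<le> (\<Sum>u\<in>L. \<xi> * (h * \<mu>))"
      proof (intro sum_mono mult_left_mono)
        fix u assume "u \<in> L"
        then have u: "u \<in> S" using finL by auto
        have "\<sigma> * (1 - weight u) * (q * real (deg S u) - h * weight u) \<le> \<bar>\<sigma> * (1 - weight u) * (q * real (deg S u) - h * weight u)\<bar>"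
          by simp
        also have "\<dots> \<le> 1 * (h * \<mu>)"
          unfolding abs_mult \<sigma>1 using w[OF u] kill_rate[OF u] by (intro mult_mono) auto
        finally show "\<sigma> * (1 - weight u) * (q * real (deg S u) - h * weight u) \<le> h * \<mu>" by simp
      qed (use \<xi>1 in simp)
      also have "\<dots> = \<xi> * (card L * (h * \<mu>))" by simp
      also have "\<dots> \<le> \<xi> * (2 * N * (h * \<mu>))"
        using cL \<xi>1 h_pos eps_bounds by (intro mult_left_mono mult_right_mono) auto
      finally show ?thesis by (simp add: mult_ac)
    qed
    have "mean q h S (\<lambda>e. (x e + (x e)^2)) (\<lambda>v. (y v + (y v)^2))
      \<le> \<xi> * (2 * (N * (h * \<mu>))) + \<xi> * (63/1000 * (N * (h * \<mu>)))"
    proof -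
      have "mean q h S (\<lambda>e. (x e + (x e)^2)) (\<lambda>v. (y v + (y v)^2))
        = (mean q h S x y)
        + (mean q h S (\<lambda>e. (x e)^2) (\<lambda>v. (y v)^2))"
        by (simp add: distrib_left sum.distrib)
      then show ?thesis using lin quad by linarith
    qed
    also have "\<dots> \<le> \<xi> * (N * (3 * h * \<mu>))"
      using mult_pos_pos[OF \<xi>1(1) mult_pos_pos[OF N_pos mult_pos_pos[OF h_pos eps_bounds(1)]]] by (simp add: mult_ac)
    also have "\<dots> \<le> \<xi> * (N * \<mu>' - N * \<mu>)" using drift_absorb \<xi>1 by (intro mult_left_mono) auto
    finally show ?thesis unfolding b_def mult_exp_exp L_def[symmetric] by (simp add: algebra_simps)
  qed
  finally show ?thesis .
qed

end


section \<open>The potential and the run of the process\<close>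

context linear_3_graph
begin

definition degree_term :: "real \<Rightarrow> real \<Rightarrow> 'v set \<Rightarrow> real \<Rightarrow> 'v \<Rightarrow> real" where
  "degree_term \<mu>0 \<phi> S \<sigma> v = of_bool (v \<in> S) *
     exp (\<mu>0 / 100 * (\<sigma> * (real (deg S v) / \<phi>^2 - N * weight v) - N * (\<mu>0 / \<phi>^3)))"

definition tally_term :: "real \<Rightarrow> real \<Rightarrow> 'v set \<Rightarrow> 'v set \<Rightarrow> real \<Rightarrow> 'v set \<Rightarrow> real" where
  "tally_term \<mu>0 \<phi> S U \<sigma> T =
     exp (\<mu>0 / 100 * (\<sigma> * (real (card (T \<inter> U)) + (\<Sum>v\<in>T \<inter> S. weight v) - (\<Sum>v\<in>T. weight v)) - N * (\<mu>0 / \<phi>^3)))"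

definition survivor_term :: "real \<Rightarrow> real \<Rightarrow> 'v set \<Rightarrow> 'v set \<Rightarrow> real" where
  "survivor_term \<mu>0 \<phi> S T = exp (\<mu>0 / 100 * (real (card (T \<inter> S)) / \<phi> - real (card T) - N * (\<mu>0 / \<phi>^3)))"

text \<open>A union bound in exponential form: a term below 1 forces its statistic into the current
  tolerance, and all terms are nonnegative, so \<open>potential\<close> below 1 certifies every
  statistic at once. Dead vertices contribute nothing to the degree terms.\<close>

definition potential :: "'v set set \<Rightarrow> real \<Rightarrow> real \<Rightarrow> 'v set \<Rightarrow> 'v set \<Rightarrow> real" where
  "potential \<T> \<mu>0 \<phi> S U = (\<Sum>\<sigma>\<in>{1, -1}. \<Sum>v\<in>V. degree_term \<mu>0 \<phi> S \<sigma> v)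
     + (\<Sum>\<sigma>\<in>{1, -1}. \<Sum>T\<in>\<T>. tally_term \<mu>0 \<phi> S U \<sigma> T) + (\<Sum>T\<in>\<T>. survivor_term \<mu>0 \<phi> S T)"

lemmas term_defs = degree_term_def tally_term_def survivor_term_def

lemma avg_killed:
  assumes "S \<subseteq> V" "v \<notin> S"
  shows "avg q h (\<lambda>S' U'. of_bool (v \<in> S') * g S' U') S U = 0"
  using assms unfolding avg_def by simp

lemma potential_lt_1:
  assumes \<T>: "finite \<T>" and eps: "\<mu>0 > 0" and lt: "potential \<T> \<mu>0 \<phi> S U < 1"
  shows "v \<in> V \<Longrightarrow> v \<in> S \<Longrightarrow> \<bar>real (deg S v) / \<phi>^2 - N * weight v\<bar> \<le> N * (\<mu>0 / \<phi>^3)"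
    and "T \<in> \<T> \<Longrightarrow> \<bar>real (card (T \<inter> U)) + (\<Sum>v\<in>T \<inter> S. weight v) - (\<Sum>v\<in>T. weight v)\<bar> \<le> N * (\<mu>0 / \<phi>^3)"
    and "T \<in> \<T> \<Longrightarrow> real (card (T \<inter> S)) / \<phi> - real (card T) \<le> N * (\<mu>0 / \<phi>^3)"
proof -
  let ?A = "degree_term \<mu>0 \<phi> S" and ?B = "tally_term \<mu>0 \<phi> S U" and ?C = "survivor_term \<mu>0 \<phi> S"
  have P: "sum (?A 1) V + sum (?A (-1)) V + (sum (?B 1) \<T> + sum (?B (-1)) \<T>) + sum ?C \<T> < 1"
    using lt unfolding potential_def by simp
  have nonneg: "sum (?A 1) V \<ge> 0" "sum (?A (-1)) V \<ge> 0" "sum (?B 1) \<T> \<ge> 0" "sum (?B (-1)) \<T> \<ge> 0" "sum ?C \<T> \<ge> 0"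
    unfolding term_defs by (auto intro!: sum_nonneg)
  have exp_lt: "x \<le> y" if "exp (\<mu>0 / 100 * (x - y)) < 1" for x y
  proof -
    have "\<mu>0 / 100 * (x - y) < 0" using that by simp
    then show ?thesis using eps by (simp add: mult_less_0_iff)
  qed
  { assume v: "v \<in> V" "v \<in> S"
    have a: "?A \<sigma> v \<le> sum (?A \<sigma>) V" for \<sigma> using v finite_V by (intro member_le_sum) (auto simp: degree_term_def)
    have "?A 1 v < 1" "?A (-1) v < 1" using a[of 1] a[of "-1"] P nonneg by linarith+
    then show "\<bar>real (deg S v) / \<phi>^2 - N * weight v\<bar> \<le> N * (\<mu>0 / \<phi>^3)"
      unfolding degree_term_def using v exp_lt by (simp only: of_bool_eq mult_1 abs_le_iff) force }
  { assume T: "T \<in> \<T>"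
    have a: "?B \<sigma> T \<le> sum (?B \<sigma>) \<T>" for \<sigma> using T \<T> by (intro member_le_sum) (auto simp: tally_term_def)
    have "?B 1 T < 1" "?B (-1) T < 1" using a[of 1] a[of "-1"] P nonneg by linarith+
    from this[unfolded tally_term_def, THEN exp_lt, unfolded mult_1 mult_minus1] show "\<bar>real (card (T \<inter> U)) + (\<Sum>v\<in>T \<inter> S. weight v) - (\<Sum>v\<in>T. weight v)\<bar> \<le> N * (\<mu>0 / \<phi>^3)"
      unfolding abs_le_iff by simp
    have "?C T \<le> sum ?C \<T>" using T \<T> by (intro member_le_sum) (auto simp: survivor_term_def)
    then have "?C T < 1" using P nonneg by linarith
    from exp_lt[OF this[unfolded survivor_term_def]]
    show "real (card (T \<inter> S)) / \<phi> - real (card T) \<le> N * (\<mu>0 / \<phi>^3)" . }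
qed

text \<open>Each summand of the potential, taken at the next value of \<phi>, has average at most
  its present value by the one-step estimates. The three alternatives are the outcomes of a step: an
  edge is taken, a vertex is discarded, nothing happens.\<close>

lemma nibble_one_step:
  assumes \<T>: "finite \<T>" "\<And>T. T \<in> \<T> \<Longrightarrow> T \<subseteq> V \<and> real (card T) \<le> 2 * N"
    and state: "S \<subseteq> V" "S \<inter> U = {}" "finite U"
    and phi: "0 < \<phi>" "\<phi> \<le> 1" and h: "0 < h" "h \<le> \<mu>0 / 100"
    and eps: "\<mu>0 / \<phi>^3 \<le> 1/20" "N * \<mu>0 \<ge> 20"
    and tot: "real (card E) * (h / (N * \<phi>^2)) + h * real (card V) \<le> 1"
    and lt: "potential \<T> \<mu>0 \<phi> S U < 1"
  shows "(\<exists>e\<in>alive S. potential \<T> \<mu>0 (\<phi> * (1 - h)) (S - e) (U \<union> e) < 1)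
       \<or> (\<exists>v\<in>S. potential \<T> \<mu>0 (\<phi> * (1 - h)) (S - {v}) U < 1) \<or> potential \<T> \<mu>0 (\<phi> * (1 - h)) S U < 1"
proof -
  have eps0: "\<mu>0 > 0" using h by simp
  have "card (alive S) \<le> card E" unfolding alive_def using finite_E by (intro card_mono) auto
  then have "real (card (alive S)) * (h / (N * \<phi>^2)) \<le> real (card E) * (h / (N * \<phi>^2))"
    using h N_pos by (intro mult_right_mono) auto
  moreover have "h * real (card S) \<le> h * real (card V)" using h state finite_V by (intro mult_left_mono) (auto intro: card_mono)
  ultimately have tot': "real (card (alive S)) * (h / (N * \<phi>^2)) + h * real (card S) \<le> 1" using tot by linarith
  interpret nibble_step V E N S U \<phi> h \<mu>0
  proof unfold_locales
    fix u assume "u \<in> S"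
    then show "\<bar>real (deg S u) / \<phi>^2 - N * weight u\<bar> \<le> N * (\<mu>0 / \<phi>^3)"
      using potential_lt_1(1)[OF \<T>(1) eps0 lt] state by blast
  qed (use state phi h eps tot' in auto)
  have "avg q h (potential \<T> \<mu>0 \<phi>') S U \<le> potential \<T> \<mu>0 \<phi> S U"
    unfolding potential_def term_defs avg_add avg_sum[OF finite_V] avg_sum[OF \<T>(1)] avg_sum[OF finite.insertI[OF finite.insertI[OF finite.emptyI]]] \<xi>_def[symmetric]
  proof (intro add_mono sum_mono)
    fix \<sigma> :: real and v assume \<sigma>: "\<sigma> \<in> {1, -1}" and v: "v \<in> V"
    show "avg q h (\<lambda>S' U'. of_bool (v \<in> S') * exp (\<xi> * (\<sigma> * (real (deg S' v) / \<phi>'^2 - N * weight v) - N * (\<mu>0 / \<phi>'^3)))) S U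
      \<le> of_bool (v \<in> S) * exp (\<xi> * (\<sigma> * (real (deg S v) / \<phi>^2 - N * weight v) - N * (\<mu>0 / \<phi>^3)))"
    proof (cases "v \<in> S")
      case True
      then show ?thesis using degree_step[of v \<sigma>] \<sigma> unfolding \<mu>'_def \<mu>_def by simp
    next
      case False
      then show ?thesis using avg_killed[OF state(1)] by simp
    qed
  next
    fix \<sigma> :: real and T assume \<sigma>: "\<sigma> \<in> {1, -1}" and T: "T \<in> \<T>"
    show "avg q h (\<lambda>S' U'. exp (\<xi> * (\<sigma> * (tally T S' U' - (\<Sum>v\<in>T. weight v)) - N * (\<mu>0 / \<phi>'^3)))) S U
      \<le> exp (\<xi> * (\<sigma> * (tally T S U - (\<Sum>v\<in>T. weight v)) - N * (\<mu>0 / \<phi>^3)))"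
      using tally_step[of T \<sigma>] \<sigma> \<T>(2)[OF T] state(3) unfolding \<mu>'_def \<mu>_def by simp
  next
    fix T assume T: "T \<in> \<T>"
    show "avg q h (\<lambda>S' U'. exp (\<xi> * (real (card (T \<inter> S')) / \<phi>' - real (card T) - N * (\<mu>0 / \<phi>'^3)))) S U
      \<le> exp (\<xi> * (real (card (T \<inter> S)) / \<phi> - real (card T) - N * (\<mu>0 / \<phi>^3)))"
      using survivor_step[of T] \<T>(2)[OF T] potential_lt_1(3)[OF \<T>(1) eps0 lt T] unfolding \<mu>'_def \<mu>_def by simp
  qed
  then have "avg q h (potential \<T> \<mu>0 \<phi>') S U < 1" using lt by simp
  from avg_exists[OF state(1) q_nonneg less_imp_le[OF h(1)] _ this] tot' show ?thesis unfolding q_def \<phi>'_def by simp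
qed

text \<open>A potential below 1 is both the invariant and the source of the hypothesis
  \<open>good\<close> for the next step. As long as \<phi> is at least \<open>p\<close>, the
  tolerance is at most 1/20 and the probabilities of a step add up to at most 1.\<close>

lemma nibble_run:
  assumes \<T>: "finite \<T>" "\<And>T. T \<in> \<T> \<Longrightarrow> T \<subseteq> V \<and> real (card T) \<le> 2 * N"
    and p: "0 < p" and h: "0 < h" "h \<le> \<mu>0 / 100" "h < 1"
    and eps: "\<mu>0 / p^3 \<le> 1/20" "N * \<mu>0 \<ge> 20"
    and tot: "real (card E) * (h / (N * p^2)) + h * real (card V) \<le> 1"
    and init: "(2 * real (card V) + 3 * real (card \<T>)) * exp (- (\<mu>0 / 100 * (N * \<mu>0))) < 1"
  shows "p \<le> (1 - h) ^ t \<Longrightarrow> \<exists>S M. S \<subseteq> V \<and> M \<subseteq> E \<and> pairwise disjnt M \<and> S \<inter> \<Union>M = {} \<and> potential \<T> \<mu>0 ((1 - h) ^ t) S (\<Union>M) < 1"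
proof (induction t)
  case 0
  \<comment> \<open>At the start every deviation is 0, so all terms are the same exponential: two
    for each vertex and three for each set of \<open>\<T>\<close>.\<close>
  have "potential \<T> \<mu>0 ((1 - h) ^ 0) V (\<Union>{}) = (2 * real (card V) + 3 * real (card \<T>)) * exp (- (\<mu>0 / 100 * (N * \<mu>0)))"
  proof -
    have "(\<Sum>v\<in>T \<inter> V. weight v) = (\<Sum>v\<in>T. weight v)" "T \<inter> V = T" if "T \<in> \<T>" for T
      using \<T>(2)[OF that] by (auto simp: Int_absorb2)
    then show ?thesis unfolding potential_def term_defs by (simp add: deg_V algebra_simps)
  qed
  then show ?case using init by (intro exI[of _ V] exI[of _ "{}"]) (simp add: pairwise_empty)
next
  case (Suc t)
  have le1: "(1 - h) ^ t \<le> 1" using h by (intro power_le_one) auto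
  have "(1 - h) ^ Suc t \<le> (1 - h) ^ t" using h by (intro power_decreasing) auto
  then have pt: "p \<le> (1 - h) ^ t" using Suc.prems by simp
  from Suc.IH[OF this] obtain S M where SM: "S \<subseteq> V" "M \<subseteq> E" "pairwise disjnt M" "S \<inter> \<Union>M = {}"
    "potential \<T> \<mu>0 ((1 - h) ^ t) S (\<Union>M) < 1" by blast
  have eps0: "\<mu>0 > 0" using h by simp
  have finU: "finite (\<Union>M)" using SM(2) edge_subset finite_V by (meson Sup_least finite_subset subsetD)
  have "(\<exists>e\<in>alive S. potential \<T> \<mu>0 ((1 - h) ^ t * (1 - h)) (S - e) (\<Union>M \<union> e) < 1)
       \<or> (\<exists>v\<in>S. potential \<T> \<mu>0 ((1 - h) ^ t * (1 - h)) (S - {v}) (\<Union>M) < 1) \<or> potential \<T> \<mu>0 ((1 - h) ^ t * (1 - h)) S (\<Union>M) < 1"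
  proof (rule nibble_one_step[OF \<T> SM(1,4) finU _ le1 h(1,2) _ eps(2) _ SM(5)])
    show "0 < (1 - h) ^ t" using p pt by simp
    have t0: "0 < (1 - h) ^ t" using p pt by simp
    have "p ^ 3 \<le> ((1 - h) ^ t) ^ 3" using p pt by (intro power_mono) auto
    then have "\<mu>0 / ((1 - h) ^ t) ^ 3 \<le> \<mu>0 / p ^ 3" using p eps0 t0 by (intro divide_left_mono) (auto intro!: mult_pos_pos zero_less_power)
    then show "\<mu>0 / ((1 - h) ^ t) ^ 3 \<le> 1/20" using eps by linarith
    have "p ^ 2 \<le> ((1 - h) ^ t) ^ 2" using p pt by (intro power_mono) auto
    then have "h / (N * ((1 - h) ^ t) ^ 2) \<le> h / (N * p ^ 2)" using p h N_pos t0
      by (intro divide_left_mono mult_left_mono) (auto intro!: mult_pos_pos zero_less_power)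
    then have "real (card E) * (h / (N * ((1 - h) ^ t) ^ 2)) \<le> real (card E) * (h / (N * p ^ 2))" by (intro mult_left_mono) auto
    then show "real (card E) * (h / (N * ((1 - h) ^ t)\<^sup>2)) + h * real (card V) \<le> 1" using tot by simp
  qed auto
  then show ?case
  proof (elim disjE bexE)
    fix e assume e: "e \<in> alive S" "potential \<T> \<mu>0 ((1 - h) ^ t * (1 - h)) (S - e) (\<Union>M \<union> e) < 1"
    have eS: "e \<subseteq> S" "e \<in> E" using e unfolding alive_def by auto
    show ?thesis
    proof (intro exI conjI)
      show "S - e \<subseteq> V" "insert e M \<subseteq> E" using SM eS by auto
      show "pairwise disjnt (insert e M)" using SM(3,4) eS unfolding pairwise_insert disjnt_def by blast
      show "(S - e) \<inter> \<Union>(insert e M) = {}" using SM(4) by auto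
      show "potential \<T> \<mu>0 ((1 - h) ^ Suc t) (S - e) (\<Union>(insert e M)) < 1" using e(2) by (simp add: mult.commute Un_commute)
    qed
  next
    fix v assume v: "v \<in> S" "potential \<T> \<mu>0 ((1 - h) ^ t * (1 - h)) (S - {v}) (\<Union>M) < 1"
    then show ?thesis using SM by (intro exI[of _ "S - {v}"] exI[of _ M]) (auto simp: mult.commute)
  next
    assume "potential \<T> \<mu>0 ((1 - h) ^ t * (1 - h)) S (\<Union>M) < 1"
    then show ?thesis using SM by (intro exI[of _ S] exI[of _ M]) (auto simp: mult.commute)
  qed
qed

text \<open>The run is stopped when \<phi> is about \<open>p\<close>. By then the tally is within
  \<open>N * (\<mu>0 / p^3)\<close> of its initial value, and the vertices of \<open>T\<close> that
  are still alive, whose fate is undecided, have total weight at most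
  \<open>5 * p * N\<close>.\<close>

theorem pseudorandom_matching:
  assumes \<T>: "finite \<T>" "\<And>T. T \<in> \<T> \<Longrightarrow> T \<subseteq> V \<and> real (card T) \<le> 2 * N"
    and p: "0 < p" "p \<le> 1" and eps: "0 < \<mu>0" "\<mu>0 / p^3 \<le> 1/20" "N * \<mu>0 \<ge> 20"
    and init: "(2 * real (card V) + 3 * real (card \<T>)) * exp (- (\<mu>0 / 100 * (N * \<mu>0))) < 1"
  obtains M where "M \<subseteq> E" "pairwise disjnt M"
    "\<And>T. T \<in> \<T> \<Longrightarrow> \<bar>real (card (T \<inter> \<Union>M)) - (\<Sum>v\<in>T. weight v)\<bar> \<le> N * (\<mu>0 / p^3 + 5 * p)"
proof -
  \<comment> \<open>A step of size \<open>1 / K\<close> has total probability at most 1 whenever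
    \<phi> is at least \<open>p\<close>; the summand 2 keeps \<open>h\<close> at most 1/2.\<close>
  define K where "K = real (card E) / (N * p^2) + real (card V) + 2"
  define h where "h = min (\<mu>0 / 100) (1 / K)"
  have K: "K \<ge> 2" unfolding K_def using N_pos by simp
  have "1 / K \<le> 1 / 2" using K by (intro divide_left_mono) auto
  then have "h \<le> 1/2" unfolding h_def by linarith
  moreover have "0 < h" "h \<le> \<mu>0 / 100" "h \<le> 1 / K" unfolding h_def using eps K by auto
  ultimately have h: "0 < h" "h \<le> \<mu>0 / 100" "h \<le> 1 / K" "h \<le> 1/2" by auto
  have "h * K \<le> 1" using h K by (simp add: field_simps)
  then have tot: "real (card E) * (h / (N * p^2)) + h * real (card V) \<le> 1"
    unfolding K_def using h by (simp add: algebra_simps)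
  obtain t0 where t0: "(1 - h) ^ t0 < p" using real_arch_pow_inv[of p "1 - h"] p h by auto
  \<comment> \<open>The first time below \<open>p\<close>. The run is stopped one step earlier,
    where \<phi> lies between \<open>p\<close> and \<open>2 * p\<close> because \<open>h\<close> is
    at most 1/2.\<close>
  define t where "t = (LEAST t. (1 - h) ^ t < p)"
  have t1: "(1 - h) ^ t < p" unfolding t_def using t0 by (rule LeastI)
  then have "t \<noteq> 0" using p by (metis not_le power_0)
  then obtain s where s: "t = Suc s" using not0_implies_Suc by blast
  have t2: "p \<le> (1 - h) ^ s" using not_less_Least[of s "\<lambda>t. (1 - h) ^ t < p"] s unfolding t_def by force
  define \<phi> where "\<phi> = (1 - h) ^ s"
  have "1/2 * \<phi> \<le> (1 - h) * \<phi>" using h unfolding \<phi>_def by (intro mult_right_mono) auto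
  then have phi: "p \<le> \<phi>" "\<phi> \<le> 2 * p" using t1 t2 s unfolding \<phi>_def by auto
  obtain S M where SM: "S \<subseteq> V" "M \<subseteq> E" "pairwise disjnt M" "S \<inter> \<Union>M = {}"
    "potential \<T> \<mu>0 \<phi> S (\<Union>M) < 1"
    using nibble_run[OF \<T> p(1) h(1,2) _ eps(2,3) tot init t2] h unfolding \<phi>_def by auto
  have "p ^ 3 \<le> \<phi> ^ 3" using p phi by (intro power_mono) auto
  then have e: "\<mu>0 / \<phi> ^ 3 \<le> \<mu>0 / p ^ 3" using p eps phi by (intro divide_left_mono) (auto intro!: mult_pos_pos zero_less_power)
  have "\<bar>real (card (T \<inter> \<Union>M)) - (\<Sum>v\<in>T. weight v)\<bar> \<le> N * (\<mu>0 / p^3 + 5 * p)" if T: "T \<in> \<T>" for T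
  proof -
    define W where "W = (\<Sum>v\<in>T \<inter> S. weight v)"
    have finT: "finite T" using \<T>(2)[OF T] finite_V finite_subset by blast
    have W: "0 \<le> W" "W \<le> real (card (T \<inter> S))"
    proof -
      have w: "0 \<le> weight v \<and> weight v \<le> 1" if "v \<in> T \<inter> S" for v using weight_bounds SM(1) that by blast
      show "0 \<le> W" unfolding W_def using w by (intro sum_nonneg) auto
      have "W \<le> (\<Sum>v\<in>T \<inter> S. 1)" unfolding W_def using w by (intro sum_mono) auto
      then show "W \<le> real (card (T \<inter> S))" by simp
    qed
    have Ne: "N * (\<mu>0 / \<phi> ^ 3) \<le> N * (\<mu>0 / p ^ 3)" "N * (\<mu>0 / p ^ 3) \<le> N * (1 / 20)"
      using mult_left_mono[OF e less_imp_le[OF N_pos]] mult_left_mono[OF eps(2) less_imp_le[OF N_pos]] by auto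
    have "real (card (T \<inter> S)) / \<phi> \<le> real (card T) + N * (\<mu>0 / \<phi>^3)"
      using potential_lt_1(3)[OF \<T>(1) eps(1) SM(5) T] by simp
    also have "\<dots> \<le> 5/2 * N" using \<T>(2)[OF T] Ne N_pos by linarith
    finally have "real (card (T \<inter> S)) \<le> 5/2 * N * \<phi>" using phi p by (simp add: field_simps)
    also have "\<dots> \<le> 5/2 * N * (2 * p)" using phi N_pos by (intro mult_left_mono) auto
    finally have "W \<le> N * (5 * p)" using W by simp
    moreover have "\<bar>real (card (T \<inter> \<Union>M)) + W - (\<Sum>v\<in>T. weight v)\<bar> \<le> N * (\<mu>0 / \<phi>^3)"
      using potential_lt_1(2)[OF \<T>(1) eps(1) SM(5) T] unfolding W_def .
    ultimately show ?thesis using Ne(1) W(1) unfolding abs_le_iff distrib_left by linarith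
  qed
  then show thesis using that SM(2,3) by blast
qed

end

text \<open>The side conditions of \<open>pseudorandom_matching\<close> for p = N^(-1/10) and \<mu>0
  = N^(-2/5), with at most N^3 vertices and N^3 prescribed sets.\<close>

definition nibble_threshold :: "real \<Rightarrow> bool" where
  "nibble_threshold N \<longleftrightarrow> N \<ge> 1 \<and> N powr (- 1 / 10) \<le> 1 / 20 \<and> N powr (3 / 5) \<ge> 20
     \<and> 5 * N^3 * exp (- (N powr (1 / 5) / 100)) < 1"

lemma eventually_nibble_threshold: "eventually nibble_threshold at_top"
  unfolding nibble_threshold_def eventually_conj_iff by (intro conjI; real_asymp)

corollary (in linear_3_graph) pseudorandom_matching_powr:
  assumes N: "nibble_threshold N" and V: "real (card V) \<le> N^3"
    and \<T>: "finite \<T>" "real (card \<T>) \<le> N^3" "\<And>T. T \<in> \<T> \<Longrightarrow> T \<subseteq> V \<and> real (card T) \<le> 2 * N"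
  obtains M where "M \<subseteq> E" "pairwise disjnt M"
    "\<And>T. T \<in> \<T> \<Longrightarrow> \<bar>real (card (T \<inter> \<Union>M)) - (\<Sum>v\<in>T. weight v)\<bar> \<le> 6 * N powr (9 / 10)"
proof -
  \<comment> \<open>With these exponents \<open>\<mu>0 / p^3\<close> equals \<open>p\<close>, which
    balances the two errors, while \<open>\<mu>0 / 100 * (N * \<mu>0)\<close> is still of order
    N^(1/5) and beats any logarithm.\<close>
  define p where "p = N powr (- 1 / 10)"
  define \<mu>0 where "\<mu>0 = N powr (- 2 / 5)"
  have N1: "N \<ge> 1" "p \<le> 1/20" "5 * N^3 * exp (- (N powr (1 / 5) / 100)) < 1" using N unfolding nibble_threshold_def p_def by auto
  have p: "0 < p" "p \<le> 1" using N1 unfolding p_def by auto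
  have "p ^ 3 = N powr (- 3 / 10)" unfolding p_def using N1 by (subst powr_power) auto
  then have e: "\<mu>0 / p ^ 3 = p" unfolding \<mu>0_def p_def by (simp add: powr_diff[symmetric])
  have Ne: "N * \<mu>0 = N powr (3 / 5)" unfolding \<mu>0_def using N1 powr_mult_base[of N "- 2 / 5"] by simp
  have ee: "\<mu>0 / 100 * (N * \<mu>0) = N powr (1 / 5) / 100" unfolding Ne unfolding \<mu>0_def by (simp add: powr_add[symmetric])
  have "(2 * real (card V) + 3 * real (card \<T>)) * exp (- (\<mu>0 / 100 * (N * \<mu>0))) \<le> 5 * N^3 * exp (- (\<mu>0 / 100 * (N * \<mu>0)))"
    using V \<T> by (intro mult_right_mono) auto
  then have init: "(2 * real (card V) + 3 * real (card \<T>)) * exp (- (\<mu>0 / 100 * (N * \<mu>0))) < 1"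
    using N1(3) unfolding ee by linarith
  have "N * p = N powr (9 / 10)" unfolding p_def using N1 powr_mult_base[of N "- 1 / 10"] by simp
  then have err: "N * (\<mu>0 / p ^ 3 + 5 * p) = 6 * N powr (9 / 10)" unfolding e by simp
  show thesis
  proof (rule pseudorandom_matching[OF \<T>(1,3) p _ _ _ init, unfolded err])
    show "0 < \<mu>0" unfolding \<mu>0_def using N1 by simp
    show "\<mu>0 / p ^ 3 \<le> 1 / 20" unfolding e using N1 by simp
    show "20 \<le> N * \<mu>0" unfolding Ne using N unfolding nibble_threshold_def by simp
  qed (use that in blast)+
qed

section \<open>Pairs with many paths of length three\<close>

abbreviation absorbers :: "('a \<times> 'b) set \<Rightarrow> ('a \<times> 'b) set \<Rightarrow> 'a \<Rightarrow> 'b \<Rightarrow> ('a \<times> 'b) set" where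
  "absorbers R Q a b \<equiv> {e \<in> Q. (a, snd e) \<in> R \<and> (fst e, b) \<in> R}"

lemma card_fibres:
  assumes "finite A" "finite B"
  shows "(\<Sum>a\<in>A. real (card {b\<in>B. P a b})) = (\<Sum>b\<in>B. real (card {a\<in>A. P a b}))"
proof -
  have "(\<Sum>a\<in>A. real (card {b\<in>B. P a b})) = (\<Sum>a\<in>A. \<Sum>b\<in>B. of_bool (P a b))"
    using assms by (simp add: Int_def)
  also have "\<dots> = (\<Sum>b\<in>B. \<Sum>a\<in>A. of_bool (P a b))" by (rule sum.swap)
  finally show ?thesis using assms by (simp add: Int_def)
qed

lemma sum_ge_exists:
  fixes f :: "'a \<Rightarrow> real"
  assumes "finite I" "real (card I) * c \<le> sum f I" "I \<noteq> {}"
  shows "\<exists>i\<in>I. c \<le> f i"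
proof (rule ccontr)
  assume "\<not> ?thesis"
  then have "sum f I < (\<Sum>i\<in>I. c)" using assms by (intro sum_strict_mono) auto
  then show False using assms by simp
qed

lemma sum_threshold_bound:
  fixes f :: "'a \<Rightarrow> real"
  assumes "finite I" "\<And>i. i \<in> I \<Longrightarrow> f i \<le> M" "0 \<le> t"
  shows "sum f I \<le> real (card {i\<in>I. t \<le> f i}) * M + real (card I) * t"
proof -
  let ?J = "{i\<in>I. t \<le> f i}"
  have "sum f I = sum f ?J + sum f (I - ?J)" using assms(1) by (subst sum.subset_diff[of ?J I]) auto
  also have "sum f ?J \<le> (\<Sum>i\<in>?J. M)" using assms by (intro sum_mono) auto
  also have "sum f (I - ?J) \<le> (\<Sum>i\<in>I - ?J. t)" by (intro sum_mono) auto
  also have "\<dots> \<le> (\<Sum>i\<in>I. t)" using assms by (intro sum_mono2) auto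
  finally show ?thesis by simp
qed

text \<open>
  Most pairs of rows in the neighbourhood of a random column $v$ have many common neighbours: a pair
  with few common neighbours is unlikely to lie in it.
\<close>

lemma many_three_edge_paths:
  fixes R :: "('a \<times> 'b) set"
  assumes fin: "finite A" "finite B" and card: "card A = n" "card B = n" and n: "n > 0"
    and R: "R \<subseteq> A \<times> B" and \<delta>: "0 < \<delta>" and dense: "\<delta> * real n ^ 2 \<le> real (card R)"
  obtains A' B' where "A' \<subseteq> A" "B' \<subseteq> B" "real (card A') \<ge> \<delta> / 8 * n" "real (card B') \<ge> \<delta> / 8 * n"
    "\<And>a b. a \<in> A' \<Longrightarrow> b \<in> B' \<Longrightarrow> real (card (absorbers R R a b)) \<ge> \<delta>^5 / 4096 * real n ^ 2"
proof -
  define N where "N = real n"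
  have N: "N > 0" "real (card A) = N" "real (card B) = N" using n card unfolding N_def by auto
  define d where "d a = real (card {b\<in>B. (a, b) \<in> R})" for a
  \<comment> \<open>Rows with fewer than \<open>\<delta> / 2 * N\<close> cells carry together at
    most half of the guaranteed \<open>\<delta> * N^2\<close> cells.\<close>
  define A1 where "A1 = {a\<in>A. \<delta> / 2 * N \<le> d a}"
  define nb where "nb v = {a\<in>A1. (a, v) \<in> R}" for v
  define cod where "cod a a' = real (card {b\<in>B. (a, b) \<in> R \<and> (a', b) \<in> R})" for a a'
  \<comment> \<open>Tuned so that the bad pairs, weighted by \<open>16 / \<delta>\<close>, take away
    at most half of the bound in \<open>nbsq\<close>.\<close>
  define \<eta> where "\<eta> = \<delta>^3 / 128"
  have finA1: "finite A1" "A1 \<subseteq> A" unfolding A1_def using fin by auto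
  have cA1: "real (card A1) \<le> N" using card_mono[OF fin(1) finA1(2)] N by simp
  have finnb: "finite (nb v)" "nb v \<subseteq> A1" for v unfolding nb_def using finA1 by auto
  have fR: "finite R" using R fin by (meson finite_SigmaI finite_subset)
  have dsum: "sum d A \<ge> \<delta> * N^2"
  proof -
    have "R = Sigma A (\<lambda>a. {b\<in>B. (a, b) \<in> R})" using R by auto
    then have "card R = card (Sigma A (\<lambda>a. {b\<in>B. (a, b) \<in> R}))" by simp
    also have "\<dots> = (\<Sum>a\<in>A. card {b\<in>B. (a, b) \<in> R})" using fin by (simp add: card_SigmaI)
    finally have "real (card R) = sum d A" unfolding d_def by simp
    then show ?thesis using dense N_def by simp
  qed
  have dA1: "sum d A1 \<ge> \<delta> / 2 * N^2"
  proof -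
    have "sum d A = sum d A1 + sum d (A - A1)" using fin finA1 by (subst sum.subset_diff[of A1 A]) auto
    moreover have "sum d (A - A1) \<le> (\<Sum>a\<in>A - A1. \<delta> / 2 * N)" unfolding A1_def by (intro sum_mono) auto
    moreover have "\<dots> \<le> (\<Sum>a\<in>A. \<delta> / 2 * N)" using fin \<delta> N by (intro sum_mono2) auto
    moreover have "(\<Sum>a\<in>A. \<delta> / 2 * N) = \<delta> / 2 * N^2" by (simp add: N power2_eq_square)
    ultimately show ?thesis using dsum by linarith
  qed
  have nbsum: "(\<Sum>v\<in>B. real (card (nb v))) = sum d A1"
    unfolding nb_def d_def by (rule card_fibres[symmetric, OF finA1(1) fin(2)])
  have nbsq: "(\<Sum>v\<in>B. real (card (nb v))^2) \<ge> \<delta>^2 / 4 * N^3"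
  proof -
    \<comment> \<open>Cauchy-Schwarz in tangent form: x^2 \<ge> 2 t x - t^2 with t =
      \<open>\<delta> / 2 * N\<close>, the guaranteed mean size of \<open>nb v\<close>.\<close>
    have "(\<Sum>v\<in>B. 2 * (\<delta> / 2 * N) * real (card (nb v)) - (\<delta> / 2 * N)^2) \<le> (\<Sum>v\<in>B. real (card (nb v))^2)"
    proof (intro sum_mono)
      fix v
      have "(real (card (nb v)) - \<delta> / 2 * N)^2 \<ge> 0" by simp
      then show "2 * (\<delta> / 2 * N) * real (card (nb v)) - (\<delta> / 2 * N)^2 \<le> real (card (nb v))^2"
        by (simp add: power2_eq_square algebra_simps)
    qed
    moreover have "(\<Sum>v\<in>B. 2 * (\<delta> / 2 * N) * real (card (nb v)) - (\<delta> / 2 * N)^2)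
       = \<delta> * N * sum d A1 - N * (\<delta> / 2 * N)^2"
      unfolding sum_subtractf sum_distrib_left[symmetric] nbsum by (simp add: N)
    moreover have "\<delta> * N * (\<delta> / 2 * N^2) \<le> \<delta> * N * sum d A1" using dA1 \<delta> N by (intro mult_left_mono) auto
    ultimately show ?thesis by (simp add: power2_eq_square power3_eq_cube algebra_simps)
  qed
  define bad where "bad v = {p \<in> nb v \<times> nb v. cod (fst p) (snd p) < \<eta> * N}" for v
  have badsum: "(\<Sum>v\<in>B. real (card (bad v))) \<le> \<eta> * N^3"
  proof -
    let ?P = "{p \<in> A1 \<times> A1. cod (fst p) (snd p) < \<eta> * N}"
    have P: "finite ?P" "real (card ?P) \<le> N * N"
    proof -
      show "finite ?P" using finA1 by auto
      have "card ?P \<le> card (A1 \<times> A1)" using finA1 by (intro card_mono) auto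
      then have "real (card ?P) \<le> real (card A1) * real (card A1)" by (simp add: card_cartesian_product flip: of_nat_mult)
      also have "\<dots> \<le> N * N" using cA1 N by (intro mult_mono) auto
      finally show "real (card ?P) \<le> N * N" .
    qed
    \<comment> \<open>Counting by pairs: a pair with fewer than \<open>\<eta> * N\<close> common
      columns is bad for fewer than \<open>\<eta> * N\<close> choices of \<open>v\<close>.\<close>
    have "bad v = {p\<in>?P. (fst p, v) \<in> R \<and> (snd p, v) \<in> R}" for v unfolding bad_def nb_def by auto
    then have "(\<Sum>v\<in>B. real (card (bad v))) = (\<Sum>v\<in>B. real (card {p\<in>?P. (fst p, v) \<in> R \<and> (snd p, v) \<in> R}))" by simp
    also have "\<dots> = (\<Sum>p\<in>?P. cod (fst p) (snd p))"
      unfolding cod_def by (rule card_fibres[symmetric, OF _ fin(2)]) (use P(1) in \<open>simp add: cod_def\<close>)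
    also have "\<dots> \<le> (\<Sum>p\<in>?P. \<eta> * N)" by (intro sum_mono) auto
    also have "\<dots> = real (card ?P) * (\<eta> * N)" by simp
    also have "\<dots> \<le> N * N * (\<eta> * N)" using P \<delta> N unfolding \<eta>_def by (intro mult_right_mono) auto
    finally show ?thesis by (simp add: power3_eq_cube algebra_simps)
  qed
  \<comment> \<open>A large value of this difference serves two demands with one \<open>v\<close>:
    \<open>nb v\<close> is large, and the bad pairs are few compared with its square.\<close>
  have "\<exists>v\<in>B. \<delta>^2 / 8 * N^2 \<le> real (card (nb v))^2 - 16 / \<delta> * real (card (bad v))"
  proof (rule sum_ge_exists[OF fin(2)])
    have "16 / \<delta> * (\<Sum>v\<in>B. real (card (bad v))) \<le> 16 / \<delta> * (\<eta> * N^3)" using badsum \<delta> by (intro mult_left_mono) auto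
    also have "\<dots> = \<delta>^2 / 8 * N^3" unfolding \<eta>_def using \<delta> by (simp add: power2_eq_square power3_eq_cube)
    finally have "\<delta>^2 / 8 * N^3 \<le> (\<Sum>v\<in>B. real (card (nb v))^2) - 16 / \<delta> * (\<Sum>v\<in>B. real (card (bad v)))"
      using nbsq by simp
    then show "real (card B) * (\<delta>^2 / 8 * N^2) \<le> (\<Sum>v\<in>B. real (card (nb v))^2 - 16 / \<delta> * real (card (bad v)))"
      unfolding sum_subtractf sum_distrib_left[symmetric] N(3) by (simp add: power2_eq_square power3_eq_cube mult_ac)
    show "B \<noteq> {}" using card n by auto
  qed
  then obtain v where v: "\<delta>^2 / 8 * N^2 \<le> real (card (nb v))^2 - 16 / \<delta> * real (card (bad v))" by blast
  define Q where "Q = nb v"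
  define m where "m = real (card Q)"
  have finQ: "finite Q" "Q \<subseteq> A1" "Q \<subseteq> A" unfolding Q_def using finnb finA1 by auto
  have m_ge: "m \<ge> \<delta> / 4 * N"
  proof -
    have "16 / \<delta> * real (card (bad v)) \<ge> 0" using \<delta> by simp
    then have "\<delta>^2 / 8 * N^2 \<le> m^2" using v unfolding m_def Q_def by linarith
    moreover have "(\<delta> / 4 * N)^2 = (\<delta>^2 / 8 * N^2) / 2" by (simp add: power2_eq_square)
    moreover have "0 \<le> \<delta>^2 / 8 * N^2" by simp
    ultimately have "(\<delta> / 4 * N)^2 \<le> m^2" by linarith
    then show ?thesis by (rule power2_le_imp_le) (simp add: m_def)
  qed
  have m_pos: "m > 0" using m_ge mult_pos_pos[OF \<delta> N(1)] by linarith
  have bad_le: "16 * real (card (bad v)) \<le> \<delta> * m^2"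
  proof -
    have "0 \<le> \<delta>^2 / 8 * N^2" by simp
    then have "16 / \<delta> * real (card (bad v)) \<le> m^2" using v unfolding m_def Q_def by linarith
    then show ?thesis using \<delta> by (simp add: field_simps)
  qed
  define bd where "bd a = real (card {a'\<in>Q. cod a a' < \<eta> * N})" for a
  \<comment> \<open>By Markov's inequality at least half of the rows of \<open>Q\<close> qualify, as
    there are at most \<open>\<delta> / 16 * m^2\<close> bad pairs.\<close>
  define A0 where "A0 = {a\<in>Q. bd a \<le> \<delta> / 8 * m}"
  have A0_card: "real (card A0) \<ge> m / 2"
  proof -
    have fA0: "finite A0" "A0 \<subseteq> Q" unfolding A0_def using finQ by auto
    have "bad v = Sigma Q (\<lambda>a. {a'\<in>Q. cod a a' < \<eta> * N})" unfolding bad_def Q_def by auto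
    then have "real (card (bad v)) = (\<Sum>a\<in>Q. bd a)" unfolding bd_def using finQ by (simp add: card_SigmaI)
    also have "\<dots> \<ge> (\<Sum>a\<in>Q - A0. bd a)" using finQ by (intro sum_mono2) (auto simp: bd_def)
    moreover have "(\<Sum>a\<in>Q - A0. bd a) \<ge> (\<Sum>a\<in>Q - A0. \<delta> / 8 * m)" unfolding A0_def by (intro sum_mono) auto
    moreover have "(\<Sum>a\<in>Q - A0. \<delta> / 8 * m) = (m - real (card A0)) * (\<delta> / 8 * m)"
      using fA0 finQ unfolding m_def by (simp add: card_Diff_subset card_mono of_nat_diff)
    ultimately have "(m - real (card A0)) * (\<delta> / 8 * m) \<le> real (card (bad v))" by linarith
    then have "16 * ((m - real (card A0)) * (\<delta> / 8 * m)) \<le> \<delta> * m^2" using bad_le by linarith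
    then have "(\<delta> * m) * (2 * (m - real (card A0))) \<le> (\<delta> * m) * m" by (simp add: power2_eq_square algebra_simps)
    then have "2 * (m - real (card A0)) \<le> m" using \<delta> m_pos by simp
    then show ?thesis by simp
  qed
  define g where "g b = real (card {a\<in>Q. (a, b) \<in> R})" for b
  define B0 where "B0 = {b\<in>B. \<delta> / 4 * m \<le> g b}"
  have B0_card: "real (card B0) \<ge> \<delta> / 4 * N"
  proof -
    have "(\<Sum>a\<in>Q. \<delta> / 2 * N) \<le> (\<Sum>a\<in>Q. d a)" using finQ unfolding A1_def by (intro sum_mono) auto
    also have "\<dots> = sum g B" unfolding d_def g_def by (rule card_fibres[OF finQ(1) fin(2)])
    also have "\<dots> \<le> real (card B0) * m + real (card B) * (\<delta> / 4 * m)" unfolding B0_def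
    proof (rule sum_threshold_bound[OF fin(2)])
      show "g i \<le> m" for i unfolding g_def m_def using finQ by (auto intro!: card_mono)
      show "0 \<le> \<delta> / 4 * m" using \<delta> m_pos by simp
    qed
    finally have "m * (\<delta> / 4 * N) \<le> m * real (card B0)" unfolding N by (simp add: m_def[symmetric] algebra_simps)
    then show ?thesis using m_pos by simp
  qed
  show thesis
  proof (rule that)
    show "A0 \<subseteq> A" "B0 \<subseteq> B" unfolding A0_def B0_def using finQ by auto
    show "\<delta> / 8 * n \<le> real (card A0)" using A0_card m_ge unfolding N_def by simp
    have "0 \<le> \<delta> * N" using \<delta> N by simp
    then show "\<delta> / 8 * n \<le> real (card B0)" using B0_card unfolding N_def by simp
    fix a b assume a: "a \<in> A0" and b: "b \<in> B0"
    \<comment> \<open>The third vertex of a path a - b' - a' - b. At least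
      \<open>\<delta> / 4 * m\<close> rows of \<open>Q\<close> meet \<open>b\<close>, and at most
      \<open>\<delta> / 8 * m\<close> of them are bad partners of \<open>a\<close>; each other a'
      allows \<open>\<eta> * N\<close> choices of b', and the cell (a', b') is an absorber.\<close>
    define H where "H = {a'\<in>Q. (a', b) \<in> R \<and> \<eta> * N \<le> cod a a'}"
    have "g b \<le> real (card H) + bd a"
    proof -
      have "{a\<in>Q. (a, b) \<in> R} \<subseteq> H \<union> {a'\<in>Q. cod a a' < \<eta> * N}" unfolding H_def by auto
      then have "card {a\<in>Q. (a, b) \<in> R} \<le> card (H \<union> {a'\<in>Q. cod a a' < \<eta> * N})"
        using finQ unfolding H_def by (intro card_mono) auto
      also have "\<dots> \<le> card H + card {a'\<in>Q. cod a a' < \<eta> * N}" by (rule card_Un_le)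
      finally show ?thesis unfolding g_def bd_def by simp
    qed
    then have H: "real (card H) \<ge> \<delta> / 8 * m" using a b unfolding A0_def B0_def by simp
    have finH: "finite H" unfolding H_def using finQ by auto
    let ?S = "Sigma H (\<lambda>a'. {b'\<in>B. (a, b') \<in> R \<and> (a', b') \<in> R})"
    have "?S \<subseteq> absorbers R R a b" unfolding H_def by auto
    then have "real (card ?S) \<le> real (card (absorbers R R a b))"
      using fR by (auto intro!: card_mono)
    moreover have "real (card ?S) = (\<Sum>a'\<in>H. cod a a')" unfolding cod_def using finH fin by (simp add: card_SigmaI)
    moreover have "(\<Sum>a'\<in>H. cod a a') \<ge> (\<Sum>a'\<in>H. \<eta> * N)" unfolding H_def by (intro sum_mono) auto
    moreover have "(\<Sum>a'\<in>H. \<eta> * N) = real (card H) * (\<eta> * N)" by simp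
    moreover have "real (card H) * (\<eta> * N) \<ge> (\<delta> / 8 * (\<delta> / 4 * N)) * (\<eta> * N)"
    proof (rule mult_right_mono)
      have "\<delta> / 8 * (\<delta> / 4 * N) \<le> \<delta> / 8 * m" using m_ge \<delta> by (intro mult_left_mono) auto
      then show "\<delta> / 8 * (\<delta> / 4 * N) \<le> real (card H)" using H by linarith
      show "0 \<le> \<eta> * N" unfolding \<eta>_def using \<delta> N by simp
    qed
    moreover have "(\<delta> / 8 * (\<delta> / 4 * N)) * (\<eta> * N) = \<delta>^5 / 4096 * real n ^ 2"
      unfolding \<eta>_def N_def by (simp add: power2_eq_square power3_eq_cube eval_nat_numeral)
    ultimately show "real (card (absorbers R R a b)) \<ge> \<delta>^5 / 4096 * real n ^ 2"
      by linarith
  qed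
qed

section \<open>Selecting the absorbing matching\<close>

text \<open>Lists grow at the head: the tail is the history at the time when the head is selected.\<close>

fun run :: "('e list \<Rightarrow> 'e set) \<Rightarrow> 'e list \<Rightarrow> bool" where
  "run Valid [] = True"
| "run Valid (x # xs) = (x \<in> Valid xs \<and> run Valid xs)"

fun tally_bad :: "('e list \<Rightarrow> 'e set) \<Rightarrow> 'e list \<Rightarrow> nat" where
  "tally_bad bad [] = 0"
| "tally_bad bad (x # xs) = of_bool (x \<in> bad xs) + tally_bad bad xs"

text \<open>A Chernoff bound without independence: a wanted event halves its weight, an unwanted one
  doubles its weight. After division by the worst expected factor of each step, the sum of all
  weights does not increase on average over the valid choices. The unwanted sets may depend on the
  history, as the obstructing cells below do.\<close>

lemma sequential_selection:
  fixes Valid :: "'e list \<Rightarrow> 'e set" and good :: "'i \<Rightarrow> 'e set" and bad :: "'j \<Rightarrow> 'e list \<Rightarrow> 'e set"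
  assumes fin: "finite I" "finite J"
    and valid: "\<And>xs. run Valid xs \<Longrightarrow> length xs < s \<Longrightarrow> finite (Valid xs) \<and> Valid xs \<noteq> {}"
    and good: "\<And>xs i. run Valid xs \<Longrightarrow> length xs < s \<Longrightarrow> i \<in> I \<Longrightarrow>
        p * real (card (Valid xs)) \<le> real (card (good i \<inter> Valid xs))"
    and bad: "\<And>xs j. run Valid xs \<Longrightarrow> length xs < s \<Longrightarrow> j \<in> J \<Longrightarrow>
        real (card (bad j xs \<inter> Valid xs)) \<le> r * real (card (Valid xs))"
    and p: "0 \<le> p" "p \<le> 1" and r: "0 \<le> r"
  obtains xs where "length xs = s" "run Valid xs"
    "\<And>i. i \<in> I \<Longrightarrow> (1/2) ^ length (filter (\<lambda>x. x \<in> good i) xs) \<le> real (card I + card J) * (1 - p / 2) ^ s"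
    "\<And>j. j \<in> J \<Longrightarrow> 2 ^ tally_bad (bad j) xs \<le> real (card I + card J) * (1 + r) ^ s"
proof -
  define gw where "gw i xs = ((1/2) ^ length (filter (\<lambda>x. x \<in> good i) xs) :: real)" for i xs
  define bw where "bw j xs = (2 ^ tally_bad (bad j) xs :: real)" for j xs
  define \<Phi> where "\<Phi> xs = (\<Sum>i\<in>I. gw i xs / (1 - p / 2) ^ length xs) + (\<Sum>j\<in>J. bw j xs / (1 + r) ^ length xs)" for xs
  have pos: "0 < 1 - p / 2" "0 < 1 + r" using p r by auto
  have "\<exists>xs. length xs = k \<and> run Valid xs \<and> \<Phi> xs \<le> real (card I + card J)" if "k \<le> s" for k
    using that
  proof (induction k)
    case 0
    show ?case by (intro exI[of _ "[]"]) (simp add: \<Phi>_def gw_def bw_def)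
  next
    case (Suc k)
    then obtain xs where xs: "length xs = k" "run Valid xs" "\<Phi> xs \<le> real (card I + card J)" by auto
    have k: "length xs < s" using xs Suc.prems by simp
    define X where "X = Valid xs"
    have X: "finite X" "X \<noteq> {}" using valid[OF xs(2) k] unfolding X_def by auto
    have count: "(\<Sum>x\<in>X. of_bool (x \<in> Y) :: real) = real (card (Y \<inter> X))" for Y
      using X by (simp add: Int_def conj_commute)
    have g: "(\<Sum>x\<in>X. gw i (x # xs)) \<le> real (card X) * (gw i xs * (1 - p / 2))" if i: "i \<in> I" for i
    proof -
      have "(\<Sum>x\<in>X. gw i (x # xs)) = (\<Sum>x\<in>X. gw i xs * (1 - 1/2 * of_bool (x \<in> good i)))"
        unfolding gw_def by (intro sum.cong) auto
      also have "\<dots> = gw i xs * (real (card X) - 1/2 * real (card (good i \<inter> X)))"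
        unfolding sum_distrib_left[symmetric] sum_subtractf count by simp
      also have "\<dots> \<le> gw i xs * (real (card X) - 1/2 * (p * real (card X)))"
        using good[OF xs(2) k i] unfolding X_def by (intro mult_left_mono) (auto simp: gw_def)
      finally show ?thesis by (simp add: algebra_simps)
    qed
    have b: "(\<Sum>x\<in>X. bw j (x # xs)) \<le> real (card X) * (bw j xs * (1 + r))" if j: "j \<in> J" for j
    proof -
      have "(\<Sum>x\<in>X. bw j (x # xs)) = (\<Sum>x\<in>X. bw j xs * (1 + of_bool (x \<in> bad j xs)))"
        unfolding bw_def by (intro sum.cong) auto
      also have "\<dots> = bw j xs * (real (card X) + real (card (bad j xs \<inter> X)))"
        unfolding sum_distrib_left[symmetric] sum.distrib count by simp
      also have "\<dots> \<le> bw j xs * (real (card X) + r * real (card X))"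
        using bad[OF xs(2) k j] unfolding X_def by (intro mult_left_mono) (auto simp: bw_def)
      finally show ?thesis by (simp add: algebra_simps)
    qed
    have "(\<Sum>x\<in>X. \<Phi> (x # xs)) = (\<Sum>i\<in>I. (\<Sum>x\<in>X. gw i (x # xs)) / (1 - p / 2) ^ Suc k) + (\<Sum>j\<in>J. (\<Sum>x\<in>X. bw j (x # xs)) / (1 + r) ^ Suc k)"
    proof -
      have "(\<Sum>x\<in>X. \<Phi> (x # xs)) = (\<Sum>x\<in>X. \<Sum>i\<in>I. gw i (x # xs) / (1 - p / 2) ^ Suc k) + (\<Sum>x\<in>X. \<Sum>j\<in>J. bw j (x # xs) / (1 + r) ^ Suc k)"
        unfolding \<Phi>_def sum.distrib using xs(1) by simp
      then show ?thesis
        unfolding sum.swap[of _ I X] sum.swap[of _ J X] sum_divide_distrib .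
    qed
    also have "\<dots> \<le> (\<Sum>i\<in>I. (real (card X) * (gw i xs * (1 - p / 2))) / (1 - p / 2) ^ Suc k) + (\<Sum>j\<in>J. (real (card X) * (bw j xs * (1 + r))) / (1 + r) ^ Suc k)"
      using pos g b by (intro add_mono sum_mono divide_right_mono) auto
    also have "\<dots> = real (card X) * \<Phi> xs"
    proof -
      have c: "x * (y * u) / u ^ Suc k = x * (y / u ^ k)" if "0 < u" for x y u :: real
        using that by simp
      show ?thesis unfolding c[OF pos(1)] c[OF pos(2)] unfolding \<Phi>_def distrib_left sum_distrib_left xs(1) ..
    qed
    finally have le: "(\<Sum>x\<in>X. \<Phi> (x # xs)) \<le> real (card X) * \<Phi> xs" .
    have "\<exists>x\<in>X. \<Phi> (x # xs) \<le> \<Phi> xs"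
    proof (rule ccontr)
      assume "\<not> ?thesis"
      then have "(\<Sum>x\<in>X. \<Phi> xs) < (\<Sum>x\<in>X. \<Phi> (x # xs))" using X by (intro sum_strict_mono) auto
      then show False using le by simp
    qed
    then obtain x where "x \<in> X" "\<Phi> (x # xs) \<le> \<Phi> xs" by blast
    then show ?case using xs unfolding X_def by (intro exI[of _ "x # xs"]) auto
  qed
  from this[of s] obtain xs where xs: "length xs = s" "run Valid xs" "\<Phi> xs \<le> real (card I + card J)" by auto
  have nn: "0 \<le> gw i xs / (1 - p / 2) ^ s" "0 \<le> bw j xs / (1 + r) ^ s" for i j
    using pos unfolding gw_def bw_def by auto
  have S: "0 \<le> (\<Sum>i\<in>I. gw i xs / (1 - p / 2) ^ s)" "0 \<le> (\<Sum>j\<in>J. bw j xs / (1 + r) ^ s)"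
    using nn by (auto intro: sum_nonneg)
  show thesis
  proof (rule that[OF xs(1,2)])
    fix i assume "i \<in> I"
    then have "gw i xs / (1 - p / 2) ^ s \<le> (\<Sum>i\<in>I. gw i xs / (1 - p / 2) ^ s)"
      using fin nn by (intro member_le_sum) auto
    then have "gw i xs / (1 - p / 2) ^ s \<le> real (card I + card J)" using xs S unfolding \<Phi>_def xs(1) by linarith
    then show "(1/2) ^ length (filter (\<lambda>x. x \<in> good i) xs) \<le> real (card I + card J) * (1 - p / 2) ^ s"
      using pos unfolding gw_def by (simp add: divide_le_eq)
  next
    fix j assume "j \<in> J"
    then have "bw j xs / (1 + r) ^ s \<le> (\<Sum>j\<in>J. bw j xs / (1 + r) ^ s)"
      using fin nn by (intro member_le_sum) auto
    then have "bw j xs / (1 + r) ^ s \<le> real (card I + card J)" using xs S unfolding \<Phi>_def xs(1) by linarith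
    then show "2 ^ tally_bad (bad j) xs \<le> real (card I + card J) * (1 + r) ^ s"
      using pos unfolding bw_def by (simp add: divide_le_eq)
  qed
qed

section \<open>Latin arrays and their colour classes\<close>

locale latin_array =
  fixes n :: nat and col :: "nat \<times> nat \<Rightarrow> 'c"
  assumes n_pos: "n > 0"
    and row_inj: "\<And>i j j'. i < n \<Longrightarrow> j < n \<Longrightarrow> j' < n \<Longrightarrow> col (i, j) = col (i, j') \<Longrightarrow> j = j'"
    and col_inj: "\<And>i i' j. i < n \<Longrightarrow> i' < n \<Longrightarrow> j < n \<Longrightarrow> col (i, j) = col (i', j) \<Longrightarrow> i = i'"
begin

definition cells :: "(nat \<times> nat) set" where "cells = {..<n} \<times> {..<n}"
definition colour_class :: "'c \<Rightarrow> (nat \<times> nat) set" where "colour_class c = {e \<in> cells. col e = c}"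

lemma finite_cells [simp]: "finite cells" unfolding cells_def by simp
lemma card_cells: "card cells = n * n" unfolding cells_def by simp
lemma finite_class [simp]: "finite (colour_class c)" unfolding colour_class_def by simp

lemma class_inj: "inj_on fst (colour_class c)" "inj_on snd (colour_class c)"
proof -
  show "inj_on fst (colour_class c)"
  proof (rule inj_onI)
    fix e e' assume e: "e \<in> colour_class c" "e' \<in> colour_class c" "fst e = fst e'"
    obtain i j where ij: "e = (i, j)" by (cases e)
    obtain j' where ij': "e' = (i, j')" using e(3) ij by (cases e') simp
    show "e = e'" using e(1,2) row_inj[of i j j'] unfolding ij ij' colour_class_def cells_def by simp
  qed
  show "inj_on snd (colour_class c)"
  proof (rule inj_onI)
    fix e e' assume e: "e \<in> colour_class c" "e' \<in> colour_class c" "snd e = snd e'"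
    obtain i j where ij: "e = (i, j)" by (cases e)
    obtain i' where ij': "e' = (i', j)" using e(3) ij by (cases e') simp
    show "e = e'" using e(1,2) col_inj[of i i' j] unfolding ij ij' colour_class_def cells_def by simp
  qed
qed

lemma card_class_fst: "card (fst ` colour_class c) = card (colour_class c)"
  "card (snd ` colour_class c) = card (colour_class c)"
  by (rule card_image[OF class_inj(1)], rule card_image[OF class_inj(2)])

lemma class_le: "card (colour_class c) \<le> n"
proof -
  have "card (fst ` colour_class c) \<le> card {..<n}" unfolding colour_class_def cells_def by (intro card_mono) auto
  then show ?thesis unfolding card_class_fst by simp
qed

text \<open>Colour classes are disjoint, so at most \<open>d / 2 * n^2\<close> colours can have more
  than \<open>2 / d\<close> cells; every other colour gets one representative.\<close>

lemma sparse_representatives: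
  assumes d: "0 < d" "d * real n ^ 2 \<le> real (card (col ` cells))"
  obtains R where "R \<subseteq> cells" "inj_on col R" "\<And>e. e \<in> R \<Longrightarrow> real (card (colour_class (col e))) \<le> 2 / d"
    "d / 2 * real n ^ 2 \<le> real (card R)"
proof -
  define C where "C = col ` cells"
  define Big where "Big = {c\<in>C. 2 / d < real (card (colour_class c))}"
  have fin: "finite C" "finite Big" "Big \<subseteq> C" unfolding C_def Big_def by auto
  have "real (card Big) * (2 / d) = (\<Sum>c\<in>Big. 2 / d)" by simp
  also have "\<dots> \<le> (\<Sum>c\<in>Big. real (card (colour_class c)))" unfolding Big_def by (intro sum_mono) auto
  also have "\<dots> = real (card (\<Union>c\<in>Big. colour_class c))"
    using fin by (subst card_UN_disjoint) (auto simp: colour_class_def)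
  also have "\<dots> \<le> real (card cells)" by (intro of_nat_mono card_mono) (auto simp: colour_class_def)
  finally have "real (card Big) \<le> d / 2 * real n ^ 2"
    using d by (simp add: card_cells power2_eq_square field_simps)
  then have small: "d / 2 * real n ^ 2 \<le> real (card (C - Big))"
    using d fin unfolding C_def[symmetric] by (simp add: card_Diff_subset card_mono of_nat_diff)
  define g where "g = inv_into cells col"
  have g: "g c \<in> cells" "col (g c) = c" if "c \<in> C" for c
    using that unfolding g_def C_def by (auto intro: inv_into_into f_inv_into_f)
  have inj: "inj_on g (C - Big)" by (rule inj_on_inverseI[of _ col]) (simp add: g)
  show thesis
  proof (rule that)
    show "g ` (C - Big) \<subseteq> cells" using g(1) by blast
    show "inj_on col (g ` (C - Big))" by (rule inj_on_inverseI[of _ g]) (use g in force)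
    show "d / 2 * real n ^ 2 \<le> real (card (g ` (C - Big)))" using small inj by (simp add: card_image)
    fix e assume "e \<in> g ` (C - Big)"
    then obtain c where c: "c \<in> C" "c \<notin> Big" "e = g c" by blast
    then show "real (card (colour_class (col e))) \<le> 2 / d" using g(2)[of c] unfolding Big_def by simp
  qed
qed

text \<open>
  Adding any other cell to the matching $Q$ takes two more cells of colour $c$ out of the array of
  the remaining rows and columns: one in the row of that cell and one in its column.
\<close>

definition obstructing :: "'c \<Rightarrow> (nat \<times> nat) list \<Rightarrow> (nat \<times> nat) set" where
  "obstructing c xs = {e \<in> cells. fst e \<notin> fst ` colour_class c \<or> snd e \<notin> snd ` colour_class c
     \<or> (\<exists>b\<in>snd ` set xs. col (fst e, b) = c) \<or> (\<exists>a\<in>fst ` set xs. col (a, snd e) = c) \<or> col e = c}"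

text \<open>By the hypothesis on \<open>c\<close> at most \<open>2 * s\<close> rows and at most
  \<open>2 * s\<close> columns miss the colour. The rows whose cell of colour \<open>c\<close> lies
  in a selected column number at most \<open>s\<close>, and likewise for columns. Together with the
  class itself, of size at most \<open>n\<close>, this gives the factor 2 + 2 + 1 + 1 + 1.\<close>

lemma card_obstructing:
  assumes s: "s > 0" "length xs \<le> s" "set xs \<subseteq> cells" and c: "n \<le> card (colour_class c) + 2 * s"
  shows "card (obstructing c xs) \<le> 7 * (s * n)"
proof -
  let ?R = "{..<n} - fst ` colour_class c" and ?C = "{..<n} - snd ` colour_class c"
  let ?R' = "{a\<in>{..<n}. \<exists>b\<in>snd ` set xs. col (a, b) = c}" and ?C' = "{b\<in>{..<n}. \<exists>a\<in>fst ` set xs. col (a, b) = c}"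
  have sub: "fst ` colour_class c \<subseteq> {..<n}" "snd ` colour_class c \<subseteq> {..<n}"
    unfolding colour_class_def cells_def by auto
  have xs: "fst ` set xs \<subseteq> {..<n}" "snd ` set xs \<subseteq> {..<n}" using s unfolding cells_def by auto
  have lens: "card (fst ` set xs) \<le> s" "card (snd ` set xs) \<le> s"
    using s card_image_le[of "set xs" fst] card_image_le[of "set xs" snd] card_length[of xs] by simp_all
  have R: "card ?R \<le> 2 * s" "card ?C \<le> 2 * s"
    using sub c by (simp_all add: card_Diff_subset finite_subset card_class_fst)
  have line: "card {e\<in>colour_class c. p e \<in> Z} \<le> card Z" if "p = fst \<or> p = snd" "finite Z" for p and Z :: "nat set"
    by (rule card_inj_on_le[of p]) (use that class_inj in \<open>auto intro: inj_on_subset\<close>)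
  have sub: "?R' \<subseteq> fst ` {e\<in>colour_class c. snd e \<in> snd ` set xs}" "?C' \<subseteq> snd ` {e\<in>colour_class c. fst e \<in> fst ` set xs}"
    using xs unfolding colour_class_def cells_def by force+
  have "card ?R' \<le> card {e\<in>colour_class c. snd e \<in> snd ` set xs}" "card ?C' \<le> card {e\<in>colour_class c. fst e \<in> fst ` set xs}"
    by (rule order_trans[OF card_mono[OF _ sub(1)] card_image_le], simp, simp,
        rule order_trans[OF card_mono[OF _ sub(2)] card_image_le], simp, simp)
  then have RC': "card ?R' \<le> s" "card ?C' \<le> s"
    using line[of snd "snd ` set xs"] line[of fst "fst ` set xs"] lens by auto
  have "obstructing c xs \<subseteq> ?R \<times> {..<n} \<union> {..<n} \<times> ?C \<union> ?R' \<times> {..<n} \<union> {..<n} \<times> ?C' \<union> colour_class c"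
  proof
    fix e assume "e \<in> obstructing c xs"
    then show "e \<in> ?R \<times> {..<n} \<union> {..<n} \<times> ?C \<union> ?R' \<times> {..<n} \<union> {..<n} \<times> ?C' \<union> colour_class c"
      unfolding obstructing_def colour_class_def[of c] cells_def by (simp add: mem_Times_iff)
  qed
  then have "card (obstructing c xs) \<le> card (?R \<times> {..<n} \<union> {..<n} \<times> ?C \<union> ?R' \<times> {..<n} \<union> {..<n} \<times> ?C' \<union> colour_class c)"
    by (intro card_mono) auto
  also have "\<dots> \<le> card (?R \<times> {..<n}) + card ({..<n} \<times> ?C) + card (?R' \<times> {..<n}) + card ({..<n} \<times> ?C') + card (colour_class c)"
    using card_Un_le[of "?R \<times> {..<n} \<union> {..<n} \<times> ?C \<union> ?R' \<times> {..<n} \<union> {..<n} \<times> ?C'" "colour_class c"]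
      card_Un_le[of "?R \<times> {..<n} \<union> {..<n} \<times> ?C \<union> ?R' \<times> {..<n}" "{..<n} \<times> ?C'"]
      card_Un_le[of "?R \<times> {..<n} \<union> {..<n} \<times> ?C" "?R' \<times> {..<n}"]
      card_Un_le[of "?R \<times> {..<n}" "{..<n} \<times> ?C"] by linarith
  also have "\<dots> \<le> 2 * s * n + n * (2 * s) + s * n + n * s + s * n"
  proof (intro add_mono)
    have "n \<le> s * n" using s by simp
    then show "card (colour_class c) \<le> s * n" using class_le[of c] by linarith
  qed (use R RC' in \<open>auto simp: card_cartesian_product\<close>)
  finally show ?thesis by (simp add: mult.commute)
qed

text \<open>A cell selected in a line without colour \<open>c\<close> is obstructing at that moment,
  so each missing line is charged to an obstructing selection of its own.\<close>

lemma missing_obstructed: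
  assumes "run Valid xs" and cells: "\<And>x ys. x \<in> Valid ys \<Longrightarrow> x \<in> cells" and p: "p = fst \<or> p = snd"
  shows "card {a\<in>p ` set xs. a \<notin> p ` colour_class c} \<le> tally_bad (obstructing c) xs"
  using assms(1)
proof (induction xs)
  case (Cons x xs)
  have "{a\<in>p ` set (x # xs). a \<notin> p ` colour_class c} \<subseteq> {a\<in>p ` set xs. a \<notin> p ` colour_class c} \<union> (if x \<in> obstructing c xs then {p x} else {})"
    using p Cons.prems cells[of x xs] unfolding obstructing_def by auto
  then have "card {a\<in>p ` set (x # xs). a \<notin> p ` colour_class c} \<le> card ({a\<in>p ` set xs. a \<notin> p ` colour_class c} \<union> (if x \<in> obstructing c xs then {p x} else {}))"
    by (intro card_mono) auto
  also have "\<dots> \<le> card {a\<in>p ` set xs. a \<notin> p ` colour_class c} + card (if x \<in> obstructing c xs then {p x} else {})" by (rule card_Un_le)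
  finally show ?case using Cons by (cases "x \<in> obstructing c xs") simp_all
qed simp

text \<open>A selection enlarges the rectangle by one row and one column, each with at most one cell
  of colour \<open>c\<close>. If the selected cell is not obstructing, none of these cells lies in
  the enlarged rectangle.\<close>

lemma rectangle_obstructed:
  assumes "run Valid xs" and cells: "\<And>x ys. x \<in> Valid ys \<Longrightarrow> x \<in> cells"
  shows "card (colour_class c \<inter> fst ` set xs \<times> snd ` set xs) \<le> 2 * tally_bad (obstructing c) xs"
  using assms(1)
proof (induction xs)
  case (Cons x xs)
  then have x: "x \<in> cells" "run Valid xs" using cells[of x xs] by simp_all
    let ?O = "colour_class c \<inter> fst ` set xs \<times> snd ` set xs"
    let ?X = "colour_class c \<inter> fst ` set (x # xs) \<times> snd ` set (x # xs)"
    show ?case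
    proof (cases "x \<in> obstructing c xs")
      case True
      let ?r = "{e\<in>colour_class c. fst e = fst x}" and ?s = "{e\<in>colour_class c. snd e = snd x}"
      have "card ?r \<le> card {fst x}" by (rule card_inj_on_le[OF inj_on_subset[OF class_inj(1)]]) auto
      moreover have "card ?s \<le> card {snd x}" by (rule card_inj_on_le[OF inj_on_subset[OF class_inj(2)]]) auto
      moreover have "?X \<subseteq> ?O \<union> ?r \<union> ?s" by auto
      then have "card ?X \<le> card (?O \<union> ?r \<union> ?s)" by (intro card_mono) auto
      moreover have "card (?O \<union> ?r \<union> ?s) \<le> card ?O + card ?r + card ?s"
        using card_Un_le[of "?O \<union> ?r" ?s] card_Un_le[of ?O ?r] by linarith
      ultimately show ?thesis using Cons.IH[OF x(2)] True by simp
    next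
      case False
      have "?X \<subseteq> ?O"
      proof
        fix e assume e: "e \<in> ?X"
        then have col: "col (fst e, snd e) = c" unfolding colour_class_def by simp
        have ob: "\<not> (\<exists>b\<in>snd ` set xs. col (fst x, b) = c)" "\<not> (\<exists>a\<in>fst ` set xs. col (a, snd x) = c)" "col (fst x, snd x) \<noteq> c"
          using False x unfolding obstructing_def by auto
        have "fst e \<in> fst ` set xs \<or> fst e = fst x" "snd e \<in> snd ` set xs \<or> snd e = snd x"
          using e by (simp_all only: Int_iff mem_Times_iff list.set image_insert insert_iff) blast+
        then have "fst e \<in> fst ` set xs \<and> snd e \<in> snd ` set xs" using col ob by (elim disjE) auto
        then show "e \<in> ?O" using e by (simp add: mem_Times_iff)
      qed
      then have "card ?X \<le> card ?O" by (intro card_mono) auto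
      then show ?thesis using Cons.IH[OF x(2)] by simp
    qed
qed simp

lemma card_class_lines:
  assumes p: "p = fst \<or> p = snd"
  shows "card X \<le> card {e\<in>colour_class c. p e \<in> X} + card {a\<in>X. a \<notin> p ` colour_class c}"
proof -
  have "card X \<le> card (p ` {e\<in>colour_class c. p e \<in> X} \<union> {a\<in>X. a \<notin> p ` colour_class c})" if "finite X"
    using that by (intro card_mono) auto
  also have "\<dots> \<le> card (p ` {e\<in>colour_class c. p e \<in> X}) + card {a\<in>X. a \<notin> p ` colour_class c}" by (rule card_Un_le)
  also have "card (p ` {e\<in>colour_class c. p e \<in> X}) \<le> card {e\<in>colour_class c. p e \<in> X}" by (rule card_image_le) simp
  finally show ?thesis by (cases "finite X") auto
qed

text \<open>Inclusion-exclusion: the rows \<open>X\<close> and the columns \<open>Y\<close> hold at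
  least s - t cells of colour \<open>c\<close> each and share at most 2 t, so at least 2 s - 4 t of
  the at most n cells of the class are lost.\<close>

lemma colour_class_outside:
  assumes X: "card X = s" and Y: "card Y = s"
    and miss: "card {a\<in>X. a \<notin> fst ` colour_class c} \<le> t" "card {b\<in>Y. b \<notin> snd ` colour_class c} \<le> t"
    and both: "card (colour_class c \<inter> X \<times> Y) \<le> 2 * t"
  shows "card (colour_class c \<inter> ({..<n} - X) \<times> ({..<n} - Y)) + 2 * s \<le> n + 4 * t"
proof -
  let ?C = "colour_class c"
  let ?P = "{e\<in>?C. fst e \<in> X}" and ?Q = "{e\<in>?C. snd e \<in> Y}" and ?O = "?C \<inter> ({..<n} - X) \<times> ({..<n} - Y)"
  have P: "s \<le> card ?P + t" "s \<le> card ?Q + t"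
    using card_class_lines[of fst X c] card_class_lines[of snd Y c] X Y miss by auto
  have "card (?P \<union> ?Q) + card (?P \<inter> ?Q) = card ?P + card ?Q" by (rule card_Un_Int[symmetric]) simp_all
  moreover have "?P \<inter> ?Q = ?C \<inter> X \<times> Y" by (auto simp: mem_Times_iff)
  ultimately have PQ: "card ?P + card ?Q \<le> card (?P \<union> ?Q) + 2 * t" using both by simp
  have "card ?O + card (?P \<union> ?Q) = card (?O \<union> (?P \<union> ?Q))" by (subst card_Un_disjoint) auto
  also have "\<dots> \<le> card ?C" by (intro card_mono) auto
  also have "\<dots> \<le> n" by (rule class_le)
  finally show ?thesis using P PQ by linarith
qed

text \<open>One selection controls two families of events: every pair must receive many absorbers,
  and every nearly full colour must meet few obstructing selections. The second family yields the
  last conclusion, that each colour falls short of the order \<open>n - s - m\<close> of the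
  remaining array by at least \<open>s / 4\<close>.\<close>

lemma absorber_selection:
  fixes R :: "(nat \<times> nat) set" and \<delta> \<beta> :: real
  assumes R: "R \<subseteq> cells" "inj_on col R" "\<delta> * real n ^ 2 \<le> real (card R)"
    and \<delta>: "0 < \<delta>" "\<delta> \<le> 1" and \<beta>: "0 < \<beta>" "\<beta> \<le> \<delta> / 40"
    and A0: "A0 \<subseteq> {..<n}" "card A0 = m" and B0: "B0 \<subseteq> {..<n}" "card B0 = m"
    and s: "s > 0" "4 * m \<le> s" "12 * real s \<le> \<beta> * n"
    and many: "\<And>a b. a \<in> A0 \<Longrightarrow> b \<in> B0 \<Longrightarrow> \<beta> * real n ^ 2 \<le> real (card (absorbers R R a b))"
    and log: "2 * real n ^ 2 \<le> exp (\<beta> * s / 8)"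
  obtains Q where "Q \<subseteq> R" "card Q = s" "inj_on fst Q" "inj_on snd Q" "fst ` Q \<inter> A0 = {}" "snd ` Q \<inter> B0 = {}"
    "col ` Q \<inter> col ` ({..<n} \<times> B0 \<union> A0 \<times> {..<n}) = {}"
    "\<And>a b. a \<in> A0 \<Longrightarrow> b \<in> B0 \<Longrightarrow> \<beta> * s / 8 \<le> real (card (absorbers R Q a b))"
    "\<And>c. real (card (colour_class c \<inter> ({..<n} - (A0 \<union> fst ` Q)) \<times> ({..<n} - (B0 \<union> snd ` Q)))) + s / 4 \<le> real n - s - m"
proof -
  define N where "N = real n"
  have N: "N > 0" "real n = N" using n_pos unfolding N_def by auto
  define F where "F = col ` ({..<n} \<times> B0 \<union> A0 \<times> {..<n})"
  define Valid where "Valid xs = {e\<in>R. fst e \<notin> A0 \<union> fst ` set xs \<and> snd e \<notin> B0 \<union> snd ` set xs \<and> col e \<notin> F}" for xs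
  define good where "good p = {e \<in> R. (fst p, snd e) \<in> R \<and> (fst e, snd p) \<in> R}" for p
  \<comment> \<open>Only these colours need watching: a class with fewer than
    \<open>n - 2 * s\<close> cells satisfies the last conclusion from the outset, because
    \<open>m\<close> is at most \<open>s / 4\<close>.\<close>
  define J where "J = {c \<in> col ` cells. n \<le> card (colour_class c) + 2 * s}"
  \<comment> \<open>The ratio of at most \<open>7 * s * n\<close> obstructing cells to at least
    \<open>\<delta> / 2 * n^2\<close> valid ones.\<close>
  define r where "r = 14 * s / (\<delta> * N)"
  have fR: "finite R" using R(1) by (rule finite_subset) simp
  have fin0: "finite A0" "finite B0" using A0 B0 finite_subset by blast+
  have runR: "set xs \<subseteq> R" if "run Valid xs" for xs
    using that by (induction xs) (auto simp: Valid_def)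
  have ms: "4 * real m \<le> real s" using s by (metis of_nat_le_iff of_nat_mult of_nat_numeral)
  have lost: "real (card (R - Valid xs)) \<le> \<beta> / 2 * N^2" if xs: "run Valid xs" "length xs < s" for xs
  proof -
    let ?A = "A0 \<union> fst ` set xs" and ?B = "B0 \<union> snd ` set xs"
    have sub: "?A \<subseteq> {..<n}" "?B \<subseteq> {..<n}" using A0 B0 runR[OF xs(1)] R(1) unfolding cells_def by auto
    have cA: "card ?A \<le> m + s" "card ?B \<le> m + s"
      using card_Un_le[of A0 "fst ` set xs"] card_Un_le[of B0 "snd ` set xs"] A0 B0 xs
        card_image_le[of "set xs" fst] card_image_le[of "set xs" snd] card_length[of xs] by simp_all
    \<comment> \<open>The colours of \<open>R\<close> are distinct, so forbidding a colour costs at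
      most one cell.\<close>
    let ?D = "{e\<in>R. col e \<in> F}"
    have "card F \<le> card ({..<n} \<times> B0 \<union> A0 \<times> {..<n})" unfolding F_def using fin0 by (intro card_image_le) auto
    also have "\<dots> \<le> n * m + m * n" using card_Un_le[of "{..<n} \<times> B0" "A0 \<times> {..<n}"] A0 B0 by (simp add: card_cartesian_product)
    finally have "card F \<le> n * m + m * n" .
    moreover have "card ?D \<le> card F" by (rule card_inj_on_le[of col]) (use R(2) fin0 in \<open>auto simp: F_def intro: inj_on_subset\<close>)
    ultimately have D: "card ?D \<le> n * m + m * n" by linarith
    have "R - Valid xs \<subseteq> ?A \<times> {..<n} \<union> {..<n} \<times> ?B \<union> ?D"
    proof
      fix e assume e: "e \<in> R - Valid xs"
      then have "fst e < n" "snd e < n" using R(1) unfolding cells_def by auto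
      then show "e \<in> ?A \<times> {..<n} \<union> {..<n} \<times> ?B \<union> ?D"
        using e unfolding Valid_def by (simp add: mem_Times_iff)
    qed
    then have "card (R - Valid xs) \<le> card (?A \<times> {..<n} \<union> {..<n} \<times> ?B \<union> ?D)" using sub fR finite_subset
      by (intro card_mono) auto
    also have "\<dots> \<le> card (?A \<times> {..<n}) + card ({..<n} \<times> ?B) + card ?D"
      using card_Un_le[of "?A \<times> {..<n} \<union> {..<n} \<times> ?B" ?D] card_Un_le[of "?A \<times> {..<n}" "{..<n} \<times> ?B"] by linarith
    also have "\<dots> \<le> (m + s) * n + n * (m + s) + (n * m + m * n)"
      using cA D by (intro add_mono) (auto simp: card_cartesian_product)
    also have "\<dots> = (4 * m + 2 * s) * n" by (simp add: algebra_simps)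
    finally have "real (card (R - Valid xs)) \<le> real ((4 * m + 2 * s) * n)" by (rule of_nat_mono)
    also have "\<dots> = (4 * real m + 2 * real s) * N" unfolding N_def by simp
    also have "\<dots> \<le> (6 * real s) * N" using ms N by (intro mult_right_mono) auto
    also have "\<dots> \<le> (\<beta> / 2 * N) * N" using s(3) N by (intro mult_right_mono) auto
    finally show ?thesis by (simp add: power2_eq_square)
  qed
  have ValidR: "Valid xs \<subseteq> R" for xs unfolding Valid_def by auto
  have cV: "card (Valid xs) \<le> n * n" for xs
    using card_mono[OF finite_cells, of "Valid xs"] ValidR R(1) unfolding card_cells by blast
  have cJ: "real (card (A0 \<times> B0) + card J) \<le> exp (\<beta> * s / 8)"
  proof -
    have "card (A0 \<times> B0) \<le> card cells" using A0 B0 unfolding cells_def by (intro card_mono) auto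
    moreover have "card J \<le> card (col ` cells)" unfolding J_def by (intro card_mono) auto
    moreover have "card (col ` cells) \<le> card cells" by (intro card_image_le) simp
    ultimately have "card (A0 \<times> B0) + card J \<le> 2 * (n * n)" unfolding card_cells by linarith
    then have "real (card (A0 \<times> B0) + card J) \<le> real (2 * (n * n))" by (rule of_nat_mono)
    then show ?thesis using log by (simp add: power2_eq_square)
  qed
  have V_large: "\<delta> / 2 * N^2 \<le> real (card (Valid xs))" if xs: "run Valid xs" "length xs < s" for xs
  proof -
    have "real (card (Valid xs)) = real (card R) - real (card (R - Valid xs))"
      using card_Diff_subset[OF finite_subset[OF ValidR[of xs] fR] ValidR[of xs]] card_mono[OF fR ValidR[of xs]] by (simp add: of_nat_diff)
    moreover have "\<beta> / 2 * N^2 \<le> \<delta> / 2 * N^2" using \<beta> \<delta> by (intro mult_right_mono) auto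
    ultimately show ?thesis using lost[OF xs] R(3) unfolding N by simp
  qed
  have r0: "r \<ge> 0" unfolding r_def using \<delta> N by simp
  obtain xs where xs: "length xs = s" "run Valid xs"
    and hit: "\<And>p. p \<in> A0 \<times> B0 \<Longrightarrow> (1/2) ^ length (filter (\<lambda>x. x \<in> good p) xs) \<le> real (card (A0 \<times> B0) + card J) * (1 - (\<beta> / 2) / 2) ^ s"
    and bad: "\<And>c. c \<in> J \<Longrightarrow> 2 ^ tally_bad (obstructing c) xs \<le> real (card (A0 \<times> B0) + card J) * (1 + r) ^ s"
  proof (rule sequential_selection[of "A0 \<times> B0" J Valid s "\<beta> / 2" good obstructing r])
    show "finite (A0 \<times> B0)" "finite J" using fin0 unfolding J_def by auto
    fix xs assume run: "run Valid xs" "length xs < s"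
    have "0 < \<delta> / 2 * N^2" using \<delta> N by simp
    then have "Valid xs \<noteq> {}" using V_large[OF run] by auto
    then show "finite (Valid xs) \<and> Valid xs \<noteq> {}" using ValidR fR finite_subset by blast
    {
      \<comment> \<open>Of the \<open>\<beta> * n^2\<close> absorbers of the pair at least half are
        still valid, whence the hitting probability \<open>\<beta> / 2\<close>.\<close>
      fix p assume p: "p \<in> A0 \<times> B0"
      have gR: "good p \<subseteq> R" unfolding good_def by auto
      have fg: "finite (good p)" using gR fR finite_subset by blast
      have "good p \<subseteq> (good p \<inter> Valid xs) \<union> (R - Valid xs)" using gR by auto
      then have "card (good p) \<le> card (good p \<inter> Valid xs) + card (R - Valid xs)"
        using fg fR card_mono[of "(good p \<inter> Valid xs) \<union> (R - Valid xs)" "good p"] card_Un_le[of "good p \<inter> Valid xs" "R - Valid xs"] by auto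
      then have "real (card (good p)) \<le> real (card (good p \<inter> Valid xs)) + real (card (R - Valid xs))" by linarith
      moreover have "\<beta> * N^2 \<le> real (card (good p))" using many[of "fst p" "snd p"] p unfolding good_def N by auto
      ultimately have "\<beta> / 2 * N^2 \<le> real (card (good p \<inter> Valid xs))" using lost[OF run] by linarith
      moreover have "real (card (Valid xs)) \<le> N^2" using of_nat_mono[OF cV[of xs]] unfolding N_def by (simp add: power2_eq_square)
      then have "\<beta> / 2 * real (card (Valid xs)) \<le> \<beta> / 2 * N^2" using \<beta> by (intro mult_left_mono) auto
      ultimately show "\<beta> / 2 * real (card (Valid xs)) \<le> real (card (good p \<inter> Valid xs))" by linarith
    }
    {
      fix c assume c: "c \<in> J"
      have "card (obstructing c xs \<inter> Valid xs) \<le> card (obstructing c xs)" unfolding obstructing_def by (intro card_mono) auto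
      also have "\<dots> \<le> 7 * (s * n)" using card_obstructing[of s xs c] s(1) run(2) runR[OF run(1)] R(1) c unfolding J_def by auto
      finally have "real (card (obstructing c xs \<inter> Valid xs)) \<le> real (7 * (s * n))" by (rule of_nat_mono)
      also have "\<dots> = r * (\<delta> / 2 * N^2)" unfolding r_def N_def using \<delta> n_pos by (simp add: power2_eq_square)
      also have "\<dots> \<le> r * real (card (Valid xs))" using V_large[OF run] r0 by (intro mult_left_mono)
      finally show "real (card (obstructing c xs \<inter> Valid xs)) \<le> r * real (card (Valid xs))" .
    }
  next
    fix xs
    assume a: "length xs = s" "run Valid xs"
      "\<And>p. p \<in> A0 \<times> B0 \<Longrightarrow> (1/2) ^ length (filter (\<lambda>x. x \<in> good p) xs) \<le> real (card (A0 \<times> B0) + card J) * (1 - (\<beta> / 2) / 2) ^ s"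
      "\<And>c. c \<in> J \<Longrightarrow> 2 ^ tally_bad (obstructing c) xs \<le> real (card (A0 \<times> B0) + card J) * (1 + r) ^ s"
    show thesis by (rule that[OF a])
  qed (use \<beta> \<delta> r0 in auto)
  define Q where "Q = set xs"
  have QR: "Q \<subseteq> R" unfolding Q_def using runR[OF xs(2)] .
  have props: "inj_on fst (set ys) \<and> inj_on snd (set ys) \<and> distinct ys \<and> fst ` set ys \<inter> A0 = {} \<and> snd ` set ys \<inter> B0 = {} \<and> col ` set ys \<inter> F = {}" if "run Valid ys" for ys
    using that by (induction ys) (auto simp: Valid_def)
  have Q: "inj_on fst Q" "inj_on snd Q" "distinct xs" "fst ` Q \<inter> A0 = {}" "snd ` Q \<inter> B0 = {}" "col ` Q \<inter> F = {}"
    using props[OF xs(2)] unfolding Q_def by auto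
  have cQ: "card Q = s" "card (fst ` Q) = s" "card (snd ` Q) = s"
    using Q xs(1) unfolding Q_def by (auto simp: distinct_card card_image)
  have subQ: "fst ` Q \<subseteq> {..<n}" "snd ` Q \<subseteq> {..<n}" using QR R(1) unfolding cells_def by auto
  have e_half: "exp (- 1) \<le> (1/2 :: real)" "exp (1/2) \<le> (2 :: real)"
  proof -
    show "exp (- 1) \<le> (1/2 :: real)" using exp_ge_add_one_self[of 1] by (simp add: exp_minus field_simps)
    have "exp (1/2 :: real) * exp (1/2) = exp 1" by (simp add: exp_add[symmetric])
    then have "exp (1/2 :: real)^2 \<le> 2^2" using exp_le by (simp add: power2_eq_square)
    then show "exp (1/2) \<le> (2 :: real)" by (rule power2_le_imp_le) simp
  qed
  show thesis
  proof (rule that[of Q])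
    fix a b assume ab: "a \<in> A0" "b \<in> B0"
    let ?h = "length (filter (\<lambda>x. x \<in> good (a, b)) xs)"
    have "?h = card (set (filter (\<lambda>x. x \<in> good (a, b)) xs))" using Q(3) by (simp add: distinct_card[symmetric] del: set_filter)
    also have "set (filter (\<lambda>x. x \<in> good (a, b)) xs) = absorbers R Q a b"
      using QR unfolding good_def Q_def by auto
    finally have h: "?h = card (absorbers R Q a b)" .
    have "exp (- real ?h) = exp (- 1) ^ ?h" by (simp add: exp_of_nat_mult[symmetric])
    also have "\<dots> \<le> (1/2) ^ ?h" using e_half by (intro power_mono) auto
    also have "\<dots> \<le> real (card (A0 \<times> B0) + card J) * (1 - (\<beta> / 2) / 2) ^ s" using hit[of "(a, b)"] ab by simp
    \<comment> \<open>The union bound costs \<open>\<beta> * s / 8\<close>, half of the exponent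
      gained by the selection; the other half becomes the number of hits.\<close>
    also have "\<dots> \<le> exp (\<beta> * s / 8) * exp (- (\<beta> / 4)) ^ s"
    proof (intro mult_mono power_mono cJ)
      show "1 - (\<beta> / 2) / 2 \<le> exp (- (\<beta> / 4))" using exp_ge_add_one_self[of "- (\<beta> / 4)"] by simp
    qed (use \<beta> \<delta> in auto)
    also have "\<dots> = exp (- (\<beta> * s / 8))" by (simp add: exp_of_nat_mult[symmetric] exp_add[symmetric])
    finally have "\<beta> * s / 8 \<le> real ?h" by simp
    then show "\<beta> * s / 8 \<le> real (card (absorbers R Q a b))" unfolding h .
  next
    fix c
    let ?X = "A0 \<union> fst ` Q" and ?Y = "B0 \<union> snd ` Q"
    let ?Z = "colour_class c \<inter> ({..<n} - ?X) \<times> ({..<n} - ?Y)"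
    show "real (card ?Z) + s / 4 \<le> real n - s - m"
    proof (cases "n \<le> card (colour_class c) + 2 * s")
      case False
      have "card ?Z \<le> card (colour_class c)" by (intro card_mono) auto
      then show ?thesis using False ms by linarith
    next
      case True
      define t where "t = tally_bad (obstructing c) xs"
      \<comment> \<open>With t \<le> s/8 the class loses at least 2 s - s/2 cells, which is at least
        s + m + s/4 since m \<le> s/4.\<close>
      have t: "8 * real t \<le> real s"
      proof (cases "c \<in> J")
        \<comment> \<open>A colour outside \<open>J\<close> with so large a class must be absent
          from the array. Its class is then empty, so n \<le> 2 s, which contradicts 12 s \<le>
          n.\<close>
        case False
        then have "c \<notin> col ` cells" using True unfolding J_def by auto
        then have "colour_class c = {}" unfolding colour_class_def by auto
        then have "N \<le> 2 * real s" using True unfolding N_def by simp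
        moreover have "12 * real s \<le> N"
        proof -
          have "\<beta> * N \<le> 1 * N" using \<beta> \<delta> N by (intro mult_right_mono) auto
          then show ?thesis using s(3) unfolding N by linarith
        qed
        ultimately show ?thesis using s(1) by linarith
      next
        case cJ': True
        have "exp (real t / 2) = exp (1/2) ^ t" by (simp add: exp_of_nat_mult[symmetric])
        also have "\<dots> \<le> 2 ^ t" using e_half by (intro power_mono) auto
        also have "\<dots> \<le> real (card (A0 \<times> B0) + card J) * (1 + r) ^ s" using bad[OF cJ'] unfolding t_def .
        also have "\<dots> \<le> exp (\<beta> * s / 8) * exp r ^ s"
          using r0 by (intro mult_mono power_mono cJ exp_ge_add_one_self) auto
        also have "\<dots> = exp (\<beta> * s / 8 + s * r)" by (simp add: exp_of_nat_mult[symmetric] exp_add[symmetric])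
        finally have 1: "real t / 2 \<le> \<beta> * s / 8 + s * r" by simp
        have "r \<le> 14 / 480"
        proof -
          have "\<beta> * N \<le> (\<delta> / 40) * N" using \<beta>(2) N by (intro mult_right_mono) auto
          then have "12 * real s \<le> (\<delta> / 40) * N" using s(3) unfolding N by linarith
          then show ?thesis unfolding r_def using \<delta> N by (simp add: field_simps)
        qed
        then have "s * r \<le> s * (14 / 480)" by (intro mult_left_mono) auto
        moreover have "\<beta> * s \<le> 1/40 * s" using \<beta> \<delta> by (intro mult_right_mono) auto
        ultimately show ?thesis using 1 by linarith
      qed
      have "card (colour_class c \<inter> ({..<n} - fst ` Q) \<times> ({..<n} - snd ` Q)) + 2 * s \<le> n + 4 * t"
      proof (rule colour_class_outside[OF cQ(2,3)])
        have V: "x \<in> cells" if "x \<in> Valid ys" for x ys using that ValidR R(1) by blast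
        show "card {a \<in> fst ` Q. a \<notin> fst ` colour_class c} \<le> t" "card {b \<in> snd ` Q. b \<notin> snd ` colour_class c} \<le> t"
          "card (colour_class c \<inter> fst ` Q \<times> snd ` Q) \<le> 2 * t"
          unfolding Q_def t_def by (rule missing_obstructed[OF xs(2) V], assumption, simp)+ (rule rectangle_obstructed[OF xs(2) V])
      qed
      moreover have "card ?Z \<le> card (colour_class c \<inter> ({..<n} - fst ` Q) \<times> ({..<n} - snd ` Q))" by (intro card_mono) auto
      ultimately have "card ?Z + 2 * s \<le> n + 4 * t" by linarith
      then have "real (card ?Z) + 2 * s \<le> real n + 4 * real t" by linarith
      then show ?thesis using t ms by linarith
    qed
  qed (use QR cQ Q in \<open>auto simp: F_def\<close>)
qed

end

section \<open>Completing a partial rainbow matching\<close>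

context latin_array
begin

definition rainbow_partial :: "(nat \<times> nat) set \<Rightarrow> bool" where
  "rainbow_partial F \<longleftrightarrow> F \<subseteq> cells \<and> inj_on fst F \<and> inj_on snd F \<and> inj_on col F"

lemma rainbow_partial_finite: "rainbow_partial F \<Longrightarrow> finite F"
  unfolding rainbow_partial_def using finite_cells finite_subset by blast

lemma rainbow_partial_subset: "rainbow_partial F \<Longrightarrow> G \<subseteq> F \<Longrightarrow> rainbow_partial G"
  unfolding rainbow_partial_def by (meson inj_on_subset order_trans)

lemma inj_on_insertI: "inj_on f F \<Longrightarrow> f e \<notin> f ` F \<Longrightarrow> inj_on f (insert e F)"
  by (simp add: inj_on_insert) blast

lemma rainbow_partial_insert:
  assumes "rainbow_partial F" "e \<in> cells" "fst e \<notin> fst ` F" "snd e \<notin> snd ` F" "col e \<notin> col ` F"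
  shows "rainbow_partial (insert e F)"
  using assms unfolding rainbow_partial_def by (intro conjI inj_on_insertI) auto

lemma rainbow_partial_Un:
  assumes "rainbow_partial F" "rainbow_partial G" "fst ` F \<inter> fst ` G = {}" "snd ` F \<inter> snd ` G = {}" "col ` F \<inter> col ` G = {}"
  shows "rainbow_partial (F \<union> G)"
  using assms unfolding rainbow_partial_def by (auto simp: inj_on_Un)

lemma row_colours_le:
  assumes "x < n" "B \<subseteq> {..<n}" "finite C"
  shows "card {b\<in>B. col (x, b) \<in> C} \<le> card C"
proof (rule card_inj_on_le[of "\<lambda>b. col (x, b)"])
  show "inj_on (\<lambda>b. col (x, b)) {b\<in>B. col (x, b) \<in> C}"
    using assms(1,2) by (intro inj_onI) (rule row_inj[of x], auto)
qed (use assms in auto)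

lemma column_colours_le:
  assumes "y < n" "A \<subseteq> {..<n}" "finite C"
  shows "card {a\<in>A. col (a, y) \<in> C} \<le> card C"
proof (rule card_inj_on_le[of "\<lambda>a. col (a, y)"])
  show "inj_on (\<lambda>a. col (a, y)) {a\<in>A. col (a, y) \<in> C}"
    using assms(1,2) by (intro inj_onI) (rule col_inj[of _ _ y], auto)
qed (use assms in auto)

text \<open>Replacement cells lie in the rainbow set \<open>R\<close>, and those of different cells
  of \<open>Q\<close> are in different lines, so each forbidden colour spoils at most one absorber
  through its cell in row \<open>a\<close> and at most one through its cell in column
  \<open>b\<close>.\<close>

lemma absorber_colours_le:
  assumes R: "inj_on col R" and Q: "inj_on fst Q" "inj_on snd Q" and C: "finite C"
  shows "card {e\<in>Q. (a, snd e) \<in> R \<and> col (a, snd e) \<in> C} \<le> card C"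
    and "card {e\<in>Q. (fst e, b) \<in> R \<and> col (fst e, b) \<in> C} \<le> card C"
proof -
  show "card {e\<in>Q. (a, snd e) \<in> R \<and> col (a, snd e) \<in> C} \<le> card C"
  proof (rule card_inj_on_le[of "\<lambda>e. col (a, snd e)"])
    show "inj_on (\<lambda>e. col (a, snd e)) {e\<in>Q. (a, snd e) \<in> R \<and> col (a, snd e) \<in> C}"
      by (rule inj_onI) (use R Q(2) in \<open>auto dest: inj_onD simp: inj_on_eq_iff\<close>)
  qed (use C in auto)
  show "card {e\<in>Q. (fst e, b) \<in> R \<and> col (fst e, b) \<in> C} \<le> card C"
  proof (rule card_inj_on_le[of "\<lambda>e. col (fst e, b)"])
    show "inj_on (\<lambda>e. col (fst e, b)) {e\<in>Q. (fst e, b) \<in> R \<and> col (fst e, b) \<in> C}"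
      by (rule inj_onI) (use R Q(1) in \<open>auto dest: inj_onD simp: inj_on_eq_iff\<close>)
  qed (use C in auto)
qed

lemma exists_outside:
  assumes "finite S" "finite T" "card T < card S" shows "\<exists>x\<in>S. x \<notin> T"
  using assms by (metis card_mono linorder_not_le subsetI)

text \<open>Greedy choice: each earlier link blocks one column and one colour, hence at most two
  cells of the row, and fewer than \<open>card X\<close> links precede.\<close>

lemma link_rows:
  assumes F: "rainbow_partial F" and X: "X \<subseteq> {..<n}" "X \<inter> fst ` F = {}" and B: "B \<subseteq> {..<n}" "B \<inter> snd ` F = {}"
    and many: "\<And>x. x \<in> X \<Longrightarrow> 2 * card X \<le> card {b\<in>B. col (x, b) \<notin> col ` F}"
  shows "\<exists>L \<subseteq> X \<times> B. fst ` L = X \<and> rainbow_partial (F \<union> L)"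
proof -
  have finX: "finite X" using X finite_subset by blast
  have finB: "finite B" using B finite_subset by blast
  have "\<exists>L \<subseteq> Z \<times> B. fst ` L = Z \<and> rainbow_partial (F \<union> L)" if "Z \<subseteq> X" for Z
    using finite_subset[OF that finX] that
  proof (induction Z rule: finite_induct)
    case empty
    then show ?case using F by (intro exI[of _ "{}"]) simp
  next
    case (insert x Z)
    then obtain L where L: "L \<subseteq> Z \<times> B" "fst ` L = Z" "rainbow_partial (F \<union> L)" by auto
    have x: "x \<in> X" "x < n" "x \<notin> Z" using insert X by auto
    have finL: "finite L" using rainbow_partial_finite[OF L(3)] by simp
    have "inj_on fst L" using L(3) unfolding rainbow_partial_def by (auto intro: inj_on_subset)
    then have cL: "card L = card Z" using L(2) card_image by metis
    have "card (insert x Z) \<le> card X" using insert.prems finX by (intro card_mono) auto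
    then have cZ: "card L < card X" using x insert(1) cL by simp
    let ?T = "snd ` L \<union> {b\<in>B. col (x, b) \<in> col ` L}"
    have "card ?T \<le> card (snd ` L) + card {b\<in>B. col (x, b) \<in> col ` L}" by (rule card_Un_le)
    also have "\<dots> \<le> card L + card (col ` L)"
      using finL by (intro add_mono card_image_le row_colours_le x B) auto
    also have "\<dots> \<le> card L + card L" using finL by (intro add_left_mono card_image_le)
    finally have "card ?T < card {b\<in>B. col (x, b) \<notin> col ` F}" using many[OF x(1)] cZ by linarith
    then obtain b where b: "b \<in> B" "col (x, b) \<notin> col ` F" "b \<notin> ?T"
      using exists_outside[of "{b\<in>B. col (x, b) \<notin> col ` F}" ?T] finL finB by auto
    have "rainbow_partial (insert (x, b) (F \<union> L))"
    proof (rule rainbow_partial_insert[OF L(3)])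
      show "(x, b) \<in> cells" using x b B unfolding cells_def by auto
      show "fst (x, b) \<notin> fst ` (F \<union> L)" using x(1,3) X(2) L(2) unfolding image_Un by auto
      show "snd (x, b) \<notin> snd ` (F \<union> L)" using b B(2) unfolding image_Un by auto
      show "col (x, b) \<notin> col ` (F \<union> L)" using b unfolding image_Un by auto
    qed
    then show ?case using L b by (intro exI[of _ "insert (x, b) L"]) auto
  qed
  then show ?thesis by blast
qed

lemma link_columns:
  assumes F: "rainbow_partial F" and Y: "Y \<subseteq> {..<n}" "Y \<inter> snd ` F = {}" and A: "A \<subseteq> {..<n}" "A \<inter> fst ` F = {}"
    and many: "\<And>y. y \<in> Y \<Longrightarrow> 2 * card Y \<le> card {a\<in>A. col (a, y) \<notin> col ` F}"
  shows "\<exists>L \<subseteq> A \<times> Y. snd ` L = Y \<and> rainbow_partial (F \<union> L)"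
proof -
  \<comment> \<open>The transposed array, in which the columns to be linked are rows.\<close>
  interpret T: latin_array n "col \<circ> prod.swap"
    using n_pos row_inj col_inj by unfold_locales auto
  have swap: "T.rainbow_partial G \<longleftrightarrow> rainbow_partial (prod.swap ` G)" for G
  proof -
    have "inj_on fst (prod.swap ` G) \<longleftrightarrow> inj_on (fst \<circ> prod.swap) G"
      "inj_on snd (prod.swap ` G) \<longleftrightarrow> inj_on (snd \<circ> prod.swap) G"
      "inj_on col (prod.swap ` G) \<longleftrightarrow> inj_on (col \<circ> prod.swap) G" by (rule comp_inj_on_iff, simp)+
    moreover have "fst \<circ> prod.swap = (snd :: nat \<times> nat \<Rightarrow> nat)" "snd \<circ> prod.swap = (fst :: nat \<times> nat \<Rightarrow> nat)" by auto
    moreover have "G \<subseteq> cells \<longleftrightarrow> prod.swap ` G \<subseteq> cells" unfolding cells_def by auto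
    ultimately show ?thesis unfolding T.rainbow_partial_def rainbow_partial_def by (simp only:) blast
  qed
  have "\<exists>L \<subseteq> Y \<times> A. fst ` L = Y \<and> T.rainbow_partial (prod.swap ` F \<union> L)"
    by (rule T.link_rows) (use F Y A many in \<open>auto simp: swap image_image\<close>)
  then obtain L where L: "L \<subseteq> Y \<times> A" "fst ` L = Y" "rainbow_partial (prod.swap ` (prod.swap ` F \<union> L))"
    unfolding swap by blast
  then show ?thesis by (intro exI[of _ "prod.swap ` L"]) (auto simp: image_Un image_image)
qed

text \<open>By the invariant \<open>card (Q - F) \<le> card Z\<close> each absorption spoils at most
  one cell of \<open>Q\<close>, so an absorber is always left. All new cells come from the rainbow
  set \<open>R\<close>, so their colours can clash only with \<open>F0\<close>, and
  \<open>many\<close> counts just the absorbers that avoid this.\<close>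

lemma absorb_pairs:
  assumes R: "R \<subseteq> cells" "inj_on col R" and Q: "Q \<subseteq> R" and F0: "rainbow_partial (F0 \<union> Q)"
    and A: "A \<subseteq> {..<n}" "A \<inter> fst ` (F0 \<union> Q) = {}" and B: "B \<subseteq> {..<n}" "B \<inter> snd ` (F0 \<union> Q) = {}"
    and g: "bij_betw g A B"
    and many: "\<And>a b. a \<in> A \<Longrightarrow> b \<in> B \<Longrightarrow> card A \<le> card {e\<in>Q. (a, snd e) \<in> R \<and> (fst e, b) \<in> R \<and> col (a, snd e) \<notin> col ` F0 \<and> col (fst e, b) \<notin> col ` F0}"
  shows "\<exists>F. rainbow_partial F \<and> fst ` F = fst ` (F0 \<union> Q) \<union> A"
proof -
  have finA: "finite A" using A finite_subset by blast
  have finQ: "finite Q" using rainbow_partial_finite[OF F0] by simp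
  have "\<exists>F. rainbow_partial F \<and> fst ` F = fst ` (F0 \<union> Q) \<union> Z \<and> snd ` F = snd ` (F0 \<union> Q) \<union> g ` Z \<and> F \<subseteq> F0 \<union> R \<and> card (Q - F) \<le> card Z"
    if "Z \<subseteq> A" for Z
    using finite_subset[OF that finA] that
  proof (induction Z rule: finite_induct)
    case empty
    have "card (Q - (F0 \<union> Q)) = 0" by (simp add: Diff_eq_empty_iff[THEN iffD2])
    then show ?case using F0 Q by (intro exI[of _ "F0 \<union> Q"]) (simp add: le_supI2)
  next
    case (insert a Z)
    then obtain F where F: "rainbow_partial F" "fst ` F = fst ` (F0 \<union> Q) \<union> Z" "snd ` F = snd ` (F0 \<union> Q) \<union> g ` Z" "F \<subseteq> F0 \<union> R"
      "card (Q - F) \<le> card Z" by auto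
    define b where "b = g a"
    have a: "a \<in> A" "a < n" "a \<notin> fst ` F" using insert A F(2) by auto
    have b: "b \<in> B" "b < n" using a g B unfolding b_def bij_betw_def by auto
    have "b \<notin> g ` Z"
    proof
      assume "b \<in> g ` Z"
      then obtain z where z: "z \<in> Z" "g a = g z" unfolding b_def by auto
      then have "a = z" using g insert a unfolding bij_betw_def inj_on_def by auto
      then show False using z insert by simp
    qed
    then have bF: "b \<notin> snd ` F" using b B(2) F(3) by auto
    let ?C = "{e\<in>Q. (a, snd e) \<in> R \<and> (fst e, b) \<in> R \<and> col (a, snd e) \<notin> col ` F0 \<and> col (fst e, b) \<notin> col ` F0}"
    have "card (insert a Z) \<le> card A" using insert.prems finA by (intro card_mono) auto
    then have "card (Q - F) < card ?C" using F(5) many[OF a(1) b(1)] insert(1,2) by simp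
    then obtain e where e: "e \<in> ?C" "e \<notin> Q - F" using exists_outside[of ?C "Q - F"] finQ by auto
    then have eF: "e \<in> F" by auto
    define c1 where "c1 = (a, snd e)"
    define c2 where "c2 = (fst e, b)"
    have c: "c1 \<in> R" "c2 \<in> R" "col c1 \<notin> col ` F0" "col c2 \<notin> col ` F0" "fst c1 = a" "snd c1 = snd e" "fst c2 = fst e" "snd c2 = b"
      using e unfolding c1_def c2_def by auto
    have inj: "inj_on fst F" "inj_on snd F" using F(1) unfolding rainbow_partial_def by auto
    have fe: "fst e \<notin> fst ` (F - {e})" "snd e \<notin> snd ` (F - {e})"
      using inj eF by (auto dest: inj_onD)
    have notcol: "col c1 \<notin> col ` F" "col c2 \<notin> col ` F"
    proof -
      \<comment> \<open>Cells of \<open>F\<close> lie in \<open>F0\<close> or in \<open>R\<close>: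
        the colours of \<open>F0\<close> are avoided by the choice of \<open>e\<close>, and distinct
        cells of \<open>R\<close> have distinct colours.\<close>
      have key: "col r \<noteq> col c'" if "r \<in> F" "c' \<in> R" "col c' \<notin> col ` F0" "c' \<notin> F" for r c'
      proof (cases "r \<in> F0")
        case True
        then have "col r \<in> col ` F0" by (rule imageI)
        then show ?thesis using that(3) by metis
      next
        case False
        then have "r \<in> R" "r \<noteq> c'" using that F(4) by auto
        then show ?thesis using that(2) R(2) by (metis inj_on_contraD)
      qed
      have "c1 \<notin> F" using a(3) c(5) imageI[of c1 F fst] by metis
      then show "col c1 \<notin> col ` F" using key[of _ c1] c(1,3) by (metis imageE)
      have "c2 \<notin> F" using bF c(8) imageI[of c2 F snd] by metis
      then show "col c2 \<notin> col ` F" using key[of _ c2] c(2,4) by (metis imageE)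
    qed
    have ae: "a \<noteq> fst e" using a(3) eF by auto
    have "rainbow_partial (insert c2 (insert c1 (F - {e})))"
    proof (intro rainbow_partial_insert)
      show "rainbow_partial (F - {e})" using F(1) by (rule rainbow_partial_subset) auto
      show "c1 \<in> cells" "c2 \<in> cells" using c R by auto
      show "fst c1 \<notin> fst ` (F - {e})" using c a by auto
      show "snd c1 \<notin> snd ` (F - {e})" using c fe by simp
      show "col c1 \<notin> col ` (F - {e})" using notcol by auto
      show "fst c2 \<notin> fst ` insert c1 (F - {e})" using c ae fe by auto
      have "b \<noteq> snd e" using bF eF by auto
      then show "snd c2 \<notin> snd ` insert c1 (F - {e})" using c bF by auto
      have "c1 \<noteq> c2" using c(5,7) ae by metis
      then have "col c1 \<noteq> col c2" using c(1,2) R(2) by (metis inj_on_contraD)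
      then show "col c2 \<notin> col ` insert c1 (F - {e})" using notcol by auto
    qed
    moreover have "fst ` insert c2 (insert c1 (F - {e})) = fst ` (F0 \<union> Q) \<union> insert a Z"
    proof -
      have "fst ` F = insert (fst e) (fst ` (F - {e}))" using eF by blast
      then have "fst ` insert c2 (insert c1 (F - {e})) = insert a (fst ` F)" using c by auto
      then show ?thesis using F(2) by simp
    qed
    moreover have "snd ` insert c2 (insert c1 (F - {e})) = snd ` (F0 \<union> Q) \<union> g ` insert a Z"
    proof -
      have "snd ` F = insert (snd e) (snd ` (F - {e}))" using eF by blast
      then have "snd ` insert c2 (insert c1 (F - {e})) = insert b (snd ` F)" using c by auto
      then show ?thesis using F(3) b_def by simp
    qed
    moreover have "insert c2 (insert c1 (F - {e})) \<subseteq> F0 \<union> R" using c F(4) by auto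
    moreover have "card (Q - insert c2 (insert c1 (F - {e}))) \<le> card (insert a Z)"
    proof -
      have "card (Q - insert c2 (insert c1 (F - {e}))) \<le> card (insert e (Q - F))" using finQ by (intro card_mono) auto
      also have "\<dots> \<le> Suc (card (Q - F))" using finQ by (simp add: card_insert_if)
      finally show ?thesis using F(5) insert(1,2) by simp
    qed
    ultimately show ?case by blast
  qed
  from this[OF order.refl] show ?thesis by (elim exE conjE) (intro exI conjI)
qed

text \<open>The constants count what the stages use up. Linking at most \<open>k\<close> rows takes
  \<open>2 * k\<close>; linking columns takes the same after the \<open>k\<close> colours of the row
  links are gone, hence \<open>3 * k\<close>. The at most \<open>2 * k\<close> colours of all links
  spoil at most \<open>4 * k\<close> absorbers of a pair, which leaves \<open>m\<close> for at most
  \<open>m\<close> absorptions. By \<open>colQ\<close> the links cannot repeat a colour of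
  \<open>Q\<close>.\<close>

lemma rainbow_completion:
  assumes R: "R \<subseteq> cells" "inj_on col R" and Q: "Q \<subseteq> R" "inj_on fst Q" "inj_on snd Q"
    and A0: "A0 \<subseteq> {..<n}" "card A0 = m" "fst ` Q \<inter> A0 = {}" and B0: "B0 \<subseteq> {..<n}" "card B0 = m" "snd ` Q \<inter> B0 = {}"
    and colQ: "col ` Q \<inter> col ` ({..<n} \<times> B0 \<union> A0 \<times> {..<n}) = {}"
    and M: "rainbow_partial M" "M \<subseteq> Ar \<times> Br" "col ` M \<inter> col ` Q = {}"
    and Ar: "Ar = {..<n} - (A0 \<union> fst ` Q)" and Br: "Br = {..<n} - (B0 \<union> snd ` Q)"
    and k: "card Ar \<le> card M + k" "k \<le> m"
    and rows: "\<And>x. x \<in> Ar \<Longrightarrow> 2 * k \<le> card {b\<in>B0. col (x, b) \<notin> col ` M}"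
    and columns: "\<And>y. y \<in> Br \<Longrightarrow> 3 * k \<le> card {a\<in>A0. col (a, y) \<notin> col ` M}"
    and absorb: "\<And>a b. a \<in> A0 \<Longrightarrow> b \<in> B0 \<Longrightarrow> m + 4 * k \<le>
       card {e\<in>Q. (a, snd e) \<in> R \<and> (fst e, b) \<in> R \<and> col (a, snd e) \<notin> col ` M \<and> col (fst e, b) \<notin> col ` M}"
  shows "\<exists>F. rainbow_partial F \<and> card F = n"
proof -
  have fin: "finite A0" "finite B0" "finite Q" "finite M" "finite R" "finite Ar" "finite Br"
  proof -
    show "finite A0" "finite B0" by (rule finite_subset[OF A0(1)], simp, rule finite_subset[OF B0(1)], simp)
    show "finite R" by (rule finite_subset[OF R(1)]) simp
    then show "finite Q" by (rule finite_subset[OF Q(1)])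
    show "finite M" by (rule rainbow_partial_finite[OF M(1)])
    show "finite Ar" "finite Br" unfolding Ar Br by simp_all
  qed
  have subQ: "fst ` Q \<subseteq> {..<n}" "snd ` Q \<subseteq> {..<n}" "Q \<subseteq> cells" using Q(1) R(1) unfolding cells_def by auto
  have rQ: "rainbow_partial Q" unfolding rainbow_partial_def using Q subQ inj_on_subset[OF R(2) Q(1)] by simp
  have cQ: "card (fst ` Q) = card Q" "card (snd ` Q) = card Q" using Q by (auto intro: card_image)
  have inj: "inj_on fst M" "inj_on snd M" "M \<subseteq> cells" using M(1) unfolding rainbow_partial_def by auto
  have cM: "card (fst ` M) = card M" "card (snd ` M) = card M" using inj by (auto intro: card_image)
  have subM: "fst ` M \<subseteq> Ar" "snd ` M \<subseteq> Br" using M(2) by auto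
  have cAr: "card Ar = n - (m + card Q)" "card Br = n - (m + card Q)"
    unfolding Ar Br using A0 B0 subQ fin cQ by (auto simp: card_Diff_subset card_Un_disjoint Int_commute)
  define X where "X = Ar - fst ` M"
  define Y where "Y = Br - snd ` M"
  have cX: "card X \<le> k" "card Y = card X" "finite X" "finite Y"
    unfolding X_def Y_def using fin subM cM k cAr by (auto simp: card_Diff_subset)
  have XY: "X \<subseteq> {..<n}" "Y \<subseteq> {..<n}" "X \<inter> A0 = {}" "Y \<inter> B0 = {}" unfolding X_def Y_def Ar Br by auto
  have rMQ: "rainbow_partial (M \<union> Q)"
    by (rule rainbow_partial_Un[OF M(1) rQ]) (use subM M(3) in \<open>auto simp: Ar Br\<close>)
  have row_Q: "col (x, b) \<notin> col ` Q" if "x < n" "b \<in> B0" for x b using colQ that by auto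
  have col_Q: "col (a, y) \<notin> col ` Q" if "y < n" "a \<in> A0" for a y using colQ that by auto
  have "\<exists>L \<subseteq> X \<times> B0. fst ` L = X \<and> rainbow_partial ((M \<union> Q) \<union> L)"
  proof (rule link_rows[OF rMQ XY(1) _ B0(1)])
    show "X \<inter> fst ` (M \<union> Q) = {}" unfolding X_def Ar by auto
    show "B0 \<inter> snd ` (M \<union> Q) = {}" using B0(3) subM(2) unfolding Br by auto
    fix x assume x: "x \<in> X"
    then have "{b\<in>B0. col (x, b) \<notin> col ` (M \<union> Q)} = {b\<in>B0. col (x, b) \<notin> col ` M}"
      using row_Q[of x] XY unfolding image_Un by auto
    then show "2 * card X \<le> card {b\<in>B0. col (x, b) \<notin> col ` (M \<union> Q)}"
      using rows[of x] x cX(1) unfolding X_def by simp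
  qed
  then obtain L1 where L1: "L1 \<subseteq> X \<times> B0" "fst ` L1 = X" "rainbow_partial (M \<union> Q \<union> L1)" by blast
  have finL1: "finite L1" using rainbow_partial_finite[OF L1(3)] by simp
  have injL1: "inj_on fst L1" "inj_on snd L1" using L1(3) unfolding rainbow_partial_def by (auto intro: inj_on_subset)
  have cL1: "card L1 = card X" using card_image[OF injL1(1)] L1(2) by simp
  have "\<exists>L \<subseteq> A0 \<times> Y. snd ` L = Y \<and> rainbow_partial ((M \<union> Q \<union> L1) \<union> L)"
  proof (rule link_columns[OF L1(3) XY(2) _ A0(1)])
    show "Y \<inter> snd ` (M \<union> Q \<union> L1) = {}" using L1(1) XY unfolding Y_def Br by auto
    show "A0 \<inter> fst ` (M \<union> Q \<union> L1) = {}" using A0(3) subM(1) L1(2) XY unfolding Ar image_Un by auto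
    fix y assume y: "y \<in> Y"
    then have yn: "y < n" "y \<in> Br" using XY unfolding Y_def by auto
    have "{a\<in>A0. col (a, y) \<notin> col ` M} \<subseteq> {a\<in>A0. col (a, y) \<notin> col ` (M \<union> Q \<union> L1)} \<union> {a\<in>A0. col (a, y) \<in> col ` L1}"
      using col_Q[OF yn(1)] unfolding image_Un by auto
    then have "card {a\<in>A0. col (a, y) \<notin> col ` M} \<le> card ({a\<in>A0. col (a, y) \<notin> col ` (M \<union> Q \<union> L1)} \<union> {a\<in>A0. col (a, y) \<in> col ` L1})"
      using fin by (intro card_mono) auto
    also have "\<dots> \<le> card {a\<in>A0. col (a, y) \<notin> col ` (M \<union> Q \<union> L1)} + card {a\<in>A0. col (a, y) \<in> col ` L1}" by (rule card_Un_le)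
    also have "\<dots> \<le> card {a\<in>A0. col (a, y) \<notin> col ` (M \<union> Q \<union> L1)} + card (col ` L1)"
      using finL1 by (intro add_left_mono column_colours_le yn A0) auto
    also have "card (col ` L1) \<le> k" using card_image_le[OF finL1, of col] cL1 cX(1) by simp
    finally show "2 * card Y \<le> card {a\<in>A0. col (a, y) \<notin> col ` (M \<union> Q \<union> L1)}"
      using columns[OF yn(2)] cX by simp
  qed
  then obtain L2 where L2: "L2 \<subseteq> A0 \<times> Y" "snd ` L2 = Y" "rainbow_partial (M \<union> Q \<union> L1 \<union> L2)" by blast
  have finL2: "finite L2" using rainbow_partial_finite[OF L2(3)] by simp
  have injL2: "inj_on fst L2" "inj_on snd L2" using L2(3) unfolding rainbow_partial_def by (auto intro: inj_on_subset)
  have cL2: "card L2 = card Y" using card_image[OF injL2(2)] L2(2) by simp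
  define F0 where "F0 = M \<union> L1 \<union> L2"
  define A where "A = A0 - fst ` L2"
  define B where "B = B0 - snd ` L1"
  have sub: "fst ` L2 \<subseteq> A0" "snd ` L1 \<subseteq> B0" using L1 L2 by auto
  \<comment> \<open>Equally many rows and columns were uncovered, and each took one element of
    \<open>B0\<close> or \<open>A0\<close>, so the rest can be paired by any bijection.\<close>
  have "card A = m - card X" "card B = m - card X"
    unfolding A_def B_def using sub fin A0 B0 finL1 finL2 card_image[OF injL1(2)] card_image[OF injL2(1)] cL1 cL2 cX
    by (auto simp: card_Diff_subset)
  moreover have finAB: "finite A" "finite B" unfolding A_def B_def using fin by auto
  ultimately obtain g where g: "bij_betw g A B" using finite_same_card_bij[of A B] by auto
  have F0Q: "F0 \<union> Q = M \<union> Q \<union> L1 \<union> L2" unfolding F0_def by auto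
  have fF0: "fst ` (F0 \<union> Q) = fst ` M \<union> X \<union> fst ` Q \<union> fst ` L2" "snd ` (F0 \<union> Q) = snd ` M \<union> snd ` L1 \<union> snd ` Q \<union> Y"
    unfolding F0_def using L1(2) L2(2) by auto
  have "\<exists>F. rainbow_partial F \<and> fst ` F = fst ` (F0 \<union> Q) \<union> A"
  proof (rule absorb_pairs[OF R Q(1) _ _ _ _ _ g])
    show "rainbow_partial (F0 \<union> Q)" using L2(3) unfolding F0Q .
    show "A \<subseteq> {..<n}" "B \<subseteq> {..<n}" unfolding A_def B_def using A0 B0 by auto
    show "A \<inter> fst ` (F0 \<union> Q) = {}" unfolding fF0 A_def using A0(3) subM(1) XY unfolding Ar by auto
    show "B \<inter> snd ` (F0 \<union> Q) = {}" unfolding fF0 B_def using B0(3) subM(2) XY unfolding Br by auto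
    fix a b assume ab: "a \<in> A" "b \<in> B"
    let ?C = "col ` L1 \<union> col ` L2"
    let ?G = "{e\<in>Q. (a, snd e) \<in> R \<and> (fst e, b) \<in> R \<and> col (a, snd e) \<notin> col ` M \<and> col (fst e, b) \<notin> col ` M}"
    let ?H = "{e\<in>Q. (a, snd e) \<in> R \<and> (fst e, b) \<in> R \<and> col (a, snd e) \<notin> col ` F0 \<and> col (fst e, b) \<notin> col ` F0}"
    let ?K1 = "{e\<in>Q. (a, snd e) \<in> R \<and> col (a, snd e) \<in> ?C}" and ?K2 = "{e\<in>Q. (fst e, b) \<in> R \<and> col (fst e, b) \<in> ?C}"
    have finC: "finite ?C" using finL1 finL2 by auto
    have cC: "card ?C \<le> 2 * k"
      using card_Un_le[of "col ` L1" "col ` L2"] card_image_le[OF finL1, of col] card_image_le[OF finL2, of col] cL1 cL2 cX by linarith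
    have K: "card ?K1 \<le> card ?C" "card ?K2 \<le> card ?C" by (rule absorber_colours_le[OF R(2) Q(2,3) finC])+
    have "?G \<subseteq> ?H \<union> ?K1 \<union> ?K2" unfolding F0_def image_Un by blast
    then have "card ?G \<le> card (?H \<union> ?K1 \<union> ?K2)" using fin by (intro card_mono) auto
    also have "\<dots> \<le> card ?H + card ?K1 + card ?K2"
      using card_Un_le[of "?H \<union> ?K1" ?K2] card_Un_le[of ?H ?K1] by linarith
    finally have "card ?G \<le> card ?H + card ?K1 + card ?K2" .
    moreover have "m + 4 * k \<le> card ?G" using absorb ab unfolding A_def B_def by blast
    moreover have "card A \<le> m" unfolding A_def using A0 fin card_mono[of A0 "A0 - fst ` L2"] by auto
    ultimately show "card A \<le> card ?H" using K cC by linarith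
  qed
  then obtain F where F: "rainbow_partial F" "fst ` F = fst ` (F0 \<union> Q) \<union> A" by blast
  have "fst ` F = {..<n}"
  proof
    show "fst ` F \<subseteq> {..<n}" using F(1) unfolding rainbow_partial_def cells_def by auto
    show "{..<n} \<subseteq> fst ` F" unfolding F(2) fF0 A_def X_def Ar by blast
  qed
  moreover have "card (fst ` F) = card F" using F(1) unfolding rainbow_partial_def by (auto intro: card_image)
  ultimately have "card F = n" by simp
  then show ?thesis using F(1) by blast
qed

end

section \<open>The nibble in an array\<close>

context latin_array
begin

text \<open>With rows, columns and colours as the vertices, disjoint hyperedges come from cells that
  differ in all three, so a matching of hyperedges is a partial rainbow matching.\<close>

definition hyperedge :: "nat \<times> nat \<Rightarrow> (nat + nat + 'c) set" where
  "hyperedge e = {Inl (fst e), Inr (Inl (snd e)), Inr (Inr (col e))}"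

lemma in_hyperedge [simp]:
  "Inl a \<in> hyperedge e \<longleftrightarrow> a = fst e" "Inr (Inl b) \<in> hyperedge e \<longleftrightarrow> b = snd e" "Inr (Inr c) \<in> hyperedge e \<longleftrightarrow> c = col e"
  unfolding hyperedge_def by auto

lemma cells_agree:
  assumes "e \<in> cells" "f \<in> cells"
  shows "fst e = fst f \<Longrightarrow> snd e = snd f \<Longrightarrow> e = f" "fst e = fst f \<Longrightarrow> col e = col f \<Longrightarrow> e = f"
    "snd e = snd f \<Longrightarrow> col e = col f \<Longrightarrow> e = f"
proof -
  show "e = f" if "fst e = fst f" "snd e = snd f" using that by (simp add: prod_eq_iff)
  show "e = f" if "fst e = fst f" "col e = col f"
    using inj_onD[OF class_inj(1) that(1)] that(2) assms unfolding colour_class_def by blast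
  show "e = f" if "snd e = snd f" "col e = col f"
    using inj_onD[OF class_inj(2) that(1)] that(2) assms unfolding colour_class_def by blast
qed

lemma inj_hyperedge: "inj_on hyperedge cells"
proof (rule inj_onI)
  fix e f assume "e \<in> cells" "f \<in> cells" and eq: "hyperedge e = hyperedge f"
  have "Inl (fst e) \<in> hyperedge f" "Inr (Inl (snd e)) \<in> hyperedge f" using eq[symmetric] by simp_all
  then show "e = f" by (simp add: prod_eq_iff)
qed

text \<open>Any two of row, column and colour determine a cell of a Latin array.\<close>

lemma hyperedge_linear:
  assumes "e \<in> cells" "f \<in> cells" "e \<noteq> f"
  shows "card (hyperedge e \<inter> hyperedge f) \<le> 1"
proof -
  have "u = v" if "u \<in> hyperedge e" "u \<in> hyperedge f" "v \<in> hyperedge e" "v \<in> hyperedge f" for u v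
    using that cells_agree[OF assms(1,2)] assms(3) unfolding hyperedge_def by (elim insertE emptyE; simp)
  moreover have "finite (hyperedge e \<inter> hyperedge f)" unfolding hyperedge_def by simp
  ultimately show ?thesis unfolding One_nat_def by (subst card_le_Suc0_iff_eq) auto
qed

text \<open>The nibble runs with degree bound \<open>k\<close>, as a row, a column or a colour meets
  at most \<open>k\<close> cells of \<open>G\<close>. The tally of a set of colours bounds its use,
  and the tally of all rows gives the size of \<open>M\<close>.\<close>

lemma rainbow_near_perfect:
  fixes Ar Br :: "nat set" and \<C> :: "'c set set"
  assumes A: "Ar \<subseteq> {..<n}" "card Ar = k" and B: "Br \<subseteq> {..<n}" "card Br = k" and k: "k > 0"
    and thr: "nibble_threshold (real k)" and size: "2 * real k + real n ^ 2 \<le> real k ^ 3"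
    and \<C>: "finite \<C>" "real (card \<C>) + 1 \<le> real k ^ 3" "\<And>C. C \<in> \<C> \<Longrightarrow> C \<subseteq> col ` cells \<and> card C \<le> 2 * k"
    and G: "G \<subseteq> Ar \<times> Br"
  obtains M where "M \<subseteq> G" "rainbow_partial M" "real (card G) / k - 6 * real k powr (9 / 10) \<le> real (card M)"
    "\<And>C. C \<in> \<C> \<Longrightarrow> real (card (C \<inter> col ` M)) \<le> (\<Sum>c\<in>C. real (card {e\<in>G. col e = c}) / k) + 6 * real k powr (9 / 10)"
proof -
  define V where "V = Inl ` Ar \<union> (Inr \<circ> Inl) ` Br \<union> (Inr \<circ> Inr) ` (col ` cells)"
  define E where "E = hyperedge ` G"
  have Gc: "G \<subseteq> cells" using G A B unfolding cells_def by auto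
  have fin: "finite Ar" "finite Br" "finite G"
    by (rule finite_subset[OF A(1)], simp, rule finite_subset[OF B(1)], simp, rule finite_subset[OF Gc], simp)
  have inj: "inj_on hyperedge G" using inj_on_subset[OF inj_hyperedge Gc] .
  have degs: "card {h\<in>E. v \<in> h} = card {e\<in>G. v \<in> hyperedge e}" for v
  proof -
    have "{h\<in>E. v \<in> h} = hyperedge ` {e\<in>G. v \<in> hyperedge e}" unfolding E_def by auto
    moreover have "inj_on hyperedge {e\<in>G. v \<in> hyperedge e}" by (rule inj_on_subset[OF inj]) auto
    ultimately show ?thesis by (simp add: card_image)
  qed
  have row: "card {e\<in>G. a = fst e} \<le> k" for a
  proof -
    have "card {e\<in>G. a = fst e} \<le> card Br"
      by (rule card_inj_on_le[of snd]) (use G fin in \<open>auto intro!: inj_onI simp: prod_eq_iff\<close>)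
    then show ?thesis using B by simp
  qed
  have column: "card {e\<in>G. b = snd e} \<le> k" for b
  proof -
    have "card {e\<in>G. b = snd e} \<le> card Ar"
      by (rule card_inj_on_le[of fst]) (use G fin in \<open>auto intro!: inj_onI simp: prod_eq_iff\<close>)
    then show ?thesis using A by simp
  qed
  have colour: "card {e\<in>G. c = col e} \<le> k" for c
  proof -
    have "card {e\<in>G. c = col e} \<le> card Ar"
    proof (rule card_inj_on_le[of fst])
      have "{e\<in>G. c = col e} \<subseteq> colour_class c" using Gc unfolding colour_class_def by auto
      then show "inj_on fst {e\<in>G. c = col e}" by (rule inj_on_subset[OF class_inj(1)])
    qed (use G fin in auto)
    then show ?thesis using A by simp
  qed
  interpret H: linear_3_graph V E "real k"
  proof
    show "finite V" unfolding V_def using fin by simp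
    show "real k > 0" using k by simp
    fix h assume "h \<in> E"
    then obtain e where e: "e \<in> G" "h = hyperedge e" unfolding E_def by auto
    show "h \<subseteq> V" using e(1) G Gc unfolding e(2) hyperedge_def V_def by auto
    show "card h = 3" unfolding e(2) hyperedge_def by simp
    fix h' assume "h' \<in> E" "h \<noteq> h'"
    then obtain f where f: "f \<in> G" "h' = hyperedge f" "e \<noteq> f" unfolding E_def e(2) by auto
    show "card (h \<inter> h') \<le> 1" unfolding e(2) f(2) using hyperedge_linear e f Gc by blast
  next
    fix v assume "v \<in> V"
    have "card {e\<in>G. v \<in> hyperedge e} \<le> k"
    proof (cases v)
      case (Inl a) then show ?thesis using row by simp
    next
      case (Inr w)
      show ?thesis
      proof (cases w)
        case (Inl b) then show ?thesis using column Inr by simp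
      next
        case (Inr c) then show ?thesis using colour \<open>v = Inr w\<close> by simp
      qed
    qed
    then show "real (card {h\<in>E. v \<in> h}) \<le> real k" unfolding degs by simp
  qed
  \<comment> \<open>The rows are one further prescribed set, because \<open>M\<close> covers as many
    rows as it has cells; this is the 1 added to \<open>card \<C>\<close> in the hypothesis.\<close>
  define \<T> :: "(nat + nat + 'c) set set" where "\<T> = insert (Inl ` Ar) ((\<lambda>C. (Inr \<circ> Inr) ` C) ` \<C>)"
  have "card V \<le> card (Inl ` Ar \<union> (Inr \<circ> Inl) ` Br :: (nat + nat + 'c) set) + card ((Inr \<circ> Inr) ` (col ` cells) :: (nat + nat + 'c) set)"
    unfolding V_def by (rule card_Un_le)
  also have "\<dots> \<le> (card Ar + card Br) + card cells"
    using fin by (intro add_mono order_trans[OF card_Un_le] card_image_le order_trans[OF card_image_le card_image_le]) auto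
  finally have "real (card V) \<le> real (card Ar + card Br + card cells)" by (rule of_nat_mono)
  moreover have "real (card Ar + card Br + card cells) = 2 * real k + real n ^ 2"
    using A B by (simp add: card_cells power2_eq_square)
  ultimately have cV: "real (card V) \<le> real k ^ 3" using size by linarith
  have cT: "real (card \<T>) \<le> real k ^ 3"
  proof -
    have "card \<T> \<le> Suc (card ((\<lambda>C. (Inr \<circ> Inr) ` C :: (nat + nat + 'c) set) ` \<C>))" unfolding \<T>_def using \<C>(1) by (simp add: card_insert_if)
    also have "\<dots> \<le> Suc (card \<C>)" using card_image_le[OF \<C>(1)] by simp
    finally show ?thesis using \<C>(2) by linarith
  qed
  have finT: "finite \<T>" unfolding \<T>_def using \<C>(1) by simp
  have T: "T \<subseteq> V \<and> real (card T) \<le> 2 * real k" if "T \<in> \<T>" for T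
  proof (cases "T = Inl ` Ar")
    case True
    then show ?thesis using A unfolding V_def by (auto simp: card_image)
  next
    case False
    then have "T \<in> (\<lambda>C. (Inr \<circ> Inr) ` C) ` \<C>" using that unfolding \<T>_def by blast
    then obtain C where C: "C \<in> \<C>" "T = (Inr \<circ> Inr) ` C" by blast
    have "card T \<le> card C" unfolding C(2) using \<C>(3)[OF C(1)] finite_subset[of C "col ` cells"] by (intro card_image_le) auto
    then have "card T \<le> 2 * k" using \<C>(3)[OF C(1)] by linarith
    moreover have "T \<subseteq> V" unfolding C(2) V_def using \<C>(3)[OF C(1)] by blast
    ultimately show ?thesis by simp
  qed
  obtain M' where M': "M' \<subseteq> E" "pairwise disjnt M'"
    and cnt: "\<And>T. T \<in> \<T> \<Longrightarrow> \<bar>real (card (T \<inter> \<Union>M')) - (\<Sum>v\<in>T. H.weight v)\<bar> \<le> 6 * real k powr (9 / 10)"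
    using H.pseudorandom_matching_powr[OF thr cV finT cT T] by blast
  define M where "M = {e\<in>G. hyperedge e \<in> M'}"
  have MG: "M \<subseteq> G" unfolding M_def by auto
  have eqM: "M' = hyperedge ` M" using M'(1) unfolding M_def E_def by auto
  have sep: "e = f" if "e \<in> M" "f \<in> M" "v \<in> hyperedge e" "v \<in> hyperedge f" for e f v
  proof (rule ccontr)
    assume "e \<noteq> f"
    then have "hyperedge e \<noteq> hyperedge f" using inj that(1,2) MG by (auto dest: inj_onD)
    then have "disjnt (hyperedge e) (hyperedge f)" using M'(2) that(1,2) unfolding M_def pairwise_def by blast
    then show False using that(3,4) unfolding disjnt_def by blast
  qed
  have rM: "rainbow_partial M" unfolding rainbow_partial_def
  proof (intro conjI inj_onI)
    show "M \<subseteq> cells" using MG Gc by blast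
  next
    fix e f assume "e \<in> M" "f \<in> M" "fst e = fst f" then show "e = f" using sep[of e f "Inl (fst e)"] by simp
  next
    fix e f assume "e \<in> M" "f \<in> M" "snd e = snd f" then show "e = f" using sep[of e f "Inr (Inl (snd e))"] by simp
  next
    fix e f assume "e \<in> M" "f \<in> M" "col e = col f" then show "e = f" using sep[of e f "Inr (Inr (col e))"] by simp
  qed
  have "Inl ` Ar \<inter> \<Union>M' = Inl ` (fst ` M)" using MG G unfolding eqM by (auto simp: hyperedge_def)
  then have "card (Inl ` Ar \<inter> \<Union>M') = card (fst ` M)" by (simp add: card_image)
  also have "\<dots> = card M" using rM unfolding rainbow_partial_def by (auto intro: card_image)
  finally have c1: "card (Inl ` Ar \<inter> \<Union>M') = card M" .
  have c2: "(\<Sum>v\<in>Inl ` Ar. H.weight v) = real (card G) / k"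
  proof -
    have "(\<Sum>v\<in>Inl ` Ar. H.weight v) = (\<Sum>a\<in>Ar. real (card {e\<in>G. a = fst e}) / k)"
      unfolding H.weight_def degs by (simp add: sum.reindex)
    also have "\<dots> = real (\<Sum>a\<in>Ar. card {e\<in>G. a = fst e}) / k" by (simp add: sum_divide_distrib)
    also have "(\<Sum>a\<in>Ar. card {e\<in>G. a = fst e}) = card (\<Union>a\<in>Ar. {e\<in>G. a = fst e})"
      using fin by (subst card_UN_disjoint) auto
    also have "(\<Union>a\<in>Ar. {e\<in>G. a = fst e}) = G" using G by auto
    finally show ?thesis .
  qed
  show thesis
  proof (rule that[OF MG rM])
    have "Inl ` Ar \<in> \<T>" unfolding \<T>_def by simp
    from cnt[OF this] show "real (card G) / k - 6 * real k powr (9 / 10) \<le> real (card M)" unfolding c1 c2 by linarith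
    fix C assume C: "C \<in> \<C>"
    have "(Inr \<circ> Inr) ` C \<inter> \<Union>M' = (Inr \<circ> Inr) ` (C \<inter> col ` M)" unfolding eqM by (auto simp: hyperedge_def)
    then have 1: "card ((Inr \<circ> Inr) ` C \<inter> \<Union>M') = card (C \<inter> col ` M)" by (simp add: card_image inj_on_def)
    have 2: "(\<Sum>v\<in>(Inr \<circ> Inr) ` C. H.weight v) = (\<Sum>c\<in>C. real (card {e\<in>G. col e = c}) / k)"
      unfolding H.weight_def degs by (subst sum.reindex) (auto simp: inj_on_def eq_commute[of "col _"])
    have "(Inr \<circ> Inr) ` C \<in> \<T>" unfolding \<T>_def using C by simp
    from cnt[OF this] show "real (card (C \<inter> col ` M)) \<le> (\<Sum>c\<in>C. real (card {e\<in>G. col e = c}) / k) + 6 * real k powr (9 / 10)"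
      unfolding 1 2 by linarith
  qed
qed

end

section \<open>Rainbow perfect matchings\<close>

text \<open>With $\<delta> = x^{-1/200} / 2$ this is the density $\<delta>^5 / 4096$ of \<^term>\<open>absorbers\<close> found above.\<close>

definition absorber_density :: "real \<Rightarrow> real" where
  "absorber_density x = (x powr (- 1 / 200) / 2)^5 / 4096"

text \<open>Here \<open>b * x / 24\<close> is a lower bound for the number s of absorbing cells, and
  b s / 128 one for m, whence 73728 = 24 * 24 * 128 in the bound for m s. As \<open>b\<close> is of
  order x^(-1/40), that clause compares x^(2 - 3/40) with x^(19/10).\<close>

definition large_order :: "nat \<Rightarrow> bool" where
  "large_order n \<longleftrightarrow> (let x = real n; b = absorber_density x in
     x \<ge> 1 \<and> b * x \<ge> 24 \<and> b * (b * x / 24) \<ge> 128 \<and> b ^ 3 * x^2 / 73728 \<ge> 120 * x powr (19 / 10)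
     \<and> 7 / 64 * (b * (b * x / 24)) \<ge> 46 * x powr (9 / 10) \<and> 2 * x^2 \<le> exp (b * (b * x / 24) / 8)
     \<and> 4 * x powr (1 / 200) \<le> x powr (9 / 10) \<and> x^2 + 2 * x + 1 \<le> (x / 2)^3)
   \<and> (\<forall>k. real n / 2 \<le> k \<longrightarrow> nibble_threshold k)"

lemma eventually_large_order: "eventually large_order sequentially"
proof -
  obtain K where K: "\<And>k. K \<le> k \<Longrightarrow> nibble_threshold k"
    using eventually_nibble_threshold unfolding eventually_at_top_linorder by blast
  have "\<forall>\<^sub>F n in sequentially. K \<le> real n / 2" by real_asymp
  then have thr: "\<forall>\<^sub>F n in sequentially. \<forall>k. real n / 2 \<le> k \<longrightarrow> nibble_threshold k"
    by eventually_elim (use K in \<open>auto intro: order_trans\<close>)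
  show ?thesis
    unfolding large_order_def Let_def eventually_conj_iff absorber_density_def by (intro conjI thr; real_asymp)
qed

lemma selection_parameters:
  assumes n: "large_order n" and \<beta>: "\<beta> = absorber_density (real n)"
  obtains s m :: nat where "s > 0" "4 * m \<le> s" "12 * real s \<le> \<beta> * n" "real m \<le> \<beta> * s / 64"
    "2 * real n ^ 2 \<le> exp (\<beta> * s / 8)" "120 * real n powr (19 / 10) \<le> real m * s" "46 * real n powr (9 / 10) \<le> 7 / 64 * (\<beta> * s)"
    "0 < \<beta>" "\<beta> \<le> real n powr (- 1 / 200) / 2 / 40"
proof -
  define x where "x = real n"
  define d where "d = x powr (- 1 / 200)"
  have L: "x \<ge> 1" "\<beta> * x \<ge> 24" "\<beta> * (\<beta> * x / 24) \<ge> 128" "\<beta> ^ 3 * x^2 / 73728 \<ge> 120 * x powr (19 / 10)"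
    "7 / 64 * (\<beta> * (\<beta> * x / 24)) \<ge> 46 * x powr (9 / 10)" "2 * x^2 \<le> exp (\<beta> * (\<beta> * x / 24) / 8)"
    using n unfolding large_order_def Let_def x_def \<beta> by auto
  have d: "0 < d" "d \<le> 1" unfolding d_def using L(1) powr_mono[of "- 1 / 200" 0 x] by auto
  have b: "\<beta> = d ^ 5 / 131072" unfolding \<beta> absorber_density_def x_def[symmetric] d_def[symmetric] by (simp add: power_divide)
  have b0: "0 < \<beta>" unfolding b using d(1) by simp
  have bd: "\<beta> \<le> d / 2 / 40"
  proof -
    have "d ^ 5 \<le> d ^ 1" using d by (intro power_decreasing) auto
    then show ?thesis using d b by simp
  qed
  \<comment> \<open>Rounding down costs at most a factor 2, as both numbers are at least 2. The
    divisor 12 is the one \<open>absorber_selection\<close> asks for; 64 makes m at most an eighth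
    of the \<open>\<beta> * s / 8\<close> absorbers of a pair.\<close>
  define s where "s = nat \<lfloor>\<beta> * x / 12\<rfloor>"
  define m where "m = nat \<lfloor>\<beta> * real s / 64\<rfloor>"
  have s: "real s \<le> \<beta> * x / 12" "\<beta> * x / 24 \<le> real s"
    unfolding s_def using L(2) by (linarith, linarith)
  have bs: "\<beta> * (\<beta> * x / 24) \<le> \<beta> * real s" using s b0 by (intro mult_left_mono) auto
  have m: "real m \<le> \<beta> * real s / 64" "\<beta> * real s / 128 \<le> real m"
    unfolding m_def using L(3) bs by (linarith, linarith)
  have s0: "0 < real s" using s L(2) by linarith
  have b1: "\<beta> \<le> 1" using bd d by simp
  show thesis
  proof (rule that[of s m])
    show "s > 0" using s0 by simp
    have "\<beta> * real s \<le> 1 * real s" using b1 by (intro mult_right_mono) auto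
    then have "4 * real m \<le> real s" using m(1) s0 by linarith
    then show "4 * m \<le> s" by linarith
    show "12 * real s \<le> \<beta> * n" using s(1) unfolding x_def by linarith
    show "real m \<le> \<beta> * s / 64" by (rule m(1))
    have "exp (\<beta> * (\<beta> * x / 24) / 8) \<le> exp (\<beta> * s / 8)" using bs by simp
    then show "2 * real n ^ 2 \<le> exp (\<beta> * s / 8)" using L(6) unfolding x_def by linarith
    show "46 * real n powr (9 / 10) \<le> 7 / 64 * (\<beta> * s)" using L(5) bs unfolding x_def by linarith
    have "\<beta> ^ 3 * x^2 / 73728 = (\<beta> * (\<beta> * x / 24) / 128) * (\<beta> * x / 24)" by (simp add: power2_eq_square power3_eq_cube)
    also have "\<dots> \<le> real m * real s"
    proof (rule mult_mono)
      show "\<beta> * (\<beta> * x / 24) / 128 \<le> real m" using m(2) bs by linarith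
    qed (use s b0 L(1) in auto)
    finally show "120 * real n powr (19 / 10) \<le> real m * s" using L(4) unfolding x_def by linarith
    show "0 < \<beta>" by (rule b0)
    show "\<beta> \<le> real n powr (- 1 / 200) / 2 / 40" using bd unfolding d_def x_def .
  qed
qed

context latin_array
begin

theorem rainbow_transversal:
  assumes large: "large_order n" and colours: "real n powr (- 1 / 200) * real n ^ 2 \<le> real (card (col ` cells))"
  shows "\<exists>F. rainbow_partial F \<and> card F = n"
proof -
  define N where "N = real n"
  define E where "E = N powr (9 / 10)"
  define d where "d = N powr (- 1 / 200)"
  define \<delta> where "\<delta> = d / 2"
  define \<beta> where "\<beta> = \<delta>^5 / 4096"
  have L: "N \<ge> 1" "4 * N powr (1 / 200) \<le> E" "N^2 + 2 * N + 1 \<le> (N / 2)^3" and thr: "\<And>k. N / 2 \<le> k \<Longrightarrow> nibble_threshold k"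
    using large unfolding large_order_def Let_def N_def E_def by auto
  have E1: "E \<ge> 1" unfolding E_def using L(1) by (simp add: ge_one_powr_ge_zero)
  have d: "0 < d" "d \<le> 1" unfolding d_def using L(1) powr_mono[of "- 1 / 200" 0 N] by auto
  have dE: "4 / d \<le> E" unfolding d_def using L(2) by (simp add: powr_minus_divide)
  have \<delta>: "0 < \<delta>" "\<delta> \<le> 1" unfolding \<delta>_def using d by auto
  obtain s m where s: "s > 0" "4 * m \<le> s" "12 * real s \<le> \<beta> * n" "real m \<le> \<beta> * s / 64"
    "2 * real n ^ 2 \<le> exp (\<beta> * s / 8)" "120 * N powr (19 / 10) \<le> real m * s" "46 * E \<le> 7 / 64 * (\<beta> * s)"
    and \<beta>: "0 < \<beta>" "\<beta> \<le> \<delta> / 40"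
    using selection_parameters[OF large, of \<beta>] unfolding \<beta>_def \<delta>_def d_def N_def E_def absorber_density_def by blast
  have bN: "\<beta> * N \<le> \<delta> / 40 * N" using \<beta> L(1) by (intro mult_right_mono) auto
  have dN: "\<delta> * N \<le> 1 * N" using \<delta> L(1) by (intro mult_right_mono) auto
  have sN: "12 * real s \<le> \<delta> / 40 * N" using s(3) bN unfolding N_def by linarith
  have msr: "4 * real m \<le> real s" using s(2) by linarith
  have s4: "4 * real s \<le> N" using sN dN L(1) by linarith
  have sm: "s + m \<le> n" using s4 msr unfolding N_def by linarith
  define k where "k = n - (m + s)"
  have kr: "real k = N - m - s" using sm unfolding k_def N_def by (simp add: of_nat_diff)
  have k2: "N / 2 \<le> real k" "real k \<le> N" "k > 0" "s \<le> k" "m \<le> k"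
    using kr s4 msr L(1) by linarith+
  have mE: "120 * E \<le> real m"
  proof -
    have "N powr (19 / 10) = E * N" unfolding E_def using L(1) powr_mult_base[of N "9 / 10"] by (simp add: mult.commute)
    then have "120 * E * N \<le> real m * s" using s(6) by simp
    also have "\<dots> \<le> real m * N" using s4 by (intro mult_left_mono) auto
    finally show ?thesis using L(1) by simp
  qed
  have kE: "real k powr (9 / 10) \<le> E" unfolding E_def using k2 by (intro powr_mono2) auto
  have k3: "N^2 + 2 * N + 1 \<le> real k ^ 3"
  proof -
    have "(N / 2) ^ 3 \<le> real k ^ 3" using k2 L(1) by (intro power_mono) auto
    then show ?thesis using L(3) by linarith
  qed
  obtain R where R: "R \<subseteq> cells" "inj_on col R" "\<And>e. e \<in> R \<Longrightarrow> real (card (colour_class (col e))) \<le> 2 / d" "\<delta> * real n ^ 2 \<le> real (card R)"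
    using sparse_representatives[OF d(1)] colours unfolding \<delta>_def d_def N_def by blast
  have "R \<subseteq> {..<n} \<times> {..<n}" using R(1) unfolding cells_def .
  then obtain A' B' where AB': "A' \<subseteq> {..<n}" "B' \<subseteq> {..<n}" "\<delta> / 8 * n \<le> real (card A')" "\<delta> / 8 * n \<le> real (card B')"
    and paths: "\<And>a b. a \<in> A' \<Longrightarrow> b \<in> B' \<Longrightarrow> \<beta> * real n ^ 2 \<le> real (card (absorbers R R a b))"
    using many_three_edge_paths[of "{..<n}" "{..<n}" n R \<delta>] n_pos \<delta>(1) R(4) unfolding \<beta>_def by auto
  have "real m \<le> \<delta> / 8 * N" using msr sN mult_nonneg_nonneg[of \<delta> N] \<delta> L(1) by linarith
  then have "m \<le> card A'" "m \<le> card B'" using AB'(3,4) unfolding N_def by linarith+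
  then obtain A0 B0 where A0: "A0 \<subseteq> A'" "card A0 = m" and B0: "B0 \<subseteq> B'" "card B0 = m"
    by (meson obtain_subset_with_card_n)
  have sub0: "A0 \<subseteq> {..<n}" "B0 \<subseteq> {..<n}" using A0 B0 AB' by auto
  have fin0: "finite A0" "finite B0" by (rule finite_subset[OF sub0(1)], simp, rule finite_subset[OF sub0(2)], simp)
  obtain Q where Q: "Q \<subseteq> R" "card Q = s" "inj_on fst Q" "inj_on snd Q" "fst ` Q \<inter> A0 = {}" "snd ` Q \<inter> B0 = {}"
    and colQ: "col ` Q \<inter> col ` ({..<n} \<times> B0 \<union> A0 \<times> {..<n}) = {}"
    and hits: "\<And>a b. a \<in> A0 \<Longrightarrow> b \<in> B0 \<Longrightarrow> \<beta> * s / 8 \<le> real (card (absorbers R Q a b))"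
    and slack: "\<And>c. real (card (colour_class c \<inter> ({..<n} - (A0 \<union> fst ` Q)) \<times> ({..<n} - (B0 \<union> snd ` Q)))) + s / 4 \<le> real n - s - m"
  proof (rule absorber_selection[OF R(1,2,4) \<delta> \<beta> sub0(1) A0(2) sub0(2) B0(2) s(1,2,3) _ s(5)])
    show "\<beta> * real n ^ 2 \<le> real (card (absorbers R R a b))" if "a \<in> A0" "b \<in> B0" for a b
      using paths that A0 B0 by blast
  qed (rule that; blast)
  define H where "H a b = absorbers R Q a b" for a b
  define Ar where "Ar = {..<n} - (A0 \<union> fst ` Q)"
  define Br where "Br = {..<n} - (B0 \<union> snd ` Q)"
  define G where "G = {e \<in> Ar \<times> Br. col e \<notin> col ` Q}"
  have subQ: "fst ` Q \<subseteq> {..<n}" "snd ` Q \<subseteq> {..<n}" "Q \<subseteq> cells" using Q(1) R(1) unfolding cells_def by auto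
  have finQ: "finite Q" by (rule finite_subset[OF subQ(3)]) simp
  have AB: "Ar \<subseteq> {..<n}" "Br \<subseteq> {..<n}" "card Ar = k" "card Br = k"
  proof -
    have "card (A0 \<union> fst ` Q) = m + s" "card (B0 \<union> snd ` Q) = m + s"
      using card_Un_disjoint[of A0 "fst ` Q"] card_Un_disjoint[of B0 "snd ` Q"] fin0 finQ Q A0 B0
      by (auto simp: card_image Int_commute)
    then show "card Ar = k" "card Br = k" unfolding Ar_def Br_def k_def
      using card_Diff_subset[of "A0 \<union> fst ` Q" "{..<n}"] card_Diff_subset[of "B0 \<union> snd ` Q" "{..<n}"] fin0 finQ sub0 subQ by auto
    show "Ar \<subseteq> {..<n}" "Br \<subseteq> {..<n}" unfolding Ar_def Br_def by auto
  qed
  have finAB: "finite Ar" "finite Br" "finite G" unfolding G_def Ar_def Br_def by auto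
  \<comment> \<open>The colours that the nibble must not overuse: those of a row in
    \<open>B0\<close>, those of a column in \<open>A0\<close>, and those of the replacement cells of
    all absorbers of a pair.\<close>
  define CR where "CR x = (\<lambda>b. col (x, b)) ` B0" for x
  define CC where "CC y = (\<lambda>a. col (a, y)) ` A0" for y
  define CD where "CD p = (\<lambda>e. col (fst p, snd e)) ` H (fst p) (snd p) \<union> (\<lambda>e. col (fst e, snd p)) ` H (fst p) (snd p)" for p
  define \<C> where "\<C> = CR ` Ar \<union> CC ` Br \<union> CD ` (A0 \<times> B0)"
  have HQ: "H a b \<subseteq> Q" "finite (H a b)" "card (H a b) \<le> s" for a b
  proof -
    show 1: "H a b \<subseteq> Q" unfolding H_def by auto
    show "finite (H a b)" using 1 finQ by (rule finite_subset)
    show "card (H a b) \<le> s" using card_mono[OF finQ 1] Q(2) by simp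
  qed
  have CRC: "card (CR x) \<le> m" "card (CC y) \<le> m" for x y
    unfolding CR_def CC_def using card_image_le[OF fin0(1)] card_image_le[OF fin0(2)] A0 B0 by auto
  have CDc: "card (CD p) \<le> 2 * s" for p
  proof -
    have "card (CD p) \<le> card (H (fst p) (snd p)) + card (H (fst p) (snd p))"
      unfolding CD_def using HQ by (intro order_trans[OF card_Un_le] add_mono card_image_le)
    then show ?thesis using HQ(3)[of "fst p" "snd p"] by linarith
  qed
  have CDR: "CD p \<subseteq> col ` R" for p unfolding CD_def H_def by auto
  have \<C>: "finite \<C>" "real (card \<C>) + 1 \<le> real k ^ 3" "\<And>C. C \<in> \<C> \<Longrightarrow> C \<subseteq> col ` cells \<and> card C \<le> 2 * k"
  proof -
    show "finite \<C>" unfolding \<C>_def using finAB fin0 by auto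
    have "card \<C> \<le> card (CR ` Ar \<union> CC ` Br) + card (CD ` (A0 \<times> B0))" unfolding \<C>_def by (rule card_Un_le)
    also have "card (CR ` Ar \<union> CC ` Br) \<le> card (CR ` Ar) + card (CC ` Br)" by (rule card_Un_le)
    also have "card (CR ` Ar) \<le> n" using card_image_le[OF finAB(1), of CR] AB k_def by linarith
    also have "card (CC ` Br) \<le> n" using card_image_le[OF finAB(2), of CC] AB k_def by linarith
    also have "card (CD ` (A0 \<times> B0)) \<le> n * n"
    proof -
      have "card (CD ` (A0 \<times> B0)) \<le> card (A0 \<times> B0)" using fin0 by (intro card_image_le) auto
      also have "\<dots> \<le> n * n" using A0 B0 sm by (simp add: card_cartesian_product mult_mono)
      finally show ?thesis .
    qed
    finally have "card \<C> \<le> n + n + n * n" by simp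
    then have "real (card \<C>) \<le> real (n + n + n * n)" by (rule of_nat_mono)
    then show "real (card \<C>) + 1 \<le> real k ^ 3" using k3 unfolding N_def by (simp add: power2_eq_square)
    fix C assume "C \<in> \<C>"
    then consider x where "x \<in> Ar" "C = CR x" | y where "y \<in> Br" "C = CC y" | p where "C = CD p" unfolding \<C>_def by blast
    then show "C \<subseteq> col ` cells \<and> card C \<le> 2 * k"
    proof cases
      case 1
      have "C \<subseteq> col ` cells" unfolding 1(2) CR_def cells_def using 1(1) AB sub0 by auto
      moreover have "card C \<le> 2 * k" using CRC(1)[of x] k2(5) unfolding 1(2) by linarith
      ultimately show ?thesis ..
    next
      case 2
      have "C \<subseteq> col ` cells" unfolding 2(2) CC_def cells_def using 2(1) AB sub0 by auto
      moreover have "card C \<le> 2 * k" using CRC(2)[of y] k2(5) unfolding 2(2) by linarith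
      ultimately show ?thesis ..
    next
      case 3
      have "C \<subseteq> col ` cells" using CDR[of p] R(1) unfolding 3 by blast
      moreover have "card C \<le> 2 * k" using CDc[of p] k2(4) unfolding 3 by linarith
      ultimately show ?thesis ..
    qed
  qed
  have "2 * real k + real n ^ 2 \<le> real k ^ 3" using k3 k2(2) unfolding N_def by linarith
  then obtain M where M: "M \<subseteq> G" "rainbow_partial M" "real (card G) / k - 6 * real k powr (9 / 10) \<le> real (card M)"
    and used: "\<And>C. C \<in> \<C> \<Longrightarrow> real (card (C \<inter> col ` M)) \<le> (\<Sum>c\<in>C. real (card {e\<in>G. col e = c}) / k) + 6 * real k powr (9 / 10)"
    using rainbow_near_perfect[OF AB(1,3,2,4) k2(3) thr[OF k2(1)] _ \<C>, of G] unfolding G_def by blast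
  have k0: "real k > 0" using k2 by simp
  have GC: "{e\<in>G. col e = c} \<subseteq> colour_class c \<inter> Ar \<times> Br" for c
    using AB unfolding G_def colour_class_def cells_def by auto
  \<comment> \<open>\<open>G\<close> omits only the colours of \<open>Q\<close>. They are colours of
    \<open>R\<close>, so each has at most \<open>2 / d\<close> cells, which costs at most
    \<open>2 / d\<close> in the size of \<open>M\<close>; the error of the nibble adds
    \<open>6 * E\<close>.\<close>
  have cM: "real k \<le> real (card M) + 7 * E"
  proof -
    have "Ar \<times> Br \<subseteq> G \<union> (\<Union>q\<in>Q. colour_class (col q))"
      using AB unfolding G_def colour_class_def cells_def by auto
    then have "card (Ar \<times> Br) \<le> card (G \<union> (\<Union>q\<in>Q. colour_class (col q)))" using finAB finQ by (intro card_mono) auto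
    also have "\<dots> \<le> card G + card (\<Union>q\<in>Q. colour_class (col q))" by (rule card_Un_le)
    also have "card (\<Union>q\<in>Q. colour_class (col q)) \<le> (\<Sum>q\<in>Q. card (colour_class (col q)))" by (rule card_UN_le[OF finQ])
    finally have "real (card (Ar \<times> Br)) \<le> real (card G) + (\<Sum>q\<in>Q. real (card (colour_class (col q))))"
      by (simp flip: of_nat_sum of_nat_add)
    also have "(\<Sum>q\<in>Q. real (card (colour_class (col q)))) \<le> (\<Sum>q\<in>Q. 2 / d)" using R(3) Q(1) by (intro sum_mono) auto
    also have "\<dots> = s * (2 / d)" using Q(2) by simp
    also have "\<dots> \<le> real k * (2 / d)" using k2(4) d by (intro mult_right_mono) auto
    finally have "real k * real k \<le> real (card G) + real k * (2 / d)" using AB by (simp add: card_cartesian_product)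
    then have "real k \<le> real (card G) / k + 2 / d" using k0 by (simp add: field_simps)
    moreover have "2 / d \<le> E" using dE d by (simp add: field_simps)
    ultimately show ?thesis using M(3) kE by linarith
  qed
  \<comment> \<open>An integer bound for the number of uncovered rows.\<close>
  define l where "l = nat \<lceil>7 * E\<rceil>"
  have l: "7 * E \<le> real l" "real l \<le> 8 * E" unfolding l_def using E1 by linarith+
  \<comment> \<open>Since each colour falls short of \<open>k\<close> by \<open>s / 4\<close>, the
    expected use is below m by m s / (4 k) \<ge> 30 E, and the error of the nibble takes back 6 E.
    The remaining 24 E are enough for 3 l, as l \<le> 8 E.\<close>
  have few: "real (card (C \<inter> col ` M)) \<le> m - 24 * E" if C: "C \<in> \<C>" "card C \<le> m" for C
  proof -
    have "(\<Sum>c\<in>C. real (card {e\<in>G. col e = c}) / k) \<le> (\<Sum>c\<in>C. (real k - s / 4) / k)"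
    proof (intro sum_mono divide_right_mono)
      fix c
      have "card {e\<in>G. col e = c} \<le> card (colour_class c \<inter> Ar \<times> Br)" using GC finAB by (intro card_mono) auto
      then show "real (card {e\<in>G. col e = c}) \<le> real k - s / 4"
        using slack[of c] kr unfolding Ar_def[symmetric] Br_def[symmetric] N_def by linarith
    qed simp
    also have "\<dots> = real (card C) * ((real k - s / 4) / k)" by simp
    also have "\<dots> \<le> real m * ((real k - s / 4) / k)" using C(2) k2(4) k0 by (intro mult_right_mono) auto
    also have "\<dots> = m - real m * s / (4 * k)" using k0 by (simp add: field_simps)
    finally have 1: "(\<Sum>c\<in>C. real (card {e\<in>G. col e = c}) / k) \<le> m - real m * s / (4 * k)" .
    have "30 * E \<le> real m * s / (4 * k)"
    proof -
      have "N powr (19 / 10) = E * N" unfolding E_def using L(1) powr_mult_base[of N "9 / 10"] by (simp add: mult.commute)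
      then have "120 * (E * N) \<le> real m * s" using s(6) by simp
      moreover have "E * k \<le> E * N" using k2(2) E1 by (intro mult_left_mono) auto
      ultimately have "120 * (E * k) \<le> real m * s" by linarith
      then show ?thesis using k0 by (simp add: field_simps)
    qed
    then show ?thesis using 1 used[OF C(1)] kE by linarith
  qed
  show ?thesis
  proof (rule rainbow_completion[OF R(1,2) Q(1,3,4) sub0(1) A0(2) Q(5) sub0(2) B0(2) Q(6) colQ M(2) _ _ Ar_def Br_def])
    show "M \<subseteq> Ar \<times> Br" using M(1) unfolding G_def by auto
    show "col ` M \<inter> col ` Q = {}" using M(1) unfolding G_def by auto
    show "card Ar \<le> card M + l" using cM l AB by linarith
    show "l \<le> m" using l mE E1 by linarith
  next
    fix x assume x: "x \<in> Ar"
    then have xn: "x < n" using AB by auto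
    have "{b\<in>B0. col (x, b) \<in> col ` M} = {b\<in>B0. col (x, b) \<in> CR x \<inter> col ` M}" unfolding CR_def by auto
    then have "card {b\<in>B0. col (x, b) \<in> col ` M} \<le> card (CR x \<inter> col ` M)"
      using row_colours_le[OF xn sub0(2), of "CR x \<inter> col ` M"] fin0 unfolding CR_def by simp
    moreover have "real (card (CR x \<inter> col ` M)) \<le> m - 24 * E" using few CRC x unfolding \<C>_def by blast
    moreover have "card {b\<in>B0. col (x, b) \<in> col ` M} + card {b\<in>B0. col (x, b) \<notin> col ` M} = m"
      unfolding B0(2)[symmetric] using fin0 by (subst card_Un_disjoint[symmetric]) (auto intro!: arg_cong[of _ _ card])
    ultimately have "24 * E \<le> real (card {b\<in>B0. col (x, b) \<notin> col ` M})" by linarith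
    then show "2 * l \<le> card {b\<in>B0. col (x, b) \<notin> col ` M}" using l E1 by linarith
  next
    fix y assume y: "y \<in> Br"
    then have yn: "y < n" using AB by auto
    have "{a\<in>A0. col (a, y) \<in> col ` M} = {a\<in>A0. col (a, y) \<in> CC y \<inter> col ` M}" unfolding CC_def by auto
    then have "card {a\<in>A0. col (a, y) \<in> col ` M} \<le> card (CC y \<inter> col ` M)"
      using column_colours_le[OF yn sub0(1), of "CC y \<inter> col ` M"] fin0 unfolding CC_def by simp
    moreover have "real (card (CC y \<inter> col ` M)) \<le> m - 24 * E" using few CRC y unfolding \<C>_def by blast
    moreover have "card {a\<in>A0. col (a, y) \<in> col ` M} + card {a\<in>A0. col (a, y) \<notin> col ` M} = m"
      unfolding A0(2)[symmetric] using fin0 by (subst card_Un_disjoint[symmetric]) (auto intro!: arg_cong[of _ _ card])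
    ultimately have "24 * E \<le> real (card {a\<in>A0. col (a, y) \<notin> col ` M})" by linarith
    then show "3 * l \<le> card {a\<in>A0. col (a, y) \<notin> col ` M}" using l E1 by linarith
  next
    fix a b assume ab: "a \<in> A0" "b \<in> B0"
    let ?h = "H a b"
    let ?D = "CD (a, b) \<inter> col ` M"
    let ?K1 = "{e\<in>Q. (a, snd e) \<in> R \<and> col (a, snd e) \<in> ?D}" and ?K2 = "{e\<in>Q. (fst e, b) \<in> R \<and> col (fst e, b) \<in> ?D}"
    let ?g = "{e\<in>Q. (a, snd e) \<in> R \<and> (fst e, b) \<in> R \<and> col (a, snd e) \<notin> col ` M \<and> col (fst e, b) \<notin> col ` M}"
    \<comment> \<open>Colours of replacement cells are colours of \<open>R\<close>, with at most
      \<open>2 / d\<close> cells each, so their expected use is at most \<open>4 / d\<close>, hence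
      at most \<open>E\<close>; the error of the nibble adds \<open>6 * E\<close>.\<close>
    have D: "real (card ?D) \<le> 7 * E"
    proof -
      have "(\<Sum>c\<in>CD (a, b). real (card {e\<in>G. col e = c}) / k) \<le> (\<Sum>c\<in>CD (a, b). (2 / d) / k)"
      proof (intro sum_mono divide_right_mono)
        fix c assume "c \<in> CD (a, b)"
        then obtain e where e: "e \<in> R" "c = col e" using CDR[of "(a, b)"] by auto
        have "card {e\<in>G. col e = c} \<le> card (colour_class c)" using GC by (intro card_mono) auto
        then show "real (card {e\<in>G. col e = c}) \<le> 2 / d" using R(3)[OF e(1)] unfolding e(2) by linarith
      qed simp
      also have "\<dots> = real (card (CD (a, b))) * ((2 / d) / k)" by simp
      also have "\<dots> \<le> (2 * real k) * ((2 / d) / k)"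
      proof (rule mult_right_mono)
        show "real (card (CD (a, b))) \<le> 2 * real k" using CDc[of "(a, b)"] k2(4) by linarith
      qed (use d k0 in simp)
      also have "\<dots> = 4 / d" using k0 by simp
      finally have "(\<Sum>c\<in>CD (a, b). real (card {e\<in>G. col e = c}) / k) \<le> E" using dE by linarith
      moreover have "CD (a, b) \<in> \<C>" unfolding \<C>_def using ab by blast
      ultimately show ?thesis using used[of "CD (a, b)"] kE by linarith
    qed
    have finD: "finite ?D" unfolding CD_def using HQ(2) by auto
    have K: "card ?K1 \<le> card ?D" "card ?K2 \<le> card ?D" by (rule absorber_colours_le[OF R(2) Q(3,4) finD])+
    have "?h \<subseteq> ?g \<union> ?K1 \<union> ?K2"
    proof
      fix e assume e: "e \<in> ?h"
      then have "col (a, snd e) \<in> CD (a, b)" "col (fst e, b) \<in> CD (a, b)" unfolding CD_def by auto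
      then show "e \<in> ?g \<union> ?K1 \<union> ?K2" using e unfolding H_def by blast
    qed
    then have "card ?h \<le> card (?g \<union> ?K1 \<union> ?K2)" using finQ HQ(2) by (intro card_mono) auto
    also have "\<dots> \<le> card ?g + card ?K1 + card ?K2"
      using card_Un_le[of "?g \<union> ?K1" ?K2] card_Un_le[of ?g ?K1] by linarith
    finally have "card ?h \<le> card ?g + 2 * card ?D" using K by linarith
    then have "real (card ?h) \<le> real (card ?g) + 2 * real (card ?D)" by linarith
    then have "\<beta> * s / 8 - 14 * E \<le> real (card ?g)" using hits[OF ab, folded H_def] D by linarith
    \<comment> \<open>As m \<le> \<beta> s / 64 and 4 l \<le> 32 E, this amounts to 7/64 \<beta> s
      \<ge> 14 E + 32 E = 46 E.\<close>
    then have "real m + 4 * real l \<le> real (card ?g)" using s(4,7) l(2) by linarith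
    then show "m + 4 * l \<le> card ?g" by linarith
  qed
qed

end

section \<open>From arrays back to edge-colourings\<close>

theorem theorem1p1:
  shows "\<exists>n0::nat. \<forall>n\<ge>n0. \<forall>(d::real) (c :: (nat + nat) set \<Rightarrow> 'c).
           proper_edge_colouring (complete_bipartite_edges n) c \<longrightarrow>
           real (card (c ` complete_bipartite_edges n)) = d * real n ^ 2 \<longrightarrow>
           d > real n powr (- 1 / 200) \<longrightarrow>
           (\<exists>M. perfect_matching n M \<and> rainbow c M)"
proof -
  obtain n0 where n0: "\<And>n. n0 \<le> n \<Longrightarrow> large_order n"
    using eventually_large_order unfolding eventually_sequentially by blast
  show ?thesis
  proof (intro exI[of _ n0] allI impI)
    fix n d and c :: "(nat + nat) set \<Rightarrow> 'c"
    assume n: "n0 \<le> n" and proper: "proper_edge_colouring (complete_bipartite_edges n) c"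
      and card: "real (card (c ` complete_bipartite_edges n)) = d * real n ^ 2" and d: "d > real n powr (- 1 / 200)"
    have large: "large_order n" using n0 n by blast
    define edge :: "nat \<times> nat \<Rightarrow> (nat + nat) set" where "edge e = {Inl (fst e), Inr (snd e)}" for e
    have [simp]: "Inl i \<in> edge e \<longleftrightarrow> i = fst e" "Inr j \<in> edge e \<longleftrightarrow> j = snd e" for i j e
      unfolding edge_def by auto
    have edge_mem: "edge (i, j) \<in> complete_bipartite_edges n" if "i < n" "j < n" for i j
      using that unfolding edge_def complete_bipartite_edges_def by auto
    have edge_inj: "e = f" if "edge e = edge f" for e f
    proof -
      have "Inl (fst e) \<in> edge f" "Inr (snd e) \<in> edge f" unfolding that[symmetric] by simp_all
      then show ?thesis by (simp add: prod_eq_iff)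
    qed
    \<comment> \<open>Properness gives both Latin conditions at once: edges with a common end and
      the same colour coincide.\<close>
    have pr: "e = f" if "edge e \<in> complete_bipartite_edges n" "edge f \<in> complete_bipartite_edges n" "v \<in> edge e" "v \<in> edge f" "c (edge e) = c (edge f)" for e f v
      using proper that edge_inj[of e f] unfolding proper_edge_colouring_def by blast
    interpret latin_array n "\<lambda>e. c (edge e)"
    proof
      show "0 < n" using large unfolding large_order_def Let_def by auto
      show "j = j'" if "i < n" "j < n" "j' < n" "c (edge (i, j)) = c (edge (i, j'))" for i j j'
        using pr[of "(i, j)" "(i, j')" "Inl i"] edge_mem that by simp
      show "i = i'" if "i < n" "i' < n" "j < n" "c (edge (i, j)) = c (edge (i', j))" for i i' j
        using pr[of "(i, j)" "(i', j)" "Inr j"] edge_mem that by simp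
    qed
    have "complete_bipartite_edges n = edge ` cells"
      unfolding complete_bipartite_edges_def cells_def edge_def by force
    then have "c ` complete_bipartite_edges n = (\<lambda>e. c (edge e)) ` cells" by auto
    moreover have "real n powr (- 1 / 200) * real n ^ 2 \<le> d * real n ^ 2" using d by (intro mult_right_mono) auto
    ultimately have "real n powr (- 1 / 200) * real n ^ 2 \<le> real (card ((\<lambda>e. c (edge e)) ` cells))" using card by simp
    from rainbow_transversal[OF large this] obtain F where F: "rainbow_partial F" "card F = n" by blast
    have Fp: "F \<subseteq> cells" "inj_on fst F" "inj_on snd F" "inj_on (\<lambda>e. c (edge e)) F" using F(1) unfolding rainbow_partial_def by auto
    have full: "fst ` F = {..<n}" "snd ` F = {..<n}"
    proof -
      have "fst ` F \<subseteq> {..<n}" "snd ` F \<subseteq> {..<n}" using Fp(1) unfolding cells_def by auto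
      then show "fst ` F = {..<n}" "snd ` F = {..<n}"
        using F(2) Fp(2,3) by (simp_all add: card_subset_eq card_image)
    qed
    have "perfect_matching n (edge ` F)"
      unfolding perfect_matching_def matching_def
    proof (intro conjI)
      show "edge ` F \<subseteq> complete_bipartite_edges n" using Fp(1) edge_mem unfolding cells_def by auto
      show "disjoint (edge ` F)"
      proof (rule disjointI)
        fix x y assume "x \<in> edge ` F" "y \<in> edge ` F" and ne: "x \<noteq> y"
        then obtain e f where ef: "e \<in> F" "f \<in> F" "x = edge e" "y = edge f" by blast
        have "fst e \<noteq> fst f" "snd e \<noteq> snd f" using Fp(2,3) ef ne by (auto dest: inj_onD)
        then show "x \<inter> y = {}" unfolding ef edge_def by auto
      qed
      show "card (edge ` F) = n" using F(2) edge_inj by (simp add: card_image inj_on_def)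
      have "\<Union>(edge ` F) = Inl ` fst ` F \<union> Inr ` snd ` F" unfolding edge_def by auto
      then show "\<Union>(edge ` F) = complete_bipartite_verts n" unfolding full complete_bipartite_verts_def Plus_def .
    qed
    moreover have "rainbow c (edge ` F)"
      using Fp(4) unfolding rainbow_def by (auto simp: inj_on_def)
    ultimately show "\<exists>M. perfect_matching n M \<and> rainbow c M" by blast
  qed
qed

end
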